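(* Let $X$ be a centered Gaussian random vector in a separable Hilbert space $H$ whose covariance operator $C_Xy={\mathbb E}(\langle y,X\rangle X)$ has infinitely many nonzero eigenvalues $\lambda_1\ge\lambda_2\ge\dots>0$, with orthonormal eigenvectors $(u_j)_{j\ge1}$ and $Z_j:=\langle X,u_j\rangle/\lambda_j^{1/2}$ (i.i.d. $N(0,1)$). Assume $\lambda_j\sim\varphi(j)$ as $j\to\infty$, where $\varphi:(s,\infty)\to(0,\infty)$ ($s\ge0$) is decreasing and regularly varying at infinity with index $-b<-1$. Fix $\vartheta\in(0,1)$ and for $n\in{\mathbb N}$ set $l=l_n:=[(\max\{1,\log n\})^\vartheta]$, \[m=m(n,l):=\max\Big\{k\ge1:\ n^{1/k}\lambda_{(k-1)l+1}^{l/2}\Big(\prod_{j=1}^k\lambda_{(j-1)l+1}\Big)^{-l/(2k)}\ge1\Big\},\] \[n_j:=\Big[n^{1/m}\lambda^{l/2}_{(j-1)l+1}\Big(\prod_{i=1}^m\lambda_{(i-1)l+1}\Big)^{-l/(2m)}\Big],\quad j=1,\dots,m,\] where $[x]$ is the integer part of $x$. For $j=1,\dots,m$ let $Z^{(j)}:=(Z_{(j-1)l+1},\dots,Z_{jl})$, let $\alpha_j\subset{\mathbb R}^l$ be an $L^2$-optimal $n_j$-quantizer of $Z^{(j)}$, let $\widehat{Z^{(j)}}$ be a Voronoi $\alpha_j$-quantization of $Z^{(j)}$, and define \[\hat X^n:=\sum_{j=1}^m\sum_{k=1}^l\lambda^{1/2}_{(j-1)l+k}(\widehat{Z^{(j)}})_k\,u_{(j-1)l+k}.\]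 Then $({\mathbb E}\|X-\hat X^n\|^2)^{1/2}\sim e_n(X)$ as $n\to\infty$.
   Context: A measurable $\varphi:(s,\infty)\to(0,\infty)$ is regularly varying at infinity with index $c\in{\mathbb R}$ if $\varphi(tx)/\varphi(x)\to t^{c}$ as $x\to\infty$ for every $t>0$. For a random vector $Y$ in ${\mathbb R}^l$ (Euclidean norm) or in $H$ with finite second moment, $e_k(Y):=\inf\{({\mathbb E}\min_{a\in\alpha}\|Y-a\|^2)^{1/2}:\mathrm{card}(\alpha)\le k\}$; an $L^2$-optimal $k$-quantizer attains this infimum. A Voronoi $\alpha$-quantization of $Y$ is $\sum_{a\in\alpha}a\mathbf 1_{C_a(\alpha)}(Y)$ for a Borel partition $\{C_a(\alpha)\}$ with $C_a(\alpha)\subset\{x:\|x-a\|=\min_{c\in\alpha}\|x-c\|\}$. $a_n\sim b_n$ means $a_n/b_n\to1$. *)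

theory Defs
  imports "HOL-Probability.Probability" "HOL-Library.Landau_Symbols"
begin

definition centered_gaussian :: "'w measure \<Rightarrow> ('w \<Rightarrow> 'h::{real_inner,banach,second_countable_topology}) \<Rightarrow> bool" where
  "centered_gaussian M X \<longleftrightarrow> X \<in> borel_measurable M \<and>
     (\<forall>y. (AE \<omega> in M. y \<bullet> X \<omega> = 0) \<or>
          (\<exists>\<sigma>>0. distributed M lborel (\<lambda>\<omega>. y \<bullet> X \<omega>) (normal_density 0 \<sigma>)))"

definition cov_op :: "'w measure \<Rightarrow> ('w \<Rightarrow> 'h::{real_inner,banach,second_countable_topology}) \<Rightarrow> 'h \<Rightarrow> 'h" where
  "cov_op M X y = (LINT \<omega>|M. (y \<bullet> X \<omega>) *\<^sub>R X \<omega>)"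

definition reg_varying :: "real \<Rightarrow> (real \<Rightarrow> real) \<Rightarrow> real \<Rightarrow> bool" where
  "reg_varying s \<phi> c \<longleftrightarrow> \<phi> \<in> borel_measurable (restrict_space lborel {s<..}) \<and>
     (\<forall>x>s. \<phi> x > 0) \<and>
     (\<forall>t>0. ((\<lambda>x. \<phi> (t * x) / \<phi> x) \<longlongrightarrow> t powr c) at_top)"

definition quant_err :: "'w measure \<Rightarrow> ('x \<Rightarrow> 'x \<Rightarrow> real) \<Rightarrow> ('w \<Rightarrow> 'x) \<Rightarrow> 'x set \<Rightarrow> real" where
  "quant_err M d Y \<alpha> = sqrt (\<integral>\<omega>. (Min ((\<lambda>a. d (Y \<omega>) a) ` \<alpha>))\<^sup>2 \<partial>M)"

definition quant_number :: "'w measure \<Rightarrow> 'x set \<Rightarrow> ('x \<Rightarrow> 'x \<Rightarrow> real) \<Rightarrow> ('w \<Rightarrow> 'x) \<Rightarrow> nat \<Rightarrow> real" where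
  "quant_number M S d Y k =
     Inf {quant_err M d Y \<alpha> | \<alpha>. \<alpha> \<subseteq> S \<and> finite \<alpha> \<and> \<alpha> \<noteq> {} \<and> card \<alpha> \<le> k}"

definition optimal_quantizer :: "'w measure \<Rightarrow> 'x set \<Rightarrow> ('x \<Rightarrow> 'x \<Rightarrow> real) \<Rightarrow> ('w \<Rightarrow> 'x) \<Rightarrow> nat \<Rightarrow> 'x set \<Rightarrow> bool" where
  "optimal_quantizer M S d Y k \<alpha> \<longleftrightarrow> \<alpha> \<subseteq> S \<and> finite \<alpha> \<and> \<alpha> \<noteq> {} \<and> card \<alpha> \<le> k \<and>
     quant_err M d Y \<alpha> = quant_number M S d Y k"

text \<open>R^l is represented as functions nat => real vanishing outside {0..<l}
  (coordinate k of the paper is coordinate k-1 here), with the Euclidean distance.\<close>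
definition Rl :: "nat \<Rightarrow> (nat \<Rightarrow> real) set" where
  "Rl l = {x. \<forall>k\<ge>l. x k = 0}"

definition euclid_dist :: "nat \<Rightarrow> (nat \<Rightarrow> real) \<Rightarrow> (nat \<Rightarrow> real) \<Rightarrow> real" where
  "euclid_dist l x y = sqrt (\<Sum>k<l. (x k - y k)\<^sup>2)"

definition voronoi_quantization :: "nat \<Rightarrow> 'w measure \<Rightarrow> (nat \<Rightarrow> real) set \<Rightarrow> ('w \<Rightarrow> nat \<Rightarrow> real) \<Rightarrow> ('w \<Rightarrow> nat \<Rightarrow> real) \<Rightarrow> bool" where
  "voronoi_quantization l M \<alpha> Y Yhat \<longleftrightarrow>
     (\<exists>C :: (nat \<Rightarrow> real) \<Rightarrow> (nat \<Rightarrow> real) set.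
        (\<forall>a\<in>\<alpha>. C a \<in> sets borel \<and>
                 C a \<subseteq> {x \<in> Rl l. \<forall>c\<in>\<alpha>. euclid_dist l x a \<le> euclid_dist l x c}) \<and>
        disjoint_family_on C \<alpha> \<and> (\<Union>a\<in>\<alpha>. C a) = Rl l \<and>
        (\<forall>\<omega>\<in>space M. Yhat \<omega> = (\<lambda>k. \<Sum>a\<in>\<alpha>. indicator (C a) (Y \<omega>) * a k)))"

definition blockLen :: "real \<Rightarrow> nat \<Rightarrow> nat" where
  "blockLen \<theta> n = nat \<lfloor>(max 1 (ln (real n))) powr \<theta>\<rfloor>"

definition blockNum :: "(nat \<Rightarrow> real) \<Rightarrow> nat \<Rightarrow> nat \<Rightarrow> nat" where
  "blockNum lam n l = Max {k. k \<ge> 1 \<and>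
      real n powr (1 / real k) * lam ((k - 1) * l + 1) powr (real l / 2) *
      (\<Prod>j=1..k. lam ((j - 1) * l + 1)) powr (- (real l / (2 * real k))) \<ge> 1}"

definition blockSize :: "(nat \<Rightarrow> real) \<Rightarrow> nat \<Rightarrow> nat \<Rightarrow> nat \<Rightarrow> nat \<Rightarrow> nat" where
  "blockSize lam n l m j = nat \<lfloor>real n powr (1 / real m) * lam ((j - 1) * l + 1) powr (real l / 2) *
      (\<Prod>i=1..m. lam ((i - 1) * l + 1)) powr (- (real l / (2 * real m)))\<rfloor>"

definition Zblock :: "('w \<Rightarrow> 'h::real_inner) \<Rightarrow> (nat \<Rightarrow> real) \<Rightarrow> (nat \<Rightarrow> 'h) \<Rightarrow> nat \<Rightarrow> nat \<Rightarrow> 'w \<Rightarrow> nat \<Rightarrow> real" where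
  "Zblock X lam u l j \<omega> = (\<lambda>k. if k < l then (X \<omega> \<bullet> u ((j - 1) * l + k + 1)) / sqrt (lam ((j - 1) * l + k + 1)) else 0)"

end

theory Submission
  imports Defs "HOL-Real_Asymp.Real_Asymp"
begin

text \<open>
  Write \<open>\<mu>\<close> for the water level \<open>n\<^bsup>-2/(ml)\<^esup> (\<Prod>j\<le>m. \<lambda>\<^bsub>(j-1)l+1\<^esub>)\<^bsup>1/m\<^esup>\<close>; the choice of \<open>m\<close> means exactly
  \<open>\<lambda>\<^bsub>ml+1\<^esub> < \<mu> \<le> \<lambda>\<^bsub>(m-1)l+1\<^esub>\<close>. Both the error of the block quantizer and the optimal error
  are compared with \<open>V = m l \<mu> + (\<Sum>i>ml. \<lambda>\<^sub>i)\<close>.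

  Upper bound: a random code shows that the standard Gaussian law on \<open>R\<^sup>l\<close> has a \<open>k\<close>-quantizer with
  squared error at most \<open>(1 + \<epsilon>) l k\<^bsup>-2/l\<^esup>\<close>, uniformly in \<open>k\<close> once \<open>l\<close> is large. Since the block
  sizes equalize the block errors, the total squared error is at most \<open>(1 + \<epsilon>) 4\<^bsup>1/l\<^esup> V\<close>.

  Lower bound: Jensen's inequality gives, for every \<open>t > 0\<close>, the dual form
  \<open>e\<^sub>n(X)\<^sup>2 \<ge> (\<Sum>i. min t \<lambda>\<^sub>i + t ln\<^sup>+ (\<lambda>\<^sub>i / t)) - 2 t ln n\<close> of Shannon's rate distortion bound;
  for \<open>t = \<mu>\<close> the right hand side is at least \<open>V (1 - ln (\<lambda>\<^sub>1 / \<lambda>\<^bsub>ml+1\<^esub>) / m)\<close>.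

  Regular variation gives a polynomial lower bound \<open>\<lambda>\<^sub>j \<ge> c j\<^bsup>-(b+1)\<^esup>\<close>, and this makes
  \<open>ln (\<lambda>\<^sub>1 / \<lambda>\<^bsub>ml+1\<^esub>) / m\<close> tend to \<open>0\<close>.
\<close>


subsection \<open>Orthonormal systems\<close>

text \<open>V is a reverse water-filling value: kept blocks are reproduced with squared error \<mu>
  per coordinate, the rest is dropped. Block length l and block number m both tend to infinity,
  while a block size may be any number from 1 upwards. Error asymptotics for a fixed dimension and a
  growing number of points are therefore of no use; the coding constant has to tend to 1 with l,
  uniformly in the number of points. The remaining gaps are explicit. Integer parts cost at most a
  factor 2 in a block size, hence 4^(1/l) in squared error. Treating a block as if its eigenvalues
  were equal costs, after telescoping over the blocks, l \<mu> ln (lam 1 / lam (m l + 1)), which is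
  compared with m l \<mu>. So \<theta> > 0 serves l, and \<theta> < 1 keeps ln n / l large and
  thereby forces m to grow. A second obstacle is that a Gaussian vector is defined through scalar
  projections only: square integrability of its norm, summability of the eigenvalues and
  independence of the coordinates all have to be derived.\<close>

definition orthonormal_seq :: "(nat \<Rightarrow> 'h::real_inner) \<Rightarrow> bool" where
  "orthonormal_seq u \<longleftrightarrow> (\<forall>i j. u i \<bullet> u j = (if i = j then 1 else 0))"

lemma orthonormal_seqD: "orthonormal_seq u \<Longrightarrow> u i \<bullet> u j = (if i = j then 1 else 0)"
  by (simp add: orthonormal_seq_def)

lemma orthonormal_seq_sum_inner:
  assumes "orthonormal_seq u" "finite I"
  shows "(\<Sum>i\<in>I. c i *\<^sub>R u i) \<bullet> u j = (if j \<in> I then c j else 0)"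
  using assms by (simp add: inner_sum_left orthonormal_seqD if_distrib cong: if_cong)

lemma orthonormal_seq_norm_sum:
  assumes "orthonormal_seq u" "finite I"
  shows "(norm (\<Sum>i\<in>I. c i *\<^sub>R u i))\<^sup>2 = (\<Sum>i\<in>I. (c i)\<^sup>2)"
  using assms unfolding power2_norm_eq_inner
  by (subst inner_sum_right) (simp add: orthonormal_seq_sum_inner power2_eq_square)

lemma bessel_ineq:
  assumes "finite F" "\<And>e f. e \<in> F \<Longrightarrow> f \<in> F \<Longrightarrow> e \<bullet> f = (if e = f then 1 else 0)"
  shows "(\<Sum>e\<in>F. (x \<bullet> e)\<^sup>2) \<le> (norm x)\<^sup>2"
proof -
  let ?p = "\<Sum>e\<in>F. (x \<bullet> e) *\<^sub>R e"
  have pe: "?p \<bullet> e = x \<bullet> e" if "e \<in> F" for e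
  proof -
    have "?p \<bullet> e = (\<Sum>f\<in>F. if f = e then x \<bullet> e else 0)"
      unfolding inner_sum_left by (rule sum.cong) (auto simp: assms(2) that)
    also have "\<dots> = x \<bullet> e" using assms(1) that by simp
    finally show ?thesis .
  qed
  have pp: "?p \<bullet> ?p = (\<Sum>e\<in>F. (x \<bullet> e)\<^sup>2)"
    by (subst inner_sum_right) (simp add: pe power2_eq_square)
  have xp: "x \<bullet> ?p = (\<Sum>e\<in>F. (x \<bullet> e)\<^sup>2)"
    by (simp add: inner_sum_right power2_eq_square)
  have "0 \<le> (x - ?p) \<bullet> (x - ?p)" by simp
  also have "\<dots> = x \<bullet> x - (\<Sum>e\<in>F. (x \<bullet> e)\<^sup>2)"
    using pp xp by (simp add: inner_diff_left inner_diff_right inner_commute)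
  finally show ?thesis by (simp add: power2_norm_eq_inner)
qed

lemma bessel_ineq_seq:
  assumes "orthonormal_seq u" "finite I"
  shows "(\<Sum>i\<in>I. (x \<bullet> u i)\<^sup>2) \<le> (norm x)\<^sup>2"
proof -
  have inj: "inj u" using orthonormal_seqD[OF assms(1)] by (metis injI zero_neq_one)
  have "(\<Sum>e\<in>u ` I. (x \<bullet> e)\<^sup>2) \<le> (norm x)\<^sup>2"
    using inj by (intro bessel_ineq) (auto simp: assms orthonormal_seqD inj_eq)
  then show ?thesis using inj by (simp add: sum.reindex inj_on_subset[OF inj])
qed

text \<open>The system need not be complete, so \<open>p\<close> is only the projection of
  \<open>x\<close> onto the closed span; the third conclusion places \<open>p\<close> in the double
  orthogonal complement of \<open>u\<close>. Bessel's inequality makes the partial sums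
  Cauchy.\<close>

lemma fourier_series_residual:
  fixes u :: "nat \<Rightarrow> 'h::{real_inner,banach}"
  assumes u: "orthonormal_seq u"
  obtains p where "(\<lambda>i. (x \<bullet> u i) *\<^sub>R u i) sums p" "\<And>i. (x - p) \<bullet> u i = 0"
    "\<And>y. (\<And>i. y \<bullet> u i = 0) \<Longrightarrow> y \<bullet> p = 0" "(\<lambda>i. (x \<bullet> u i)\<^sup>2) sums (norm p)\<^sup>2"
proof -
  let ?f = "\<lambda>i. (x \<bullet> u i) *\<^sub>R u i"
  have sq: "summable (\<lambda>i. (x \<bullet> u i)\<^sup>2)"
    by (rule bounded_imp_summable[of _ "(norm x)\<^sup>2"]) (auto intro!: bessel_ineq_seq u)
  have "summable ?f"
    unfolding summable_Cauchy
  proof (intro allI impI)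
    fix e :: real assume "e > 0"
    then obtain N where N: "\<And>m n. m \<ge> N \<Longrightarrow> norm (sum (\<lambda>i. (x \<bullet> u i)\<^sup>2) {m..<n}) < e\<^sup>2"
      using sq unfolding summable_Cauchy by (meson zero_less_power)
    have "norm (sum ?f {m..<n}) < e" if "m \<ge> N" for m n
    proof -
      have "(norm (sum ?f {m..<n}))\<^sup>2 < e\<^sup>2"
        using N[OF that, of n] by (subst orthonormal_seq_norm_sum[OF u]) (auto simp: sum_nonneg)
      then show ?thesis using \<open>e > 0\<close> power2_less_imp_less by fastforce
    qed
    then show "\<exists>N. \<forall>m\<ge>N. \<forall>n. norm (sum ?f {m..<n}) < e" by blast
  qed
  then have S: "?f sums (suminf ?f)" by (rule summable_sums)
  define p where "p = suminf ?f"
  have lim: "(\<lambda>n. sum ?f {..<n}) \<longlonglongrightarrow> p" using S by (simp add: sums_def p_def)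
  have "(x - p) \<bullet> u i = 0" for i
  proof -
    have "(\<lambda>n. sum ?f {..<n} \<bullet> u i) \<longlonglongrightarrow> p \<bullet> u i" by (intro tendsto_intros lim)
    moreover have "\<forall>\<^sub>F n in sequentially. sum ?f {..<n} \<bullet> u i = x \<bullet> u i"
      using eventually_gt_at_top[of i] by eventually_elim (subst orthonormal_seq_sum_inner[OF u], auto)
    ultimately have "(\<lambda>n. x \<bullet> u i) \<longlonglongrightarrow> p \<bullet> u i" by (rule Lim_transform_eventually)
    then have "x \<bullet> u i = p \<bullet> u i" by (rule LIMSEQ_unique[OF tendsto_const])
    then show ?thesis by (simp add: inner_diff_left)
  qed
  moreover have "y \<bullet> p = 0" if "\<And>i. y \<bullet> u i = 0" for y
  proof -
    have "(\<lambda>n. y \<bullet> sum ?f {..<n}) \<longlonglongrightarrow> y \<bullet> p" by (intro tendsto_intros lim)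
    then show ?thesis using that by (simp add: inner_sum_right LIMSEQ_const_iff)
  qed
  moreover have "(\<lambda>i. (x \<bullet> u i)\<^sup>2) sums (norm p)\<^sup>2"
  proof -
    have "(\<lambda>n. (norm (sum ?f {..<n}))\<^sup>2) \<longlonglongrightarrow> (norm p)\<^sup>2" by (intro tendsto_intros lim)
    then show ?thesis by (simp add: orthonormal_seq_norm_sum[OF u] sums_def)
  qed
  ultimately show ?thesis using that S unfolding p_def by blast
qed

text \<open>\<open>C\<close> stands for directions missing from \<open>u\<close>. Together they are
  total and \<open>x\<close> has no component along \<open>C\<close>, so nothing is left after
  projecting onto \<open>u\<close>. \<open>C\<close> empty is the classical case; the general one is
  applied to almost every value of a Gaussian vector.\<close>

lemma parseval:
  fixes u :: "nat \<Rightarrow> 'h::{real_inner,banach}"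
  assumes u: "orthonormal_seq u"
    and compl: "\<And>y. (\<And>i. y \<bullet> u i = 0) \<Longrightarrow> (\<And>e. e \<in> C \<Longrightarrow> y \<bullet> e = 0) \<Longrightarrow> y = 0"
    and C: "\<And>e i. e \<in> C \<Longrightarrow> e \<bullet> u i = 0"
    and x: "\<And>e. e \<in> C \<Longrightarrow> x \<bullet> e = 0"
  shows "(\<lambda>i. (x \<bullet> u i)\<^sup>2) sums (norm x)\<^sup>2"
proof -
  obtain p where p: "\<And>i. (x - p) \<bullet> u i = 0"
    "\<And>y. (\<And>i. y \<bullet> u i = 0) \<Longrightarrow> y \<bullet> p = 0" "(\<lambda>i. (x \<bullet> u i)\<^sup>2) sums (norm p)\<^sup>2"
    using fourier_series_residual[OF u, of x] by metis
  have "x - p = 0"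
    by (rule compl) (use p(1,2) C x in \<open>auto simp: inner_diff_left inner_commute[of p]\<close>)
  then show ?thesis using p(3) by simp
qed

section \<open>Completion of an orthonormal system\<close>

definition orthonormal_set :: "'h::real_inner set \<Rightarrow> bool" where
  "orthonormal_set B \<longleftrightarrow> (\<forall>e\<in>B. \<forall>f\<in>B. e \<bullet> f = (if e = f then 1 else 0))"

text \<open>Distinct elements lie at distance sqrt 2, so balls of radius 1/2 around them are
  disjoint open sets, of which a second countable space has only countably many.\<close>

lemma orthonormal_set_countable:
  fixes B :: "'h::{real_inner,second_countable_topology} set"
  assumes "orthonormal_set B"
  shows "countable B"
proof -
  have d: "dist e f > 1" if "e \<in> B" "f \<in> B" "e \<noteq> f" for e f
  proof -
    have "(dist e f)\<^sup>2 = 2"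
      using assms that unfolding orthonormal_set_def dist_norm power2_norm_eq_inner
      by (simp add: inner_diff_left inner_diff_right)
    then have "dist e f = sqrt 2" by (metis real_sqrt_unique zero_le_dist)
    then show ?thesis by simp
  qed
  have "countable ((\<lambda>e. ball e (1/2)) ` B)"
  proof (rule countable_disjoint_open_subsets)
    show "pairwise disjnt ((\<lambda>e. ball e (1/2)) ` B)"
    proof (clarsimp simp: pairwise_def)
      fix e f assume ef: "e \<in> B" "f \<in> B" "ball e (1/2) \<noteq> ball f (1/2)"
      then have "dist e f > 1" using d by blast
      then show "disjnt (ball e (1/2)) (ball f (1/2))"
        unfolding disjnt_def by (intro disjoint_ballI) auto
    qed
  qed auto
  moreover have "inj_on (\<lambda>e. ball e (1/2)) B"
  proof (rule inj_onI, rule ccontr)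
    fix e f assume *: "e \<in> B" "f \<in> B" "ball e (1/2) = ball f (1/2)" "e \<noteq> f"
    then have "e \<in> ball f (1/2)" by (metis centre_in_ball half_gt_zero zero_less_one)
    then show False using d[OF *(2,1)] * by auto
  qed
  ultimately show ?thesis by (rule countable_image_inj_on)
qed

text \<open>Zorn's lemma gives a maximal orthonormal set. It is total, since a nonzero vector
  orthogonal to it could be normalized and added.\<close>

lemma orthonormal_set_extend:
  fixes A :: "'h::real_inner set"
  assumes "orthonormal_set A"
  obtains B where "A \<subseteq> B" "orthonormal_set B" "\<And>y. (\<And>e. e \<in> B \<Longrightarrow> y \<bullet> e = 0) \<Longrightarrow> y = 0"
proof -
  let ?S = "{B. A \<subseteq> B \<and> orthonormal_set B}"
  have "\<exists>M\<in>?S. \<forall>X\<in>?S. M \<subseteq> X \<longrightarrow> X = M"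
  proof (rule subset_Zorn_nonempty)
    show "?S \<noteq> {}" using assms by blast
    fix C assume C: "C \<noteq> {}" "subset.chain ?S C"
    have "orthonormal_set (\<Union>C)"
      unfolding orthonormal_set_def
    proof (intro ballI)
      fix e f assume "e \<in> \<Union>C" "f \<in> \<Union>C"
      then obtain P Q where PQ: "P \<in> C" "Q \<in> C" "e \<in> P" "f \<in> Q" by blast
      then have "P \<subseteq> Q \<or> Q \<subseteq> P" using C(2) unfolding subset.chain_def by blast
      then obtain R where "R \<in> C" "e \<in> R" "f \<in> R" using PQ by blast
      then show "e \<bullet> f = (if e = f then 1 else 0)"
        using C(2) unfolding subset.chain_def orthonormal_set_def by blast
    qed
    then show "\<Union>C \<in> ?S" using C unfolding subset.chain_def by blast
  qed
  then obtain B where B: "A \<subseteq> B" "orthonormal_set B"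
    and max: "\<And>X. A \<subseteq> X \<Longrightarrow> orthonormal_set X \<Longrightarrow> B \<subseteq> X \<Longrightarrow> X = B"
    unfolding mem_Collect_eq Ball_def Bex_def by (elim exE conjE) metis
  have "y = 0" if y: "\<And>e. e \<in> B \<Longrightarrow> y \<bullet> e = 0" for y
  proof (rule ccontr)
    assume "y \<noteq> 0"
    define z where "z = y /\<^sub>R norm y"
    have z: "z \<bullet> z = 1" "\<And>e. e \<in> B \<Longrightarrow> z \<bullet> e = 0"
      using \<open>y \<noteq> 0\<close> y by (auto simp: z_def power2_norm_eq_inner[symmetric] power2_eq_square)
    then have "z \<notin> B" by fastforce
    have "orthonormal_set (insert z B)"
      using z B(2) \<open>z \<notin> B\<close> unfolding orthonormal_set_def by (auto simp: inner_commute)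
    then have "insert z B = B" using max B(1) by blast
    then show False using \<open>z \<notin> B\<close> by blast
  qed
  then show ?thesis using that B by blast
qed

subsection \<open>Independence from characteristic functions\<close>

context prob_space
begin

text \<open>Tilting the measure by \<open>W\<close> leaves the characteristic function of \<open>Y\<close> unchanged, so Levy's uniqueness
  theorem applies to the tilted law of \<open>Y\<close>.\<close>

lemma nonneg_weight_indep_if_char:
  fixes W Y :: "'a \<Rightarrow> real"
  assumes W[measurable]: "W \<in> borel_measurable M" and Y[measurable]: "Y \<in> borel_measurable M"
    and W0: "\<And>\<omega>. 0 \<le> W \<omega>" and WC: "\<And>\<omega>. W \<omega> \<le> C"
    and ch: "\<And>s. (CLINT \<omega>|M. of_real (W \<omega>) * iexp (s * Y \<omega>)) =
                 of_real (expectation W) * (CLINT \<omega>|M. iexp (s * Y \<omega>))"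
    and A[measurable]: "A \<in> sets borel"
  shows "expectation (\<lambda>\<omega>. W \<omega> * indicator A (Y \<omega>)) =
         expectation W * expectation (\<lambda>\<omega>. indicator A (Y \<omega>))"
proof -
  have intW: "integrable M W"
    by (rule integrable_const_bound[where B=C]) (auto simp: W0 WC)
  show ?thesis
  proof (cases "expectation W = 0")
    case True
    then have "AE \<omega> in M. W \<omega> = 0"
      using integral_nonneg_eq_0_iff_AE[OF intW] W0 by auto
    then have "expectation (\<lambda>\<omega>. W \<omega> * indicator A (Y \<omega>)) = expectation (\<lambda>\<omega>. 0)"
      by (intro integral_cong_AE) auto
    then show ?thesis using True by simp
  next
    case False
    define w where "w = expectation W"
    have w: "w > 0" using False W0 Bochner_Integration.integral_nonneg[of M W] unfolding w_def by (simp add: less_le)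
    let ?\<nu> = "density M (\<lambda>\<omega>. ennreal (W \<omega> / w))"
    have intWw: "integrable M (\<lambda>\<omega>. W \<omega> / w)" using intW by simp
    have "emeasure ?\<nu> (space M) = (\<integral>\<^sup>+ \<omega>. ennreal (W \<omega> / w) \<partial>M)"
      by (subst emeasure_density) (auto intro!: nn_integral_cong)
    also have "\<dots> = 1"
      using w W0 by (subst nn_integral_eq_integral[OF intWw]) (auto simp: w_def)
    finally have "prob_space ?\<nu>" by (intro prob_spaceI) simp
    then interpret nu: prob_space ?\<nu> .
    have rd1: "real_distribution (distr ?\<nu> borel Y)"
      by (intro nu.real_distribution_distr) simp
    have rd2: "real_distribution (distr M borel Y)"
      by (intro real_distribution_distr) simp
    have "distr ?\<nu> borel Y = distr M borel Y"
    proof (rule Levy_uniqueness[OF rd1 rd2], rule ext)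
      fix s
      have "char (distr ?\<nu> borel Y) s = (CLINT \<omega>|M. (W \<omega> / w) *\<^sub>R iexp (s * Y \<omega>))"
        unfolding char_def using w W0
        by (subst integral_distr) (auto simp: integral_density)
      also have "\<dots> = (CLINT \<omega>|M. (1 / w) *\<^sub>R (of_real (W \<omega>) * iexp (s * Y \<omega>)))"
        by (rule Bochner_Integration.integral_cong) (auto simp: scaleR_conv_of_real)
      also have "\<dots> = (1 / w) *\<^sub>R (of_real w * (CLINT \<omega>|M. iexp (s * Y \<omega>)))"
        by (simp only: integral_scaleR_right ch w_def)
      also have "\<dots> = char (distr M borel Y) s"
        unfolding char_def using w by (subst integral_distr) (auto simp: scaleR_conv_of_real)
      finally show "char (distr ?\<nu> borel Y) s = char (distr M borel Y) s" .
    qed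
    then have "(LINT x|distr ?\<nu> borel Y. indicator A x) = (LINT x|distr M borel Y. indicator A x :: real)"
      by simp
    then have "(LINT \<omega>|?\<nu>. indicator A (Y \<omega>)) = (expectation (\<lambda>\<omega>. indicator A (Y \<omega>)) :: real)"
      by (subst (asm) (1 2) integral_distr) simp_all
    then have "expectation (\<lambda>\<omega>. W \<omega> / w * indicator A (Y \<omega>)) = (expectation (\<lambda>\<omega>. indicator A (Y \<omega>)) :: real)"
      using w W0 by (subst (asm) integral_density) auto
    moreover have "expectation (\<lambda>\<omega>. W \<omega> / w * indicator A (Y \<omega>)) = expectation (\<lambda>\<omega>. W \<omega> * indicator A (Y \<omega>)) / w"
      by (simp flip: integral_divide_zero)
    ultimately show ?thesis using w unfolding w_def[symmetric] by (simp add: field_simps)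
  qed
qed

text \<open>Hypothesis and claim are linear in \<open>W\<close> and hold for constant weights, so
  passing to \<open>W + C\<close> reduces a signed weight to a nonnegative one.\<close>

lemma real_weight_indep_if_char:
  fixes W Y :: "'a \<Rightarrow> real"
  assumes W[measurable]: "W \<in> borel_measurable M" and Y[measurable]: "Y \<in> borel_measurable M"
    and WC: "\<And>\<omega>. \<bar>W \<omega>\<bar> \<le> C"
    and ch: "\<And>s. (CLINT \<omega>|M. of_real (W \<omega>) * iexp (s * Y \<omega>)) =
                 of_real (expectation W) * (CLINT \<omega>|M. iexp (s * Y \<omega>))"
    and A[measurable]: "A \<in> sets borel"
  shows "expectation (\<lambda>\<omega>. W \<omega> * indicator A (Y \<omega>)) =
         expectation W * expectation (\<lambda>\<omega>. indicator A (Y \<omega>))"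
proof -
  have intW: "integrable M W"
    by (rule integrable_const_bound[where B=C]) (auto simp: WC)
  have intWA: "integrable M (\<lambda>\<omega>. W \<omega> * indicator A (Y \<omega>))"
    using WC by (intro integrable_const_bound[where B=C])
      (auto simp: indicator_def intro: order_trans[OF abs_ge_zero])
  have intA: "integrable M (\<lambda>\<omega>. indicator A (Y \<omega>) :: real)"
    by (intro integrable_const_bound[where B=1]) (auto simp: indicator_def)
  have inte: "integrable M (\<lambda>\<omega>. iexp (s * Y \<omega>))" for s
    by (intro integrable_const_bound[where B=1]) (auto simp: )
  have intWe: "integrable M (\<lambda>\<omega>. of_real (W \<omega>) * iexp (s * Y \<omega>))" for s
    using WC by (intro integrable_const_bound[where B=C]) (auto simp: norm_mult)
  have "expectation (\<lambda>\<omega>. (W \<omega> + C) * indicator A (Y \<omega>)) =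
         expectation (\<lambda>\<omega>. W \<omega> + C) * expectation (\<lambda>\<omega>. indicator A (Y \<omega>))"
  proof (rule nonneg_weight_indep_if_char[where C="2 * C"])
    show "0 \<le> W \<omega> + C" "W \<omega> + C \<le> 2 * C" for \<omega> using WC[of \<omega>] by auto
    show "(CLINT \<omega>|M. of_real (W \<omega> + C) * iexp (s * Y \<omega>)) =
            of_real (expectation (\<lambda>\<omega>. W \<omega> + C)) * (CLINT \<omega>|M. iexp (s * Y \<omega>))" for s
      using intWe inte intW
      by (simp add: distrib_right ch prob_space del: of_real_mult)
  qed simp_all
  then show ?thesis
    using intW intWA intA by (simp add: distrib_right prob_space)
qed

text \<open>The weights met below are products of indicators and exponentials, hence complex. Their
  real and imaginary parts combine \<open>G\<close> and \<open>cnj G\<close>; the factorization for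
  \<open>cnj G\<close> follows by conjugating the hypothesis at \<open>- s\<close>.\<close>

lemma complex_weight_indep_if_char:
  fixes G :: "'a \<Rightarrow> complex" and Y :: "'a \<Rightarrow> real"
  assumes G[measurable]: "G \<in> borel_measurable M" and Y[measurable]: "Y \<in> borel_measurable M"
    and GC: "\<And>\<omega>. norm (G \<omega>) \<le> C"
    and ch: "\<And>s. (CLINT \<omega>|M. G \<omega> * iexp (s * Y \<omega>)) =
                 (CLINT \<omega>|M. G \<omega>) * (CLINT \<omega>|M. iexp (s * Y \<omega>))"
    and A[measurable]: "A \<in> sets borel"
  shows "(CLINT \<omega>|M. G \<omega> * indicator A (Y \<omega>)) =
         (CLINT \<omega>|M. G \<omega>) * of_real (expectation (\<lambda>\<omega>. indicator A (Y \<omega>)))"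
proof -
  have intG: "integrable M G"
    by (rule integrable_const_bound[where B=C]) (auto simp: GC)
  have intGA: "integrable M (\<lambda>\<omega>. G \<omega> * indicator A (Y \<omega>))"
    using GC by (intro integrable_const_bound[where B=C])
      (auto simp: indicator_def intro: order_trans[OF norm_ge_zero])
  have intGe: "integrable M (\<lambda>\<omega>. G \<omega> * iexp (s * Y \<omega>))" for s
    using GC by (intro integrable_const_bound[where B=C]) (auto simp: norm_mult)
  have chc: "(CLINT \<omega>|M. cnj (G \<omega>) * iexp (s * Y \<omega>)) =
                 cnj (CLINT \<omega>|M. G \<omega>) * (CLINT \<omega>|M. iexp (s * Y \<omega>))" for s
  proof -
    have e: "cnj (iexp x) = iexp (- x)" for x by (simp add: exp_cnj)
    have "(CLINT \<omega>|M. cnj (G \<omega>) * iexp (s * Y \<omega>)) = (CLINT \<omega>|M. cnj (G \<omega> * iexp ((-s) * Y \<omega>)))"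
      unfolding complex_cnj_mult e by simp
    also have "\<dots> = cnj ((CLINT \<omega>|M. G \<omega>) * (CLINT \<omega>|M. iexp ((-s) * Y \<omega>)))"
      unfolding Bochner_Integration.integral_cnj ch ..
    also have "\<dots> = cnj (CLINT \<omega>|M. G \<omega>) * (CLINT \<omega>|M. cnj (iexp ((-s) * Y \<omega>)))"
      unfolding complex_cnj_mult Bochner_Integration.integral_cnj ..
    finally show ?thesis unfolding e by simp
  qed
  have [measurable]: "cnj \<in> borel_measurable borel"
    by (intro borel_measurable_continuous_onI continuous_intros)
  have intcGe: "integrable M (\<lambda>\<omega>. cnj (G \<omega>) * iexp (s * Y \<omega>))" for s
    using GC by (intro integrable_const_bound[where B=C]) (auto simp: norm_mult)
  have re: "of_real (Re z) = (z + cnj z) / 2" and im: "of_real (Im z) = (z - cnj z) / (2 * \<i>)" for z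
    by (auto simp: complex_eq_iff)
  have "expectation (\<lambda>\<omega>. Re (G \<omega>) * indicator A (Y \<omega>)) =
         expectation (\<lambda>\<omega>. Re (G \<omega>)) * expectation (\<lambda>\<omega>. indicator A (Y \<omega>))"
  proof (rule real_weight_indep_if_char[where C=C])
    show "\<bar>Re (G \<omega>)\<bar> \<le> C" for \<omega> using GC[of \<omega>] abs_Re_le_cmod order_trans by blast
    show "(CLINT \<omega>|M. of_real (Re (G \<omega>)) * iexp (s * Y \<omega>)) =
            of_real (expectation (\<lambda>\<omega>. Re (G \<omega>))) * (CLINT \<omega>|M. iexp (s * Y \<omega>))" for s
      unfolding integral_Re[OF intG] re add_divide_distrib distrib_right times_divide_eq_left
      using intGe intcGe by (simp add: ch chc del: of_real_mult)
  qed simp_all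
  moreover have "expectation (\<lambda>\<omega>. Im (G \<omega>) * indicator A (Y \<omega>)) =
         expectation (\<lambda>\<omega>. Im (G \<omega>)) * expectation (\<lambda>\<omega>. indicator A (Y \<omega>))"
  proof (rule real_weight_indep_if_char[where C=C])
    show "\<bar>Im (G \<omega>)\<bar> \<le> C" for \<omega> using GC[of \<omega>] abs_Im_le_cmod order_trans by blast
    show "(CLINT \<omega>|M. of_real (Im (G \<omega>)) * iexp (s * Y \<omega>)) =
            of_real (expectation (\<lambda>\<omega>. Im (G \<omega>))) * (CLINT \<omega>|M. iexp (s * Y \<omega>))" for s
      unfolding integral_Im[OF intG] im diff_divide_distrib left_diff_distrib times_divide_eq_left
      using intGe intcGe by (simp add: ch chc del: of_real_mult)
  qed simp_all
  moreover have "Re (G \<omega> * indicator A (Y \<omega>)) = Re (G \<omega>) * indicator A (Y \<omega>)"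
      "Im (G \<omega> * indicator A (Y \<omega>)) = Im (G \<omega>) * indicator A (Y \<omega>)" for \<omega>
    by (auto simp: indicator_def)
  ultimately show ?thesis
    using intGA intG by (auto simp: complex_eq_iff simp flip: integral_Re integral_Im)
qed

text \<open>Exponentials are exchanged for indicators one index at a time. In \<open>key\<close> the
  indices in \<open>K\<close> already carry indicators and those in \<open>J\<close> still carry
  exponentials: \<open>K\<close> empty is the hypothesis, \<open>J\<close> empty is the product rule
  for probabilities.\<close>

lemma indep_vars_if_char_factorizes:
  fixes Y :: "'i \<Rightarrow> 'a \<Rightarrow> real"
  assumes Y[measurable]: "\<And>i. i \<in> I \<Longrightarrow> Y i \<in> borel_measurable M"
    and ch: "\<And>J t. finite J \<Longrightarrow> J \<subseteq> I \<Longrightarrow>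
      (CLINT \<omega>|M. iexp (\<Sum>j\<in>J. t j * Y j \<omega>)) = (\<Prod>j\<in>J. CLINT \<omega>|M. iexp (t j * Y j \<omega>))"
  shows "indep_vars (\<lambda>_. borel) Y I"
proof -
  have key: "(CLINT \<omega>|M. (\<Prod>k\<in>K. indicator (A k) (Y k \<omega>)) * iexp (\<Sum>j\<in>J. t j * Y j \<omega>)) =
      of_real (\<Prod>k\<in>K. expectation (\<lambda>\<omega>. indicator (A k) (Y k \<omega>))) * (\<Prod>j\<in>J. CLINT \<omega>|M. iexp (t j * Y j \<omega>))"
    if "finite K" "K \<subseteq> I" "\<And>k. k \<in> K \<Longrightarrow> A k \<in> sets borel" "finite J" "J \<subseteq> I" "J \<inter> K = {}" for K J A t
    using that
  proof (induction K arbitrary: J t rule: finite_induct)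
    case empty
    then show ?case using ch by simp
  next
    case (insert k K)
    let ?H = "\<lambda>\<omega>. (\<Prod>k\<in>K. indicator (A k) (Y k \<omega>)) :: complex"
    let ?G = "\<lambda>\<omega>. ?H \<omega> * iexp (\<Sum>j\<in>J. t j * Y j \<omega>)"
    have kI: "k \<in> I" "k \<notin> J" using insert by auto
    have [measurable]: "A i \<in> sets borel" if "i \<in> insert k K" for i using insert that by auto
    have [measurable]: "Y i \<in> borel_measurable M" if "i \<in> insert k (K \<union> J)" for i using insert that by auto
    have mk[measurable]: "Y k \<in> borel_measurable M" "A k \<in> sets borel" by auto
    have IHG: "(CLINT \<omega>|M. ?G \<omega>) = of_real (\<Prod>k\<in>K. expectation (\<lambda>\<omega>. indicator (A k) (Y k \<omega>))) * (\<Prod>j\<in>J. CLINT \<omega>|M. iexp (t j * Y j \<omega>))"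
      using insert by (intro insert.IH) auto
    have nH: "norm (?H \<omega>) \<le> 1" for \<omega>
      unfolding prod_norm[symmetric] by (rule prod_le_1) (auto simp: indicator_def)
    have "(CLINT \<omega>|M. ?G \<omega> * indicator (A k) (Y k \<omega>)) =
        (CLINT \<omega>|M. ?G \<omega>) * of_real (expectation (\<lambda>\<omega>. indicator (A k) (Y k \<omega>)))"
    proof (rule complex_weight_indep_if_char[where C=1])
      show "norm (?G \<omega>) \<le> 1" for \<omega> using nH[of \<omega>] by (simp add: norm_mult)
      fix s
      have kk: "(\<Sum>j\<in>J. (t(k := s)) j * Y j \<omega>) = (\<Sum>j\<in>J. t j * Y j \<omega>)"
        "(\<Prod>j\<in>J. CLINT \<omega>|M. iexp ((t(k := s)) j * Y j \<omega>)) = (\<Prod>j\<in>J. CLINT \<omega>|M. iexp (t j * Y j \<omega>))" for \<omega>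
        using kI by (auto intro!: sum.cong prod.cong)
      \<comment> \<open>The factor with frequency \<open>s\<close> is absorbed as one more
        exponential, at index \<open>k\<close>. This is the induction hypothesis for
        \<open>insert k J\<close>, which is why \<open>J\<close> and \<open>t\<close> stay
        arbitrary.\<close>
      have "(CLINT \<omega>|M. ?G \<omega> * iexp (s * Y k \<omega>)) =
        (CLINT \<omega>|M. ?H \<omega> * iexp (\<Sum>j\<in>insert k J. (t(k := s)) j * Y j \<omega>))"
        using insert.prems kI
        by (intro Bochner_Integration.integral_cong refl)
           (simp add: kk exp_add distrib_left del: fun_upd_apply of_real_mult of_real_sum,
            simp add: mult_ac)
      also have "\<dots> = of_real (\<Prod>k\<in>K. expectation (\<lambda>\<omega>. indicator (A k) (Y k \<omega>))) *
          (\<Prod>j\<in>insert k J. CLINT \<omega>|M. iexp ((t(k := s)) j * Y j \<omega>))"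
        using insert by (intro insert.IH) auto
      also have "\<dots> = (CLINT \<omega>|M. ?G \<omega>) * (CLINT \<omega>|M. iexp (s * Y k \<omega>))"
        unfolding IHG using insert.prems kI by (simp add: kk del: fun_upd_apply of_real_mult, simp add: mult_ac)
      finally show "(CLINT \<omega>|M. ?G \<omega> * iexp (s * Y k \<omega>)) = (CLINT \<omega>|M. ?G \<omega>) * (CLINT \<omega>|M. iexp (s * Y k \<omega>))" .
    qed simp_all
    then show ?case
      unfolding IHG using insert.hyps by (simp add: mult_ac)
  qed
  show ?thesis
    unfolding indep_vars_def2
  proof (intro conjI ballI indep_setsI)
    fix i assume "i \<in> I"
    then show "Y i \<in> borel_measurable M" by simp
    show "{Y i -` A \<inter> space M |A. A \<in> sets borel} \<subseteq> events" using Y[OF \<open>i \<in> I\<close>] by (auto intro: measurable_sets)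
  next
    fix A J assume J: "J \<noteq> {}" "J \<subseteq> I" "finite J"
      and "\<forall>j\<in>J. A j \<in> {Y j -` B \<inter> space M |B. B \<in> sets borel}"
    then have "\<forall>j\<in>J. \<exists>B. A j = Y j -` B \<inter> space M \<and> B \<in> sets borel" by blast
    then obtain B where B: "\<And>j. j \<in> J \<Longrightarrow> A j = Y j -` B j \<inter> space M" "\<And>j. j \<in> J \<Longrightarrow> B j \<in> sets borel"
      by metis
    have Aev: "A j \<in> events" if "j \<in> J" for j using B[OF that] J that Y by (auto intro: measurable_sets)
    have inter: "(\<Inter>j\<in>J. A j) \<in> events" using J Aev by auto
    have ind: "of_real (indicator (\<Inter>j\<in>J. A j) \<omega>) = (\<Prod>k\<in>J. indicator (B k) (Y k \<omega>) :: complex)" if "\<omega> \<in> space M" for \<omega>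
    proof (cases "\<omega> \<in> (\<Inter>j\<in>J. A j)")
      case True
      then have "(\<Prod>k\<in>J. indicator (B k) (Y k \<omega>) :: complex) = 1" 
        using B(1) by (intro prod.neutral ballI) (metis INT_iff IntD1 indicator_simps(1) vimageE)
      then show ?thesis using True by simp
    next
      case False
      then obtain j where j: "j \<in> J" "\<omega> \<notin> A j" by blast
      then have "Y j \<omega> \<notin> B j" using B(1)[of j] that by auto
      with j(1) have "(\<Prod>k\<in>J. indicator (B k) (Y k \<omega>) :: complex) = 0" using J by (intro prod_zero bexI[of _ j]) auto
      then show ?thesis using False by simp
    qed
    have iA: "expectation (\<lambda>\<omega>. indicator (B k) (Y k \<omega>)) = prob (A k)" if "k \<in> J" for k
    proof -
      have "expectation (\<lambda>\<omega>. indicator (B k) (Y k \<omega>)) = expectation (\<lambda>\<omega>. indicator (A k) \<omega> :: real)"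
        using B(1)[OF that] by (intro Bochner_Integration.integral_cong) (auto simp: indicator_def)
      then show ?thesis using Aev[OF that] by simp
    qed
    have "complex_of_real (prob (\<Inter>j\<in>J. A j)) = of_real (expectation (indicator (\<Inter>j\<in>J. A j)))"
      using inter by simp
    also have "\<dots> = (CLINT \<omega>|M. of_real (indicator (\<Inter>j\<in>J. A j) \<omega>))"
      by (rule integral_complex_of_real[symmetric])
    also have "\<dots> = (CLINT \<omega>|M. (\<Prod>k\<in>J. indicator (B k) (Y k \<omega>)) * iexp (\<Sum>j\<in>{}. 0 * Y j \<omega>))"
      by (intro Bochner_Integration.integral_cong) (auto simp: ind)
    also have "\<dots> = of_real (\<Prod>k\<in>J. expectation (\<lambda>\<omega>. indicator (B k) (Y k \<omega>)))"
      using key[of J B "{}"] J B by simp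
    finally show "prob (\<Inter>j\<in>J. A j) = (\<Prod>j\<in>J. prob (A j))"
      by (simp only: of_real_eq_iff iA cong: prod.cong)
  qed
qed

end

subsection \<open>Gaussian vectors in Hilbert space\<close>

text \<open>Injectivity of \<open>u\<close> makes the extended system infinite and separability
  makes it countable, so \<open>nat\<close> can enumerate it.\<close>

lemma orthonormal_seq_extend:
  fixes u :: "nat \<Rightarrow> 'h::{real_inner,second_countable_topology}"
  assumes u: "orthonormal_seq u"
  obtains e where "orthonormal_seq e" "range u \<subseteq> range e" "\<And>y. (\<And>i. y \<bullet> e i = 0) \<Longrightarrow> y = 0"
proof -
  have inj: "inj u" using orthonormal_seqD[OF u] by (metis injI zero_neq_one)
  have "orthonormal_set (range u)"
    using u inj by (auto simp: orthonormal_set_def orthonormal_seqD inj_eq)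
  then obtain B where B: "range u \<subseteq> B" "orthonormal_set B" "\<And>y. (\<And>e. e \<in> B \<Longrightarrow> y \<bullet> e = 0) \<Longrightarrow> y = 0"
    using orthonormal_set_extend by metis
  have "infinite B" using B(1) inj finite_subset range_inj_infinite by blast
  then have bij: "bij_betw (from_nat_into B) UNIV B"
    using orthonormal_set_countable[OF B(2)] by (intro bij_betw_from_nat_into)
  show ?thesis
  proof (rule that[of "from_nat_into B"])
    show "orthonormal_seq (from_nat_into B)"
      using B(2) bij unfolding orthonormal_seq_def orthonormal_set_def bij_betw_def
      by (metis injD rangeI)
    show "range u \<subseteq> range (from_nat_into B)" using B(1) bij by (simp add: bij_betw_def)
    show "y = 0" if "\<And>i. y \<bullet> from_nat_into B i = 0" for y
      using that bij by (intro B(3)) (metis bij_betw_def imageE)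
  qed
qed

text \<open>Everything is expressed through the variance, so that almost surely vanishing
  functionals and normal ones need no distinction afterwards. The fourth moment serves the
  truncation argument, the characteristic function serves independence.\<close>

lemma (in prob_space) centered_gaussian_functional:
  assumes X: "centered_gaussian M X"
  shows "integrable M (\<lambda>\<omega>. (y \<bullet> X \<omega>)\<^sup>2)" "integrable M (\<lambda>\<omega>. (y \<bullet> X \<omega>)^4)"
    and "expectation (\<lambda>\<omega>. (y \<bullet> X \<omega>)^4) = 3 * (expectation (\<lambda>\<omega>. (y \<bullet> X \<omega>)\<^sup>2))\<^sup>2"
    and "(CLINT \<omega>|M. iexp (y \<bullet> X \<omega>)) = of_real (exp (- expectation (\<lambda>\<omega>. (y \<bullet> X \<omega>)\<^sup>2) / 2))"
    and "expectation (\<lambda>\<omega>. (y \<bullet> X \<omega>)\<^sup>2) = \<sigma>\<^sup>2 \<Longrightarrow> \<sigma> > 0 \<Longrightarrow>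
      distributed M lborel (\<lambda>\<omega>. (y \<bullet> X \<omega>) / \<sigma>) std_normal_density"
proof -
  have [measurable]: "X \<in> borel_measurable M" using X by (simp add: centered_gaussian_def)
  consider "AE \<omega> in M. y \<bullet> X \<omega> = 0" | s where "s > 0" "distributed M lborel (\<lambda>\<omega>. y \<bullet> X \<omega>) (normal_density 0 s)"
    using X by (auto simp: centered_gaussian_def)
  then have "integrable M (\<lambda>\<omega>. (y \<bullet> X \<omega>)\<^sup>2) \<and> integrable M (\<lambda>\<omega>. (y \<bullet> X \<omega>)^4) \<and>
    expectation (\<lambda>\<omega>. (y \<bullet> X \<omega>)^4) = 3 * (expectation (\<lambda>\<omega>. (y \<bullet> X \<omega>)\<^sup>2))\<^sup>2 \<and>
    (CLINT \<omega>|M. iexp (y \<bullet> X \<omega>)) = of_real (exp (- expectation (\<lambda>\<omega>. (y \<bullet> X \<omega>)\<^sup>2) / 2)) \<and>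
    (expectation (\<lambda>\<omega>. (y \<bullet> X \<omega>)\<^sup>2) = \<sigma>\<^sup>2 \<longrightarrow> \<sigma> > 0 \<longrightarrow>
      distributed M lborel (\<lambda>\<omega>. (y \<bullet> X \<omega>) / \<sigma>) std_normal_density)"
  proof cases
    case 1
    have 2: "integrable M (\<lambda>\<omega>. (y \<bullet> X \<omega>)\<^sup>2) \<longleftrightarrow> integrable M (\<lambda>\<omega>. 0::real)"
      using 1 by (intro integrable_cong_AE) auto
    have 4: "integrable M (\<lambda>\<omega>. (y \<bullet> X \<omega>)^4) \<longleftrightarrow> integrable M (\<lambda>\<omega>. 0::real)"
      using 1 by (intro integrable_cong_AE) auto
    have e2: "expectation (\<lambda>\<omega>. (y \<bullet> X \<omega>)\<^sup>2) = expectation (\<lambda>\<omega>. 0)"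
      using 1 by (intro integral_cong_AE) auto
    have e4: "expectation (\<lambda>\<omega>. (y \<bullet> X \<omega>)^4) = expectation (\<lambda>\<omega>. 0)"
      using 1 by (intro integral_cong_AE) auto
    have ec: "(CLINT \<omega>|M. iexp (y \<bullet> X \<omega>)) = (CLINT \<omega>|M. 1)"
      using 1 by (intro integral_cong_AE) auto
    show ?thesis using 2 4 e2 e4 ec by (auto simp: prob_space)
  next
    case 2
    note D = 2(2)
    have n2: "has_bochner_integral lborel (\<lambda>x. normal_density 0 s x * x\<^sup>2) (s\<^sup>2)"
      using normal_moment_even[OF 2(1), of 0 1] 2(1) by (simp add: fact_numeral)
    have n4: "has_bochner_integral lborel (\<lambda>x. normal_density 0 s x * x^4) (3 * (s\<^sup>2)\<^sup>2)"
      using normal_moment_even[OF 2(1), of 0 2] 2(1)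
      by (simp add: fact_numeral field_simps power2_eq_square)
    have i2: "integrable M (\<lambda>\<omega>. (y \<bullet> X \<omega>)\<^sup>2)"
      using distributed_integrable[OF D, of "\<lambda>x. x\<^sup>2"] n2 by (auto simp: integrable.intros)
    have i4: "integrable M (\<lambda>\<omega>. (y \<bullet> X \<omega>)^4)"
      using distributed_integrable[OF D, of "\<lambda>x. x^4"] n4 by (auto simp: integrable.intros)
    have e2: "expectation (\<lambda>\<omega>. (y \<bullet> X \<omega>)\<^sup>2) = s\<^sup>2"
      using distributed_integral[OF D, of "\<lambda>x. x\<^sup>2"] n2 by (auto dest: has_bochner_integral_integral_eq)
    have e4: "expectation (\<lambda>\<omega>. (y \<bullet> X \<omega>)^4) = 3 * (s\<^sup>2)\<^sup>2"
      using distributed_integral[OF D, of "\<lambda>x. x^4"] n4 by (auto dest: has_bochner_integral_integral_eq)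
    have st: "distributed M lborel (\<lambda>\<omega>. (y \<bullet> X \<omega>) / s) std_normal_density"
      using D normal_standard_normal_convert[OF 2(1), of "\<lambda>\<omega>. y \<bullet> X \<omega>" 0] by simp
    have "(CLINT \<omega>|M. iexp (s * ((y \<bullet> X \<omega>) / s))) = (CLINT x|lborel. std_normal_density x *\<^sub>R iexp (s * x))"
    proof -
      have "(CLINT \<omega>|M. iexp (s * ((y \<bullet> X \<omega>) / s))) = (CLINT x|distr M lborel (\<lambda>\<omega>. (y \<bullet> X \<omega>) / s). iexp (s * x))"
        by (subst integral_distr) auto
      also have "\<dots> = (CLINT x|density lborel std_normal_density. iexp (s * x))"
        using st by (simp add: distributed_def)
      also have "\<dots> = (CLINT x|lborel. std_normal_density x *\<^sub>R iexp (s * x))"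
        by (subst integral_density) auto
      finally show ?thesis .
    qed
    also have "\<dots> = char std_normal_distribution s"
      unfolding char_def by (subst integral_density) auto
    also have "\<dots> = of_real (exp (- s\<^sup>2 / 2))" by (simp add: char_std_normal_distribution)
    finally have ec: "(CLINT \<omega>|M. iexp (y \<bullet> X \<omega>)) = of_real (exp (- s\<^sup>2 / 2))"
      using 2(1) by simp
    have "distributed M lborel (\<lambda>\<omega>. (y \<bullet> X \<omega>) / \<sigma>) std_normal_density"
      if "s\<^sup>2 = \<sigma>\<^sup>2" "\<sigma> > 0"
      using st that 2(1) by (metis less_imp_le power2_eq_imp_eq)
    then show ?thesis using i2 i4 e2 e4 ec by simp
  qed
  then show "integrable M (\<lambda>\<omega>. (y \<bullet> X \<omega>)\<^sup>2)" "integrable M (\<lambda>\<omega>. (y \<bullet> X \<omega>)^4)"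
    and "expectation (\<lambda>\<omega>. (y \<bullet> X \<omega>)^4) = 3 * (expectation (\<lambda>\<omega>. (y \<bullet> X \<omega>)\<^sup>2))\<^sup>2"
    and "(CLINT \<omega>|M. iexp (y \<bullet> X \<omega>)) = of_real (exp (- expectation (\<lambda>\<omega>. (y \<bullet> X \<omega>)\<^sup>2) / 2))"
    and "expectation (\<lambda>\<omega>. (y \<bullet> X \<omega>)\<^sup>2) = \<sigma>\<^sup>2 \<Longrightarrow> \<sigma> > 0 \<Longrightarrow>
      distributed M lborel (\<lambda>\<omega>. (y \<bullet> X \<omega>) / \<sigma>) std_normal_density"
    by blast+
qed

text \<open>A Gaussian functional of variance v has fourth moment 3 v^2, so an event of small
  probability cannot carry most of its variance. The point is that the same \<open>B\<close> works
  for every \<open>y\<close>.\<close>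

lemma (in prob_space) centered_gaussian_truncated_moment:
  assumes X: "centered_gaussian M X"
    and B: "B \<in> events" "prob B \<le> 1 / 12"
  shows "expectation (\<lambda>\<omega>. (y \<bullet> X \<omega>)\<^sup>2) \<le> 2 * expectation (\<lambda>\<omega>. (y \<bullet> X \<omega>)\<^sup>2 * indicator (space M - B) \<omega>)"
proof -
  note g = centered_gaussian_functional[OF X, of y]
  define v where "v = expectation (\<lambda>\<omega>. (y \<bullet> X \<omega>)\<^sup>2)"
  have "v \<ge> 0" unfolding v_def by (rule Bochner_Integration.integral_nonneg) auto
  have iC: "integrable M (\<lambda>\<omega>. (y \<bullet> X \<omega>)\<^sup>2 * indicator (space M - B) \<omega>)"
    by (rule integrable_real_mult_indicator) (use B g(1) in auto)
  have iB[simp]: "integrable M (\<lambda>\<omega>. indicator B \<omega> :: real)"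
    using B by (simp add: emeasure_eq_measure)
  show ?thesis
  proof (cases "v = 0")
    case True
    then show ?thesis unfolding v_def[symmetric] by simp
  next
    case False
    then have v: "v > 0" using \<open>v \<ge> 0\<close> by simp
    \<comment> \<open>Weighted so that each term integrates to at most v / 4: 3 v^2 / (12 v) from
      the fourth moment, 3 v / 12 from the probability of \<open>B\<close>.\<close>
    have pt: "x\<^sup>2 * i \<le> x^4 / (12 * v) + 3 * v * i" if "i = 0 \<or> i = 1" for x i :: real
    proof -
      have "0 \<le> (x\<^sup>2 - 6 * v * i)\<^sup>2 / (12 * v)" using v by simp
      also have "\<dots> = x^4 / (12 * v) + 3 * v * i\<^sup>2 - x\<^sup>2 * i"
        using v by (simp add: field_simps power2_eq_square power4_eq_xxxx)
      finally show ?thesis using that by auto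
    qed
    have split: "(y \<bullet> X \<omega>)\<^sup>2 \<le> (y \<bullet> X \<omega>)\<^sup>2 * indicator (space M - B) \<omega> + ((y \<bullet> X \<omega>)^4 / (12 * v) + 3 * v * indicator B \<omega>)"
      if "\<omega> \<in> space M" for \<omega>
      using pt[of "indicator B \<omega>" "y \<bullet> X \<omega>"] that by (auto simp: indicator_def split: if_splits)
    have "v \<le> expectation (\<lambda>\<omega>. (y \<bullet> X \<omega>)\<^sup>2 * indicator (space M - B) \<omega> + ((y \<bullet> X \<omega>)^4 / (12 * v) + 3 * v * indicator B \<omega>))"
      unfolding v_def
      by (rule integral_mono[OF g(1) _ split[unfolded v_def]])
         (use iC g(1,2) B in \<open>intro Bochner_Integration.integrable_add integrable_divide integrable_mult_right, auto simp: emeasure_eq_measure\<close>)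
    also have "\<dots> = expectation (\<lambda>\<omega>. (y \<bullet> X \<omega>)\<^sup>2 * indicator (space M - B) \<omega>) + (3 * v\<^sup>2 / (12 * v) + 3 * v * prob B)"
      using iC g(2) iB B(1) by (simp add: g(3) v_def)
    also have "3 * v\<^sup>2 / (12 * v) + 3 * v * prob B \<le> v / 2"
      using v B(2) by (simp add: power2_eq_square field_simps)
    finally show ?thesis unfolding v_def by simp
  qed
qed

text \<open>Off an event of probability at most 1/12 the squared norm is bounded by some
  \<open>K\<close>. There Bessel's inequality bounds the truncated variances of any n coordinates by
  \<open>K\<close> in total, and removing the truncation at most doubles this. The sequence
  \<open>u\<close> is the seed of the complete system used.\<close>

lemma (in prob_space) centered_gaussian_square_integrable:
  fixes X :: "'a \<Rightarrow> 'h::{real_inner,banach,second_countable_topology}"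
  assumes X: "centered_gaussian M X" and u: "orthonormal_seq (u :: nat \<Rightarrow> 'h)"
  shows "integrable M (\<lambda>\<omega>. (norm (X \<omega>))\<^sup>2)"
proof -
  have [measurable]: "X \<in> borel_measurable M" using X by (simp add: centered_gaussian_def)
  obtain e :: "nat \<Rightarrow> 'h" where e: "orthonormal_seq e" "\<And>y. (\<And>i. y \<bullet> e i = 0) \<Longrightarrow> y = 0"
    using orthonormal_seq_extend[OF u] by metis
  have pars: "(\<lambda>i. (x \<bullet> e i)\<^sup>2) sums (norm x)\<^sup>2" for x
    by (rule parseval[where C="{}"]) (use e in auto)
  let ?B = "\<lambda>n::nat. {\<omega> \<in> space M. (norm (X \<omega>))\<^sup>2 > n}"
  have "(\<lambda>n. prob (?B n)) \<longlonglongrightarrow> prob (\<Inter>n. ?B n)"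
    by (rule finite_Lim_measure_decseq) (auto simp: decseq_def)
  moreover have "(\<Inter>n. ?B n) = {}"
    by (auto simp: not_less) (meson not_less real_arch_simple)
  ultimately have "(\<lambda>n. prob (?B n)) \<longlonglongrightarrow> 0" by simp
  then have "\<forall>\<^sub>F n in sequentially. prob (?B n) < 1/12" by (rule order_tendstoD) simp
  then obtain K where "\<And>n. n \<ge> K \<Longrightarrow> prob (?B n) < 1/12" unfolding eventually_sequentially by blast
  then have K: "prob (?B K) \<le> 1/12" by (simp add: less_imp_le)
  let ?C = "space M - ?B K"
  have tr: "expectation (\<lambda>\<omega>. (X \<omega> \<bullet> e i)\<^sup>2) \<le> 2 * expectation (\<lambda>\<omega>. (X \<omega> \<bullet> e i)\<^sup>2 * indicator ?C \<omega>)" for i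
    using centered_gaussian_truncated_moment[OF X, of "?B K" "e i"] K by (simp add: inner_commute)
  have i: "integrable M (\<lambda>\<omega>. (X \<omega> \<bullet> e i)\<^sup>2)" for i
    using centered_gaussian_functional(1)[OF X, of "e i"] by (simp add: inner_commute)
  have iC: "integrable M (\<lambda>\<omega>. (X \<omega> \<bullet> e i)\<^sup>2 * indicator ?C \<omega>)" for i
    by (rule integrable_real_mult_indicator) (use i in auto)
  have bound: "(\<Sum>i<n. expectation (\<lambda>\<omega>. (X \<omega> \<bullet> e i)\<^sup>2)) \<le> 2 * K" for n
  proof -
    have "(\<Sum>i<n. expectation (\<lambda>\<omega>. (X \<omega> \<bullet> e i)\<^sup>2)) \<le> (\<Sum>i<n. 2 * expectation (\<lambda>\<omega>. (X \<omega> \<bullet> e i)\<^sup>2 * indicator ?C \<omega>))"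
      by (rule sum_mono) (rule tr)
    also have "\<dots> = 2 * expectation (\<lambda>\<omega>. \<Sum>i<n. (X \<omega> \<bullet> e i)\<^sup>2 * indicator ?C \<omega>)"
      by (subst Bochner_Integration.integral_sum[OF iC]) (rule sum_distrib_left[symmetric])
    also have "\<dots> \<le> 2 * expectation (\<lambda>\<omega>. real K)"
    proof (intro mult_left_mono integral_mono)
      fix \<omega> assume "\<omega> \<in> space M"
      then show "(\<Sum>i<n. (X \<omega> \<bullet> e i)\<^sup>2 * indicator ?C \<omega>) \<le> real K"
        using bessel_ineq_seq[OF e(1), of "{..<n}" "X \<omega>"] by (auto simp: indicator_def)
    qed (rule Bochner_Integration.integrable_sum iC | simp)+
    finally show ?thesis by (simp add: prob_space)
  qed
  have "(\<integral>\<^sup>+ \<omega>. ennreal ((norm (X \<omega>))\<^sup>2) \<partial>M) = (\<integral>\<^sup>+ \<omega>. (\<Sum>i. ennreal ((X \<omega> \<bullet> e i)\<^sup>2)) \<partial>M)"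
  proof (rule nn_integral_cong)
    fix \<omega>
    show "ennreal ((norm (X \<omega>))\<^sup>2) = (\<Sum>i. ennreal ((X \<omega> \<bullet> e i)\<^sup>2))"
      using pars[of "X \<omega>"] by (subst suminf_ennreal2) (auto simp: sums_iff)
  qed
  also have "\<dots> = (\<Sum>i. \<integral>\<^sup>+ \<omega>. ennreal ((X \<omega> \<bullet> e i)\<^sup>2) \<partial>M)"
    by (rule nn_integral_suminf) auto
  also have "\<dots> = (\<Sum>i. ennreal (expectation (\<lambda>\<omega>. (X \<omega> \<bullet> e i)\<^sup>2)))"
    using i by (intro suminf_cong nn_integral_eq_integral) auto
  also have "\<dots> \<le> ennreal (2 * K)"
    using bound by (intro suminf_le_const) (auto simp: sum_ennreal intro!: ennreal_leI)
  finally show ?thesis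
    by (intro integrableI_nonneg) (auto simp: less_top[symmetric] top_unique)
qed

section \<open>Independent standard normal coordinates along the eigenvectors\<close>

text \<open>Eigenvalues are counted from 0 here. Since \<open>v\<close> need not be complete,
  \<open>cov0\<close> expresses that all directions orthogonal to it carry no variance.\<close>

locale gaussian_eigen = prob_space M for M :: "'w measure" +
  fixes X :: "'w \<Rightarrow> 'h::{real_inner,banach,second_countable_topology}"
    and L :: "nat \<Rightarrow> real" and v :: "nat \<Rightarrow> 'h"
  assumes gauss: "centered_gaussian M X"
    and L_pos: "\<And>i. L i > 0"
    and v: "orthonormal_seq v"
    and cov: "\<And>i. cov_op M X (v i) = L i *\<^sub>R v i"
    and cov0: "\<And>y. (\<And>i. y \<bullet> v i = 0) \<Longrightarrow> cov_op M X y = 0"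
begin

lemma X_measurable[measurable]: "X \<in> borel_measurable M"
  using gauss by (simp add: centered_gaussian_def)

definition Z :: "nat \<Rightarrow> 'w \<Rightarrow> real" where "Z i \<omega> = (X \<omega> \<bullet> v i) / sqrt (L i)"

lemma Z_measurable[measurable]: "Z i \<in> borel_measurable M"
  unfolding Z_def by measurable

lemma norm_X_sq_integrable: "integrable M (\<lambda>\<omega>. (norm (X \<omega>))\<^sup>2)"
  by (rule centered_gaussian_square_integrable[OF gauss v])

lemma inner_inner_integrable: "integrable M (\<lambda>\<omega>. (y \<bullet> X \<omega>) *\<^sub>R X \<omega>)"
proof (rule Bochner_Integration.integrable_bound)
  show "integrable M (\<lambda>\<omega>. norm y * (norm (X \<omega>))\<^sup>2)" using norm_X_sq_integrable by simp
  show "AE \<omega> in M. norm ((y \<bullet> X \<omega>) *\<^sub>R X \<omega>) \<le> norm (norm y * (norm (X \<omega>))\<^sup>2)"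
    using Cauchy_Schwarz_ineq2[of y] by (auto simp: power2_eq_square mult.assoc[symmetric] intro!: mult_right_mono)
qed simp

lemma covariance: "expectation (\<lambda>\<omega>. (y \<bullet> X \<omega>) * (z \<bullet> X \<omega>)) = z \<bullet> cov_op M X y"
proof -
  have "z \<bullet> cov_op M X y = expectation (\<lambda>\<omega>. z \<bullet> ((y \<bullet> X \<omega>) *\<^sub>R X \<omega>))"
    unfolding cov_op_def by (rule integral_inner_right[symmetric]) (use inner_inner_integrable in simp)
  then show ?thesis by simp
qed

lemma variance_sum:
  assumes "finite I"
  shows "expectation (\<lambda>\<omega>. ((\<Sum>i\<in>I. c i *\<^sub>R v i) \<bullet> X \<omega>)\<^sup>2) = (\<Sum>i\<in>I. (c i)\<^sup>2 * L i)"
proof -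
  let ?y = "\<Sum>i\<in>I. c i *\<^sub>R v i"
  have lin: "?y \<bullet> X \<omega> = (\<Sum>i\<in>I. c i * (v i \<bullet> X \<omega>))" for \<omega> by (simp add: inner_sum_left)
  have int: "integrable M (\<lambda>\<omega>. (y \<bullet> X \<omega>) * (z \<bullet> X \<omega>))" for y z
    using inner_inner_integrable[of y] integrable_inner_right[of z M "\<lambda>\<omega>. (y \<bullet> X \<omega>) *\<^sub>R X \<omega>"] by simp
  have "expectation (\<lambda>\<omega>. (?y \<bullet> X \<omega>)\<^sup>2) = expectation (\<lambda>\<omega>. \<Sum>i\<in>I. c i * ((v i \<bullet> X \<omega>) * (?y \<bullet> X \<omega>)))"
    unfolding power2_eq_square by (subst (2) lin) (simp add: sum_distrib_right mult_ac)
  also have "\<dots> = (\<Sum>i\<in>I. c i * expectation (\<lambda>\<omega>. (v i \<bullet> X \<omega>) * (?y \<bullet> X \<omega>)))"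
    by (subst Bochner_Integration.integral_sum) (auto intro!: integrable_mult_right int)
  also have "\<dots> = (\<Sum>i\<in>I. c i * (?y \<bullet> (L i *\<^sub>R v i)))" by (simp only: covariance cov)
  also have "\<dots> = (\<Sum>i\<in>I. (c i)\<^sup>2 * L i)"
    by (rule sum.cong) (auto simp: orthonormal_seq_sum_inner[OF v assms] power2_eq_square)
  finally show ?thesis .
qed

lemma coord_variance: "expectation (\<lambda>\<omega>. (X \<omega> \<bullet> v i)\<^sup>2) = L i"
  using variance_sum[of "{i}" "\<lambda>_. 1"] by (simp add: inner_commute)

lemma coord_sq_integrable: "integrable M (\<lambda>\<omega>. (X \<omega> \<bullet> v i)\<^sup>2)"
  using centered_gaussian_functional(1)[OF gauss, of "v i"] by (simp add: inner_commute)

lemma Z_std_normal: "distributed M lborel (Z i) std_normal_density"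
  unfolding Z_def using centered_gaussian_functional(5)[OF gauss, of "v i" "sqrt (L i)"] L_pos[of i] coord_variance[of i]
  by (simp add: inner_commute)

text \<open>A finite linear combination of the \<open>Z i\<close> is a functional of
  \<open>X\<close>, hence Gaussian, and its variance is the sum of the squared coefficients; so its
  characteristic function is a product.\<close>

lemma Z_indep: "indep_vars (\<lambda>_. borel) Z UNIV"
proof (rule indep_vars_if_char_factorizes)
  have fin: "(CLINT \<omega>|M. iexp (\<Sum>j\<in>J. t j * Z j \<omega>)) = of_real (exp (- (\<Sum>j\<in>J. (t j)\<^sup>2) / 2))"
    if "finite J" for J t
  proof -
    let ?y = "\<Sum>i\<in>J. (t i / sqrt (L i)) *\<^sub>R v i"
    have "(\<Sum>j\<in>J. t j * Z j \<omega>) = ?y \<bullet> X \<omega>" for \<omega>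
      by (subst inner_commute) (simp add: inner_sum_right Z_def)
    moreover have "expectation (\<lambda>\<omega>. (?y \<bullet> X \<omega>)\<^sup>2) = (\<Sum>j\<in>J. (t j)\<^sup>2)"
      unfolding variance_sum[OF that] using L_pos
      by (intro sum.cong) (auto simp: power_divide less_imp_le less_imp_neq[symmetric])
    ultimately show ?thesis using centered_gaussian_functional(4)[OF gauss, of ?y] by simp
  qed
  fix J :: "nat set" and t assume J: "finite J"
  have "(CLINT \<omega>|M. iexp (t j * Z j \<omega>)) = of_real (exp (- (t j)\<^sup>2 / 2))" for j
    using fin[of "{j}" t] by simp
  then show "(CLINT \<omega>|M. iexp (\<Sum>j\<in>J. t j * Z j \<omega>)) = (\<Prod>j\<in>J. CLINT \<omega>|M. iexp (t j * Z j \<omega>))"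
    unfolding fin[OF J] using J
    by (simp add: sum_negf[symmetric] sum_divide_distrib exp_sum del: of_real_exp flip: of_real_prod)
qed simp

text \<open>In a completion of \<open>v\<close> each additional direction has variance 0, so
  \<open>X\<close> is almost surely orthogonal to it. There are countably many such directions, and
  one null set serves them all.\<close>

lemma AE_parseval: "AE \<omega> in M. (\<lambda>i. (X \<omega> \<bullet> v i)\<^sup>2) sums (norm (X \<omega>))\<^sup>2"
proof -
  obtain e :: "nat \<Rightarrow> 'h" where e: "orthonormal_seq e" "range v \<subseteq> range e" "\<And>y. (\<And>i. y \<bullet> e i = 0) \<Longrightarrow> y = 0"
    using orthonormal_seq_extend[OF v] by metis
  let ?C = "range e - range v"
  have C: "f \<bullet> v i = 0" if f: "f \<in> ?C" for f i
  proof -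
    have "v i \<in> range e" using e(2) by (rule subsetD) simp
    then obtain k where k: "v i = e k" by (rule rangeE)
    obtain j where "f = e j" using f by auto
    with k show ?thesis using that orthonormal_seqD[OF e(1), of j k] by (cases "j = k") (auto, metis rangeI)
  qed
  have z: "AE \<omega> in M. X \<omega> \<bullet> f = 0" if "f \<in> ?C" for f
  proof -
    have "cov_op M X f = 0" using C[OF that] by (rule cov0)
    then have "expectation (\<lambda>\<omega>. (f \<bullet> X \<omega>)\<^sup>2) = 0"
      using covariance[of f f] by (simp add: power2_eq_square)
    then have "AE \<omega> in M. (f \<bullet> X \<omega>)\<^sup>2 = 0"
      using integral_nonneg_eq_0_iff_AE[OF centered_gaussian_functional(1)[OF gauss, of f]] by auto
    then show ?thesis by (simp add: inner_commute)
  qed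
  have "AE \<omega> in M. \<forall>f\<in>?C. X \<omega> \<bullet> f = 0"
    by (subst AE_ball_countable) (use z in auto)
  then show ?thesis
  proof (rule AE_mp[OF _ AE_I2], intro impI)
    fix \<omega> assume \<omega>: "\<forall>f\<in>?C. X \<omega> \<bullet> f = 0"
    show "(\<lambda>i. (X \<omega> \<bullet> v i)\<^sup>2) sums (norm (X \<omega>))\<^sup>2"
    proof (rule parseval[OF v, where C="?C"])
      show "y = 0" if "\<And>i. y \<bullet> v i = 0" "\<And>f. f \<in> ?C \<Longrightarrow> y \<bullet> f = 0" for y
        using that by (intro e(3)) (metis DiffI rangeE rangeI)
    qed (use \<omega> C in auto)
  qed
qed

text \<open>Trace formula, by dominated convergence with Bessel's inequality as the bound. It is the
  source of the summability of the eigenvalues and of their convergence to 0.\<close>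

lemma L_sums: "L sums expectation (\<lambda>\<omega>. (norm (X \<omega>))\<^sup>2)"
proof -
  have "(\<lambda>n. expectation (\<lambda>\<omega>. \<Sum>i<n. (X \<omega> \<bullet> v i)\<^sup>2)) \<longlonglongrightarrow> expectation (\<lambda>\<omega>. (norm (X \<omega>))\<^sup>2)"
  proof (rule integral_dominated_convergence[where w="\<lambda>\<omega>. (norm (X \<omega>))\<^sup>2"])
    show "AE \<omega> in M. (\<lambda>n. \<Sum>i<n. (X \<omega> \<bullet> v i)\<^sup>2) \<longlonglongrightarrow> (norm (X \<omega>))\<^sup>2"
      using AE_parseval by (simp add: sums_def)
    show "AE \<omega> in M. norm (\<Sum>i<n. (X \<omega> \<bullet> v i)\<^sup>2) \<le> (norm (X \<omega>))\<^sup>2" for n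
      by (rule AE_I2) (simp add: sum_nonneg bessel_ineq_seq[OF v])
  qed (use norm_X_sq_integrable in auto)
  then show ?thesis using coord_sq_integrable by (simp add: sums_def coord_variance)
qed

end

subsection \<open>Random coding for the standard Gaussian law\<close>

abbreviation gaussian_product :: "nat \<Rightarrow> (nat \<Rightarrow> real) measure" where
  "gaussian_product l \<equiv> PiM {..<l} (\<lambda>_. std_normal_distribution)"

lemma prob_space_std_normal: "prob_space std_normal_distribution"
  by (rule prob_space_normal_density) simp

lemma prob_space_gaussian_product: "prob_space (gaussian_product l)"
  by (rule prob_space_PiM) (rule prob_space_std_normal)

lemma product_sigma_finite_std_normal: "product_sigma_finite (\<lambda>_::nat. std_normal_distribution)"
  by (simp add: product_sigma_finite_def prob_space_std_normal prob_space_imp_sigma_finite)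

lemma sets_gaussian_PiM[measurable_cong]:
  "sets (PiM I (\<lambda>_. std_normal_distribution)) = sets (PiM I (\<lambda>_. borel))"
  by (rule sets_PiM_cong) auto

text \<open>\<open>tilt c t z g\<close> is the Jacobian-weighted density ratio for the substitution \<open>w = c z + t g\<close> under the
  standard normal law.\<close>

definition tilt :: "real \<Rightarrow> real \<Rightarrow> real \<Rightarrow> real \<Rightarrow> real" where
  "tilt c t z g = t * exp (g\<^sup>2 / 2 - (c * z + t * g)\<^sup>2 / 2)"

lemma std_normal_nn_integral_affine:
  assumes [measurable]: "f \<in> borel_measurable borel" and t: "t > 0"
  shows "(\<integral>\<^sup>+ w. f w \<partial>std_normal_distribution) =
         (\<integral>\<^sup>+ g. f (c * z + t * g) * ennreal (tilt c t z g) \<partial>std_normal_distribution)"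
proof -
  have "(\<integral>\<^sup>+ w. f w \<partial>std_normal_distribution) = (\<integral>\<^sup>+ w. ennreal (std_normal_density w) * f w \<partial>lborel)"
    by (subst nn_integral_density) auto
  also have "\<dots> = ennreal t * (\<integral>\<^sup>+ g. ennreal (std_normal_density (c * z + t * g)) * f (c * z + t * g) \<partial>lborel)"
    using t by (subst nn_integral_real_affine[where c=t and t="c * z"]) auto
  also have "\<dots> = (\<integral>\<^sup>+ g. ennreal t * (ennreal (std_normal_density (c * z + t * g)) * f (c * z + t * g)) \<partial>lborel)"
    by (subst nn_integral_cmult) auto
  also have "\<dots> = (\<integral>\<^sup>+ g. ennreal (std_normal_density g) * (f (c * z + t * g) * ennreal (tilt c t z g)) \<partial>lborel)"
  proof (rule nn_integral_cong)
    fix g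
    have "exp (- (c * z + t * g)\<^sup>2 / 2) = exp (- g\<^sup>2 / 2) * exp (g\<^sup>2 / 2 - (c * z + t * g)\<^sup>2 / 2)"
      by (simp add: exp_add[symmetric])
    then have "t * std_normal_density (c * z + t * g) = std_normal_density g * tilt c t z g"
      unfolding std_normal_density_def tilt_def by simp
    then have "ennreal t * ennreal (std_normal_density (c * z + t * g)) = ennreal (std_normal_density g) * ennreal (tilt c t z g)"
      using t by (simp add: ennreal_mult[symmetric] tilt_def)
    then show "ennreal t * (ennreal (std_normal_density (c * z + t * g)) * f (c * z + t * g)) =
      ennreal (std_normal_density g) * (f (c * z + t * g) * ennreal (tilt c t z g))"
      by (metis mult.assoc mult.commute)
  qed
  also have "\<dots> = (\<integral>\<^sup>+ g. f (c * z + t * g) * ennreal (tilt c t z g) \<partial>std_normal_distribution)"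
    unfolding tilt_def by (subst nn_integral_density) auto
  finally show ?thesis .
qed

text \<open>Fubini reduces the substitution to one coordinate at a time. \<open>F\<close> stays
  arbitrary because the induction hypothesis is applied to the inner integral.\<close>

lemma gaussian_PiM_nn_integral_affine:
  fixes z :: "nat \<Rightarrow> real"
  assumes "finite I" and F: "F \<in> borel_measurable (PiM I (\<lambda>_. borel :: real measure))" and t: "t > 0"
  shows "(\<integral>\<^sup>+ w. F w \<partial>PiM I (\<lambda>_. std_normal_distribution)) =
    (\<integral>\<^sup>+ g. F (\<lambda>i\<in>I. c * z i + t * g i) * (\<Prod>i\<in>I. ennreal (tilt c t (z i) (g i))) \<partial>PiM I (\<lambda>_. std_normal_distribution))"
  using assms(1,2)
proof (induction I arbitrary: F rule: finite_induct)
  case empty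
  then show ?case by (simp add: PiM_empty nn_integral_count_space_finite)
next
  case (insert i I)
  interpret product_sigma_finite "\<lambda>_::nat. std_normal_distribution" by (rule product_sigma_finite_std_normal)
  interpret sigma_finite_measure std_normal_distribution
    by (simp add: prob_space_std_normal prob_space_imp_sigma_finite)
  note [measurable] = insert.prems
  have [measurable]: "tilt c t z \<in> borel_measurable borel" for z unfolding tilt_def by measurable
  let ?P = "PiM I (\<lambda>_. std_normal_distribution)"
  let ?F = "\<lambda>x. \<integral>\<^sup>+ y. F (x(i := c * z i + t * y)) * ennreal (tilt c t (z i) y) \<partial>std_normal_distribution"
  have "(\<integral>\<^sup>+ w. F w \<partial>PiM (insert i I) (\<lambda>_. std_normal_distribution)) =
     (\<integral>\<^sup>+ x. (\<integral>\<^sup>+ y. F (x(i := y)) \<partial>std_normal_distribution) \<partial>?P)"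
    using insert.hyps by (intro product_nn_integral_insert) auto
  also have "\<dots> = (\<integral>\<^sup>+ x. ?F x \<partial>?P)"
  proof (rule nn_integral_cong)
    fix x assume x: "x \<in> space ?P"
    have [measurable]: "(\<lambda>y. F (x(i := y))) \<in> borel_measurable borel"
    proof -
      have "(\<lambda>y. x(i := y)) \<in> measurable borel (PiM (insert i I) (\<lambda>_. borel :: real measure))"
        using x by (intro measurable_fun_upd[where J=I] measurable_const) (auto simp: space_PiM)
      then show ?thesis by (rule measurable_compose[OF _ insert.prems])
    qed
    show "(\<integral>\<^sup>+ y. F (x(i := y)) \<partial>std_normal_distribution) = ?F x"
      by (rule std_normal_nn_integral_affine[OF _ t]) simp
  qed
  also have "\<dots> = (\<integral>\<^sup>+ g. ?F (\<lambda>j\<in>I. c * z j + t * g j) * (\<Prod>j\<in>I. ennreal (tilt c t (z j) (g j))) \<partial>?P)"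
    by (rule insert.IH) measurable
  also have "\<dots> = (\<integral>\<^sup>+ g. \<integral>\<^sup>+ y. F ((\<lambda>j\<in>I. c * z j + t * g j)(i := c * z i + t * y)) *
       ennreal (tilt c t (z i) y) * (\<Prod>j\<in>I. ennreal (tilt c t (z j) (g j))) \<partial>std_normal_distribution \<partial>?P)"
  proof (rule nn_integral_cong)
    fix g assume x: "g \<in> space ?P"
    let ?x = "\<lambda>j\<in>I. c * z j + t * g j"
    have [measurable]: "(\<lambda>y. F (?x(i := c * z i + t * y))) \<in> borel_measurable borel"
    proof -
      have "(\<lambda>y. ?x(i := c * z i + t * y)) \<in> measurable borel (PiM (insert i I) (\<lambda>_. borel :: real measure))"
        by (intro measurable_fun_upd[where J=I] measurable_const) (auto simp: space_PiM)
      then show ?thesis by (rule measurable_compose[OF _ insert.prems])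
    qed
    show "?F ?x * (\<Prod>j\<in>I. ennreal (tilt c t (z j) (g j))) = (\<integral>\<^sup>+ y. F (?x(i := c * z i + t * y)) *
       ennreal (tilt c t (z i) y) * (\<Prod>j\<in>I. ennreal (tilt c t (z j) (g j))) \<partial>std_normal_distribution)"
      by (rule nn_integral_multc[symmetric]) measurable
  qed
  also have "\<dots> = (\<integral>\<^sup>+ g. \<integral>\<^sup>+ y. (\<lambda>g. F (\<lambda>j\<in>insert i I. c * z j + t * g j) *
       (\<Prod>j\<in>insert i I. ennreal (tilt c t (z j) (g j)))) (g(i := y)) \<partial>std_normal_distribution \<partial>?P)"
  proof (intro nn_integral_cong)
    fix g y
    have "(\<lambda>j\<in>I. c * z j + t * g j)(i := c * z i + t * y) = (\<lambda>j\<in>insert i I. c * z j + t * (g(i := y)) j)"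
      by (auto simp: fun_eq_iff)
    moreover have "(\<Prod>j\<in>insert i I. ennreal (tilt c t (z j) ((g(i := y)) j))) =
        ennreal (tilt c t (z i) y) * (\<Prod>j\<in>I. ennreal (tilt c t (z j) (g j)))"
      using insert.hyps by (auto intro!: prod.cong arg_cong2[where f="(*)"])
    ultimately show "F ((\<lambda>j\<in>I. c * z j + t * g j)(i := c * z i + t * y)) *
       ennreal (tilt c t (z i) y) * (\<Prod>j\<in>I. ennreal (tilt c t (z j) (g j))) =
      (\<lambda>g. F (\<lambda>j\<in>insert i I. c * z j + t * g j) *
       (\<Prod>j\<in>insert i I. ennreal (tilt c t (z j) (g j)))) (g(i := y))"
      by (simp add: mult.assoc)
  qed
  also have "\<dots> = (\<integral>\<^sup>+ g. F (\<lambda>j\<in>insert i I. c * z j + t * g j) *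
       (\<Prod>j\<in>insert i I. ennreal (tilt c t (z j) (g j))) \<partial>PiM (insert i I) (\<lambda>_. std_normal_distribution))"
    using insert.hyps by (intro product_nn_integral_insert[symmetric]) measurable
  finally show ?case .
qed

lemma PiM_sum_square:
  fixes f :: "nat \<Rightarrow> real \<Rightarrow> real"
  assumes I: "finite I" and P: "\<And>i. prob_space (P i)"
    and f1: "\<And>i. i \<in> I \<Longrightarrow> integrable (P i) (f i)" and f2: "\<And>i. i \<in> I \<Longrightarrow> integrable (P i) (\<lambda>x. (f i x)\<^sup>2)"
    and f0: "\<And>i. i \<in> I \<Longrightarrow> (\<integral>x. f i x \<partial>P i) = 0"
  shows "integrable (PiM I P) (\<lambda>x. (\<Sum>i\<in>I. f i (x i))\<^sup>2)"
    and "(\<integral>x. (\<Sum>i\<in>I. f i (x i))\<^sup>2 \<partial>PiM I P) = (\<Sum>i\<in>I. \<integral>x. (f i x)\<^sup>2 \<partial>P i)"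
proof -
  interpret product_sigma_finite P
    by (simp add: product_sigma_finite_def P prob_space_imp_sigma_finite)
  interpret P: prob_space "P i" for i by (rule P)
  \<comment> \<open>Each product of two factors becomes a product over all of \<open>I\<close>, with
    1 in the other places, so that integration factorizes; for i different from j the factor at i
    integrates to 0.\<close>
  let ?h = "\<lambda>i j k y. if k = i then if k = j then (f i y)\<^sup>2 else f i y else if k = j then f j y else 1"
  have pr: "f i (x i) * f j (x j) = (\<Prod>k\<in>I. ?h i j k (x k))" if "i \<in> I" "j \<in> I" for i j x
  proof (cases "i = j")
    case True
    then show ?thesis using that I by (simp add: prod.remove[of I j] power2_eq_square)
  next
    case False
    have "(\<Prod>k\<in>I - {i} - {j}. ?h i j k (x k)) = 1" by (rule prod.neutral) auto
    then show ?thesis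
      using that I False by (simp add: prod.remove[of I i] prod.remove[of "I - {i}" j])
  qed
  have ih: "integrable (P k) (?h i j k)" if "k \<in> I" for i j k
    using f1[OF that] f2[OF that] by (cases "k = i"; cases "k = j") auto
  have ii: "integrable (PiM I P) (\<lambda>x. f i (x i) * f j (x j))" if "i \<in> I" "j \<in> I" for i j
    unfolding pr[OF that] by (rule product_integrable_prod[OF I ih])
  have e: "(\<integral>x. f i (x i) * f j (x j) \<partial>PiM I P) = (if i = j then \<integral>x. (f i x)\<^sup>2 \<partial>P i else 0)"
    if "i \<in> I" "j \<in> I" for i j
  proof -
    have "(\<integral>x. f i (x i) * f j (x j) \<partial>PiM I P) = (\<Prod>k\<in>I. \<integral>y. ?h i j k y \<partial>P k)"
      unfolding pr[OF that] by (rule product_integral_prod[OF I ih])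
    also have "\<dots> = (if i = j then \<integral>x. (f i x)\<^sup>2 \<partial>P i else 0)"
    proof (cases "i = j")
      case True
      have "(\<Prod>k\<in>I - {i}. \<integral>y. ?h i j k y \<partial>P k) = 1"
        using True by (intro prod.neutral) (auto simp: P.prob_space)
      then show ?thesis using True that I by (simp add: prod.remove[of I i])
    next
      case False
      have "(\<integral>y. ?h i j i y \<partial>P i) = 0" using False f0 that by simp
      then have "(\<Prod>k\<in>I. \<integral>y. ?h i j k y \<partial>P k) = 0" using that I by (intro prod_zero bexI[of _ i]) 
      then show ?thesis using False by simp
    qed
    finally show ?thesis .
  qed
  have sq: "(\<Sum>i\<in>I. f i (x i))\<^sup>2 = (\<Sum>i\<in>I. \<Sum>j\<in>I. f i (x i) * f j (x j))" for x
    by (simp add: power2_eq_square sum_product)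
  show "integrable (PiM I P) (\<lambda>x. (\<Sum>i\<in>I. f i (x i))\<^sup>2)"
    unfolding sq by (intro Bochner_Integration.integrable_sum ii)
  have "(\<integral>x. (\<Sum>i\<in>I. f i (x i))\<^sup>2 \<partial>PiM I P) = (\<Sum>i\<in>I. \<Sum>j\<in>I. \<integral>x. f i (x i) * f j (x j) \<partial>PiM I P)"
    unfolding sq by (subst Bochner_Integration.integral_sum, intro Bochner_Integration.integrable_sum ii, assumption+)
      (intro sum.cong refl Bochner_Integration.integral_sum ii)
  also have "\<dots> = (\<Sum>i\<in>I. \<Sum>j\<in>I. if i = j then \<integral>x. (f i x)\<^sup>2 \<partial>P i else 0)"
    by (intro sum.cong refl e)
  finally show "(\<integral>x. (\<Sum>i\<in>I. f i (x i))\<^sup>2 \<partial>PiM I P) = (\<Sum>i\<in>I. \<integral>x. (f i x)\<^sup>2 \<partial>P i)"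
    using I by simp
qed

text \<open>Chebyshev's inequality twice: the sum of the \<open>(g i)\<^sup>2 - 1\<close> has
  variance 2 l, that of the \<open>z i * g i\<close> at most (1 + \<eta>) l, hence at most 2 l. Each
  exceptional event has probability at most 2 / (\<eta>^2 l), which is at most 1/4 by the assumption
  on \<open>l\<close>.\<close>

lemma gaussian_product_typical:
  fixes \<eta> :: real
  assumes \<eta>: "0 < \<eta>" "\<eta> \<le> 1" and l: "real l \<ge> 8 / \<eta>\<^sup>2"
    and z: "(\<Sum>i<l. (z i)\<^sup>2) \<le> (1 + \<eta>) * l"
  shows "measure (gaussian_product l) {g \<in> space (gaussian_product l).
    \<bar>(\<Sum>i<l. (g i)\<^sup>2) - l\<bar> < \<eta> * l \<and> \<bar>\<Sum>i<l. z i * g i\<bar> < \<eta> * l} \<ge> 1 / 2"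
    and "measure (gaussian_product l) {g \<in> space (gaussian_product l).
    (\<Sum>i<l. (g i)\<^sup>2) \<ge> (1 + \<eta>) * l} \<le> 2 / (\<eta>\<^sup>2 * l)"
proof -
  interpret prob_space "gaussian_product l" by (rule prob_space_gaussian_product)
  interpret N: prob_space std_normal_distribution by (rule prob_space_std_normal)
  have N1: "N.prob UNIV = 1" using N.prob_space by simp
  let ?G = "gaussian_product l"
  have l0: "real l > 0" using l \<eta> by (smt (verit) divide_pos_pos zero_less_power)
  have m: "integrable std_normal_distribution (\<lambda>x. x ^ k)" for k
    by (rule integrable_std_normal_distribution_moment)
  have m1: "(\<integral>x. x \<partial>std_normal_distribution) = 0"
    using integral_std_normal_distribution_moment_odd[of 1] by simp
  have m2: "(\<integral>x. x\<^sup>2 \<partial>std_normal_distribution) = 1"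
    using std_normal_distribution_even_moments(1)[of 1] by simp
  have m4: "(\<integral>x. x^4 \<partial>std_normal_distribution) = 3"
    using std_normal_distribution_even_moments(1)[of 2] by (simp add: fact_numeral)
  have sq1: "(x\<^sup>2 - 1)\<^sup>2 = x^4 - 2 * x\<^sup>2 + 1" for x :: real
    by (simp add: power2_diff power_mult[symmetric])
  have S: "integrable ?G (\<lambda>g. (\<Sum>i<l. (g i)\<^sup>2 - 1)\<^sup>2)"
    "expectation (\<lambda>g. (\<Sum>i<l. (g i)\<^sup>2 - 1)\<^sup>2) = (\<Sum>i<l. 2)"
  proof -
    have i1: "integrable std_normal_distribution (\<lambda>x. x\<^sup>2 - 1 :: real)" using m[of 2] by simp
    have i2: "integrable std_normal_distribution (\<lambda>x. (x\<^sup>2 - 1)\<^sup>2 :: real)" unfolding sq1 using m[of 2] m[of 4] by simp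
    have e1: "(\<integral>x. x\<^sup>2 - 1 \<partial>std_normal_distribution) = (0::real)" using m[of 2] by (simp add: m2 N1)
    have e2: "(\<integral>x. (x\<^sup>2 - 1)\<^sup>2 \<partial>std_normal_distribution) = (2::real)" unfolding sq1 using m[of 2] m[of 4] by (simp add: m2 m4 N1)
    show "integrable ?G (\<lambda>g. (\<Sum>i<l. (g i)\<^sup>2 - 1)\<^sup>2)"
      by (rule PiM_sum_square(1)[where f="\<lambda>_ x. x\<^sup>2 - 1"]) (use i1 i2 e1 prob_space_std_normal in auto)
    show "expectation (\<lambda>g. (\<Sum>i<l. (g i)\<^sup>2 - 1)\<^sup>2) = (\<Sum>i<l. 2)"
      by (subst PiM_sum_square(2)[where f="\<lambda>_ x. x\<^sup>2 - 1"]) (use i1 i2 e1 e2 prob_space_std_normal in auto)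
  qed
  have T: "integrable ?G (\<lambda>g. (\<Sum>i<l. z i * g i)\<^sup>2)"
    "expectation (\<lambda>g. (\<Sum>i<l. z i * g i)\<^sup>2) = (\<Sum>i<l. (z i)\<^sup>2)"
  proof -
    have i1: "integrable std_normal_distribution (\<lambda>x. a * x :: real)" for a using m[of 1] by simp
    have i2: "integrable std_normal_distribution (\<lambda>x. (a * x)\<^sup>2 :: real)" for a using m[of 2] by (simp add: power_mult_distrib)
    have e1: "(\<integral>x. a * x \<partial>std_normal_distribution) = (0::real)" for a by (simp add: m1)
    have e2: "(\<integral>x. (a * x)\<^sup>2 \<partial>std_normal_distribution) = a\<^sup>2" for a by (simp add: m2 power_mult_distrib)
    show "integrable ?G (\<lambda>g. (\<Sum>i<l. z i * g i)\<^sup>2)"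
      by (rule PiM_sum_square(1)[where f="\<lambda>i x. z i * x"]) (use i1 i2 e1 prob_space_std_normal in auto)
    show "expectation (\<lambda>g. (\<Sum>i<l. z i * g i)\<^sup>2) = (\<Sum>i<l. (z i)\<^sup>2)"
      by (subst PiM_sum_square(2)[where f="\<lambda>i x. z i * x"]) (use i1 i2 e1 e2 prob_space_std_normal in auto)
  qed
  have \<eta>l: "\<eta> * l > 0" using \<eta> l0 by simp
  have \<eta>l2: "(\<eta> * l)\<^sup>2 > 0" using \<eta>l by (rule zero_less_power)
  let ?A = "{g \<in> space ?G. (\<Sum>i<l. (g i)\<^sup>2 - 1)\<^sup>2 \<ge> (\<eta> * l)\<^sup>2}"
  let ?B = "{g \<in> space ?G. (\<Sum>i<l. z i * g i)\<^sup>2 \<ge> (\<eta> * l)\<^sup>2}"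
  have A: "prob ?A \<le> (2 * l) / (\<eta> * l)\<^sup>2"
    using integral_Markov_inequality_measure[OF S(1) sets.top _ \<eta>l2] S(2) by (simp add: mult.commute)
  have B: "prob ?B \<le> (2 * l) / (\<eta> * l)\<^sup>2"
  proof -
    have "prob ?B \<le> (\<Sum>i<l. (z i)\<^sup>2) / (\<eta> * l)\<^sup>2"
      using integral_Markov_inequality_measure[OF T(1) sets.top _ \<eta>l2] T(2) by simp
    also have "\<dots> \<le> (2 * l) / (\<eta> * l)\<^sup>2"
      using z \<eta> l0 by (intro divide_right_mono) (auto intro!: order_trans[OF z] mult_right_mono)
    finally show ?thesis .
  qed
  have eq: "(2 * l) / (\<eta> * l)\<^sup>2 = 2 / (\<eta>\<^sup>2 * l)" using l0 by (simp add: field_simps power2_eq_square)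
  have sm: "(\<Sum>i<l. (g i)\<^sup>2 - 1) = (\<Sum>i<l. (g i)\<^sup>2) - l" for g :: "nat \<Rightarrow> real"
    by (simp add: sum_subtractf)
  have "8 \<le> \<eta>\<^sup>2 * l" using l \<eta> by (simp add: field_simps)
  then have q: "2 / (\<eta>\<^sup>2 * l) \<le> 1 / 4" by (simp add: field_simps)
  have meas[measurable]: "?A \<in> events" "?B \<in> events" by measurable
  have "prob (?A \<union> ?B) \<le> prob ?A + prob ?B" by (rule measure_Un_le) (rule meas)+
  also have "\<dots> \<le> 1 / 2" using A B q unfolding eq by linarith
  finally have AB: "prob (?A \<union> ?B) \<le> 1 / 2" .
  have sub: "{g \<in> space ?G. \<bar>(\<Sum>i<l. (g i)\<^sup>2) - l\<bar> < \<eta> * l \<and> \<bar>\<Sum>i<l. z i * g i\<bar> < \<eta> * l} = space ?G - (?A \<union> ?B)"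
    using \<eta>l by (auto simp: sm abs_le_square_iff[symmetric] not_le)
  have "prob (space ?G - (?A \<union> ?B)) = 1 - prob (?A \<union> ?B)" by (rule prob_compl) (intro sets.Un meas)
  then show "prob {g \<in> space ?G. \<bar>(\<Sum>i<l. (g i)\<^sup>2) - l\<bar> < \<eta> * l \<and> \<bar>\<Sum>i<l. z i * g i\<bar> < \<eta> * l} \<ge> 1 / 2"
    unfolding sub using AB by simp
  have "prob {g \<in> space ?G. (\<Sum>i<l. (g i)\<^sup>2) \<ge> (1 + \<eta>) * l} \<le> prob ?A"
  proof (intro finite_measure_mono meas subsetI)
    fix g assume g: "g \<in> {g \<in> space ?G. (\<Sum>i<l. (g i)\<^sup>2) \<ge> (1 + \<eta>) * l}"
    then have "\<eta> * l \<le> (\<Sum>i<l. (g i)\<^sup>2) - l" by (simp add: algebra_simps)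
    then have "(\<eta> * l)\<^sup>2 \<le> ((\<Sum>i<l. (g i)\<^sup>2) - l)\<^sup>2" using \<eta>l by (intro power_mono) auto
    then show "g \<in> ?A" using g unfolding sm by blast
  qed
  then show "prob {g \<in> space ?G. (\<Sum>i<l. (g i)\<^sup>2) \<ge> (1 + \<eta>) * l} \<le> 2 / (\<eta>\<^sup>2 * l)"
    using A unfolding eq by linarith
qed

text \<open>The substitution \<open>w = sqrt (1 - D) z + sqrt D g\<close> realizes the optimal test channel: for typical
  \<open>g\<close> the codeword \<open>sqrt (1 - D) w\<close> is within the allowed distance of \<open>z\<close>, and the density ratio is
  \<open>D\<^bsup>l/2\<^esup>\<close> up to a factor \<open>exp (O(\<eta> l))\<close>.\<close>

lemma gaussian_cover_prob:
  fixes \<eta> D :: real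
  assumes \<eta>: "0 < \<eta>" "\<eta> \<le> 1" and l: "real l \<ge> 8 / \<eta>\<^sup>2"
    and D: "0 < D" "D < 1"
    and z: "(\<Sum>i<l. (z i)\<^sup>2) \<le> (1 + \<eta>) * l"
  shows "measure (gaussian_product l) {w \<in> space (gaussian_product l).
      (\<Sum>i<l. (z i - sqrt (1 - D) * w i)\<^sup>2) \<le> D * l * (1 + 2 * \<eta>)}
    \<ge> D powr (real l / 2) * exp (- (3 / 2 * \<eta> * l)) / 2"
proof -
  interpret prob_space "gaussian_product l" by (rule prob_space_gaussian_product)
  let ?G = "gaussian_product l"
  let ?C = "{w \<in> space ?G. (\<Sum>i<l. (z i - sqrt (1 - D) * w i)\<^sup>2) \<le> D * l * (1 + 2 * \<eta>)}"
  let ?E = "{g \<in> space ?G. \<bar>(\<Sum>i<l. (g i)\<^sup>2) - l\<bar> < \<eta> * l \<and> \<bar>\<Sum>i<l. z i * g i\<bar> < \<eta> * l}"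
  define c t where "c = sqrt (1 - D)" and "t = sqrt D"
  have ct: "c\<^sup>2 = 1 - D" "t\<^sup>2 = D" "c > 0" "t > 0" using D by (auto simp: c_def t_def)
  have ct2: "2 * (c * t) \<le> 1" using sum_squares_bound[of c t] ct by simp
  define K where "K = D powr (real l / 2) * exp (- (3 / 2 * \<eta> * l))"
  have K0: "K \<ge> 0" by (simp add: K_def)
  have Cm[measurable]: "?C \<in> sets ?G" by measurable
  have Em[measurable]: "?E \<in> sets ?G" by measurable
  \<comment> \<open>Pointwise form of the claim: for typical \<open>g\<close> the substituted point
    is a covering codeword and its weight is at least \<open>K\<close>. Integrating over
    \<open>g\<close> and undoing the substitution gives the bound.\<close>
  have main: "indicator ?E g * ennreal K \<le>
     indicator ?C (\<lambda>i\<in>{..<l}. c * z i + t * g i) * (\<Prod>i<l. ennreal (tilt c t (z i) (g i)))"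
    if "g \<in> space ?G" for g
  proof (cases "g \<in> ?E")
    case False
    then show ?thesis by simp
  next
    case True
    define Q S T where "Q = (\<Sum>i<l. (z i)\<^sup>2)" and "S = (\<Sum>i<l. (g i)\<^sup>2)" and "T = (\<Sum>i<l. z i * g i)"
    have b: "S \<le> (1 + \<eta>) * l" "S \<ge> (1 - \<eta>) * l" "T \<le> \<eta> * l" "- T \<le> \<eta> * l" "Q \<le> (1 + \<eta>) * l"
      using True z by (auto simp: S_def T_def Q_def abs_less_iff algebra_simps)
    have Tb: "2 * (c * t) * T \<le> \<eta> * l" "- (2 * (c * t) * T) \<le> \<eta> * l"
    proof -
      have "\<bar>2 * (c * t) * T\<bar> \<le> 1 * (\<eta> * l)"
        unfolding abs_mult[of "2 * (c * t)"] using ct2 ct b by (intro mult_mono) (auto simp: abs_le_iff)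
      then show "2 * (c * t) * T \<le> \<eta> * l" "- (2 * (c * t) * T) \<le> \<eta> * l" by auto
    qed
    have "(\<Sum>i<l. (z i - c * (c * z i + t * g i))\<^sup>2) = (\<Sum>i<l. D\<^sup>2 * (z i)\<^sup>2 - D * (2 * (c * t)) * (z i * g i) + D * (1 - D) * (g i)\<^sup>2)"
    proof (rule sum.cong)
      fix i
      have "z i - c * (c * z i + t * g i) = (1 - c\<^sup>2) * z i - c * t * g i" by (simp add: algebra_simps power2_eq_square)
      also have "\<dots> = D * z i - c * t * g i" using ct by simp
      also have "\<dots>\<^sup>2 = D\<^sup>2 * (z i)\<^sup>2 - D * (2 * (c * t)) * (z i * g i) + t\<^sup>2 * c\<^sup>2 * (g i)\<^sup>2"
        by (simp add: power2_diff power_mult_distrib mult_ac)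
      finally show "(z i - c * (c * z i + t * g i))\<^sup>2 = D\<^sup>2 * (z i)\<^sup>2 - D * (2 * (c * t)) * (z i * g i) + D * (1 - D) * (g i)\<^sup>2"
        using ct by simp
    qed simp
    also have "\<dots> = D\<^sup>2 * Q - D * (2 * (c * t)) * T + D * (1 - D) * S"
      unfolding Q_def S_def T_def by (simp only: sum_subtractf sum.distrib sum_distrib_left)
    also have "\<dots> = D * (D * Q + (- (2 * (c * t) * T)) + (1 - D) * S)"
      by (simp add: algebra_simps power2_eq_square)
    also have "\<dots> \<le> D * (D * ((1 + \<eta>) * l) + \<eta> * l + (1 - D) * ((1 + \<eta>) * l))"
      using D b Tb by (intro mult_left_mono add_mono) auto
    also have "\<dots> = D * l * (1 + 2 * \<eta>)" by (simp add: algebra_simps)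
    finally have "(\<lambda>i\<in>{..<l}. c * z i + t * g i) \<in> ?C"
      by (simp add: space_PiM c_def)
    moreover have "ennreal K \<le> (\<Prod>i<l. ennreal (tilt c t (z i) (g i)))"
    proof -
      have "(\<Sum>i<l. (g i)\<^sup>2 / 2 - (c * z i + t * g i)\<^sup>2 / 2) = (\<Sum>i<l. ((1 - t\<^sup>2) * (g i)\<^sup>2 - c\<^sup>2 * (z i)\<^sup>2 - (2 * (c * t)) * (z i * g i)) / 2)"
        by (rule sum.cong) (auto simp: power2_sum field_simps)
      also have "\<dots> = ((1 - t\<^sup>2) * S - c\<^sup>2 * Q - 2 * (c * t) * T) / 2"
        unfolding Q_def S_def T_def by (simp only: sum_subtractf sum.distrib sum_distrib_left flip: sum_divide_distrib)
      also have "\<dots> = ((1 - D) * (S - Q) - 2 * (c * t) * T) / 2" unfolding ct by (simp add: algebra_simps)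
      \<comment> \<open>Typicality bounds Q - S by 2 \<eta> l and the cross term by \<eta> l; half
        of the total is the constant 3/2.\<close>
      also have "\<dots> \<ge> - (3 / 2 * \<eta> * l)"
      proof -
        have "Q - S \<le> 2 * \<eta> * l" using b by (simp add: algebra_simps)
        then have "(1 - D) * (Q - S) \<le> (1 - D) * (2 * \<eta> * l)" using D by (intro mult_left_mono) auto
        also have "\<dots> \<le> 2 * \<eta> * l" using D \<eta> by (intro mult_left_le_one_le) auto
        finally show ?thesis using Tb by (simp add: algebra_simps)
      qed
      finally have ex: "(\<Sum>i<l. (g i)\<^sup>2 / 2 - (c * z i + t * g i)\<^sup>2 / 2) \<ge> - (3 / 2 * \<eta> * l)" .
      have "D powr (real l / 2) = t ^ l"
        using D unfolding t_def by (simp add: powr_half_sqrt[symmetric] powr_powr flip: powr_realpow)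
      then have "K \<le> t ^ l * exp (\<Sum>i<l. (g i)\<^sup>2 / 2 - (c * z i + t * g i)\<^sup>2 / 2)"
        unfolding K_def using ct ex by (intro mult_mono) auto
      also have "\<dots> = (\<Prod>i<l. tilt c t (z i) (g i))"
        by (simp add: tilt_def prod.distrib exp_sum)
      finally show ?thesis using ct by (subst prod_ennreal) (auto simp: tilt_def intro!: ennreal_leI)
    qed
    ultimately show ?thesis using True by simp
  qed
  have "ennreal (1 / 2 * K) = ennreal (1 / 2) * ennreal K" by (rule ennreal_mult) (use K0 in auto)
  also have "\<dots> \<le> emeasure ?G ?E * ennreal K"
    unfolding emeasure_eq_measure
    by (intro mult_right_mono ennreal_leI gaussian_product_typical(1)[OF \<eta> l z]) simp
  also have "\<dots> = (\<integral>\<^sup>+ g. indicator ?E g * ennreal K \<partial>?G)"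
    by (subst nn_integral_multc) auto
  also have "\<dots> \<le> (\<integral>\<^sup>+ g. indicator ?C (\<lambda>i\<in>{..<l}. c * z i + t * g i) * (\<Prod>i<l. ennreal (tilt c t (z i) (g i))) \<partial>?G)"
    by (intro nn_integral_mono main)
  also have "\<dots> = (\<integral>\<^sup>+ w. indicator ?C w \<partial>?G)"
  proof (rule gaussian_PiM_nn_integral_affine[symmetric])
    have "?C \<in> sets (PiM {..<l} (\<lambda>_. borel))" using Cm by (simp only: sets_gaussian_PiM)
    then show "indicator ?C \<in> borel_measurable (PiM {..<l} (\<lambda>_. borel :: real measure))" by simp
  qed (use ct in auto)
  also have "\<dots> = emeasure ?G ?C" by simp
  finally have "ennreal (1 / 2 * K) \<le> ennreal (prob ?C)"
    unfolding emeasure_eq_measure .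
  then have "1 / 2 * K \<le> prob ?C" by (simp only: ennreal_le_iff measure_nonneg)
  then show ?thesis unfolding K_def by simp
qed

section \<open>Codebooks\<close>

text \<open>Random coding, one codeword at a time: by Fubini, on average over \<open>a\<close> under
  \<open>Q\<close>, a codeword covers at least the fraction p of the still uncovered part of
  \<open>T\<close>, so some \<open>a\<close> does. Each new point thus shrinks the uncovered set by
  the factor 1 - p.\<close>

lemma greedy_cover:
  assumes P: "prob_space P" and Q: "prob_space Q" and R: "R \<in> sets (P \<Otimes>\<^sub>M Q)" and T: "T \<in> sets P"
    and p: "\<And>z. z \<in> T \<Longrightarrow> p \<le> measure Q (Pair z -` R)" and p0: "0 \<le> p" and p1: "p \<le> 1"
  shows "\<exists>A. finite A \<and> card A \<le> k \<and> A \<subseteq> space Q \<and> measure P {z \<in> T. \<forall>a\<in>A. (z, a) \<notin> R} \<le> (1 - p) ^ k"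
proof (induction k)
  case 0
  interpret P: prob_space P by fact
  show ?case by (intro exI[of _ "{}"]) auto
next
  case (Suc k)
  interpret P: prob_space P by fact
  interpret Q: prob_space Q by fact
  interpret PQ: pair_prob_space P Q ..
  note [measurable] = R T
  from Suc obtain A where A: "finite A" "card A \<le> k" "A \<subseteq> space Q" "measure P {z \<in> T. \<forall>a\<in>A. (z, a) \<notin> R} \<le> (1 - p) ^ k"
    by blast
  let ?U = "{z \<in> T. \<forall>a\<in>A. (z, a) \<notin> R}"
  have TP: "T \<subseteq> space P" using T sets.sets_into_space by blast
  have Rs: "(\<lambda>z. (z, a)) -` R \<inter> space P \<in> sets P" if "a \<in> space Q" for a
    using that by (intro measurable_sets[OF _ R]) simp
  have Um[measurable]: "?U \<in> sets P"
  proof -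
    have "?U = T - (\<Union>a\<in>A. (\<lambda>z. (z, a)) -` R \<inter> space P)" using TP by auto
    also have "\<dots> \<in> sets P" using A Rs T by (intro sets.Diff sets.finite_UN) auto
    finally show ?thesis .
  qed
  let ?f = "\<lambda>a. measure P {z \<in> ?U. (z, a) \<in> R}"
  have mR[measurable]: "{x \<in> space (P \<Otimes>\<^sub>M Q). fst x \<in> ?U \<and> x \<in> R} \<in> sets (P \<Otimes>\<^sub>M Q)"
    by measurable
  let ?RU = "{x \<in> space (P \<Otimes>\<^sub>M Q). fst x \<in> ?U \<and> x \<in> R}"
  have fa: "?f a = measure P ((\<lambda>z. (z, a)) -` ?RU)" if "a \<in> space Q" for a
    using that TP by (intro arg_cong[where f="measure P"]) (auto simp: space_pair_measure)
  have "emeasure (P \<Otimes>\<^sub>M Q) ?RU = (\<integral>\<^sup>+ z. emeasure Q (Pair z -` ?RU) \<partial>P)"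
    by (rule Q.emeasure_pair_measure_alt[OF mR])
  also have "\<dots> \<ge> (\<integral>\<^sup>+ z. ennreal p * indicator ?U z \<partial>P)"
  proof (rule nn_integral_mono)
    fix z assume z: "z \<in> space P"
    show "ennreal p * indicator ?U z \<le> emeasure Q (Pair z -` ?RU)"
    proof (cases "z \<in> ?U")
      case True
      have "Pair z -` ?RU = Pair z -` R" using True z sets.sets_into_space[OF R] by (auto simp: space_pair_measure)
      then show ?thesis using True p[of z] by (auto simp: Q.emeasure_eq_measure intro!: ennreal_leI)
    qed simp
  qed
  also have "(\<integral>\<^sup>+ z. ennreal p * indicator ?U z \<partial>P) = ennreal p * ennreal (measure P ?U)"
    by (simp add: P.emeasure_eq_measure nn_integral_cmult_indicator Um)
  finally have low: "ennreal p * ennreal (measure P ?U) \<le> emeasure (P \<Otimes>\<^sub>M Q) ?RU" .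
  have "\<exists>a\<in>space Q. ?f a \<ge> p * measure P ?U"
  proof (rule ccontr)
    assume "\<not> ?thesis"
    then have less: "\<And>a. a \<in> space Q \<Longrightarrow> ?f a < p * measure P ?U" by (auto simp: not_le)
    have fm: "?f \<in> borel_measurable Q"
    proof (subst measurable_cong[OF fa])
      show "(\<lambda>a. measure P ((\<lambda>z. (z, a)) -` ?RU)) \<in> borel_measurable Q"
        unfolding measure_def using PQ.measurable_emeasure_Pair2[OF mR] by simp
    qed
    have int: "integrable Q ?f"
      by (rule Q.integrable_const_bound[where B=1]) (use fm in auto)
    from int have "Q.expectation ?f < p * measure P ?U"
      by (rule Q.expectation_less) (use less in auto)
    moreover have "emeasure (P \<Otimes>\<^sub>M Q) ?RU = ennreal (Q.expectation ?f)"
    proof -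
      have "emeasure (P \<Otimes>\<^sub>M Q) ?RU = (\<integral>\<^sup>+ a. ennreal (?f a) \<partial>Q)"
        by (subst PQ.emeasure_pair_measure_alt2[OF mR], intro nn_integral_cong)
           (simp only: fa P.emeasure_eq_measure)
      also have "\<dots> = ennreal (Q.expectation ?f)" by (rule nn_integral_eq_integral[OF int]) auto
      finally show ?thesis .
    qed
    ultimately have "emeasure (P \<Otimes>\<^sub>M Q) ?RU < ennreal (p * measure P ?U)"
      by (simp add: ennreal_less_iff Bochner_Integration.integral_nonneg)
    then show False using low p0 by (simp add: ennreal_mult not_le)
  qed
  then obtain a where a: "a \<in> space Q" "?f a \<ge> p * measure P ?U" by blast
  have "{z \<in> T. \<forall>a\<in>insert a A. (z, a) \<notin> R} = ?U - {z \<in> ?U. (z, a) \<in> R}" by auto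
  moreover have "{z \<in> ?U. (z, a) \<in> R} \<in> sets P"
  proof -
    have "{z \<in> ?U. (z, a) \<in> R} = ?U \<inter> ((\<lambda>z. (z, a)) -` R \<inter> space P)" using TP by auto
    then show ?thesis using Rs[OF a(1)] Um by simp
  qed
  ultimately have "measure P {z \<in> T. \<forall>a\<in>insert a A. (z, a) \<notin> R} = measure P ?U - ?f a"
    using Um by (simp add: P.finite_measure_Diff subset_eq)
  also have "\<dots> \<le> (1 - p) * measure P ?U" using a(2) by (simp add: algebra_simps)
  also have "\<dots> \<le> (1 - p) * (1 - p) ^ k" using A(4) p1 by (intro mult_left_mono) auto
  finally have "measure P {z \<in> T. \<forall>a\<in>insert a A. (z, a) \<notin> R} \<le> (1 - p) ^ Suc k" by simp
  then show ?case using A a(1) by (intro exI[of _ "insert a A"]) (auto intro: order_trans[OF card_insert_le_m1] simp: card_insert_if)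
qed

text \<open>With w = x / (1 + x) rounded down to v = i / N, the error is (w - v) / ((1 - w) (1 -
  v)). Rounding down keeps v at most w, so both denominators are controlled by 1 / (1 - w) = 1 +
  x.\<close>

lemma companding_nonneg:
  fixes x :: real
  assumes x: "x \<ge> 0" and N: "N \<ge> 1"
  shows "\<exists>i<N. \<bar>x - (real i / N) / (1 - real i / N)\<bar> \<le> (1 + x)\<^sup>2 / N"
proof -
  define w where "w = x / (1 + x)"
  have w: "0 \<le> w" "w < 1" using x by (auto simp: w_def)
  have xw: "x = w / (1 - w)" "1 / (1 - w) = 1 + x" using x by (auto simp: w_def field_simps)
  define i where "i = nat \<lfloor>N * w\<rfloor>"
  have i: "real i \<le> N * w" "N * w < real i + 1" using w N unfolding i_def by (auto simp: of_nat_nat)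
  define v where "v = real i / N"
  have v: "0 \<le> v" "v \<le> w" using i N by (auto simp: v_def field_simps)
  have wv: "w - v \<le> 1 / N"
  proof -
    have "w = N * w / N" using N by simp
    also have "\<dots> \<le> (real i + 1) / N" using i by (intro divide_right_mono) auto
    finally show ?thesis by (simp add: v_def add_divide_distrib)
  qed
  have "real i < N" using i(1) w N by (smt (verit) mult_left_le of_nat_0_le_iff mult_less_cancel_left2 of_nat_1 of_nat_mono)
  then have iN: "i < N" by simp
  have "x - v / (1 - v) = (w - v) * (1 / (1 - w)) * (1 / (1 - v))"
    unfolding xw(1) using w v by (simp add: field_simps)
  moreover have "0 \<le> (w - v) * (1 / (1 - w)) * (1 / (1 - v))" using w v by simp
  moreover have "(w - v) * (1 / (1 - w)) * (1 / (1 - v)) \<le> 1 / N * (1 / (1 - w)) * (1 / (1 - w))"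
    using w v wv by (intro mult_mono frac_le) auto
  ultimately have "\<bar>x - v / (1 - v)\<bar> \<le> 1 / N * (1 / (1 - w)) * (1 / (1 - w))"
    by linarith
  then have "\<bar>x - v / (1 - v)\<bar> \<le> (1 + x)\<^sup>2 / N"
    unfolding xw(2) by (simp add: power2_eq_square)
  then show ?thesis using iN unfolding v_def by blast
qed

text \<open>The quantizer is uniform after the change of scale \<open>x \<mapsto> x / (1 + \<bar>x\<bar>)\<close>.\<close>

lemma companding_quantizer:
  assumes "q \<ge> 1"
  shows "\<exists>A. finite A \<and> A \<noteq> {} \<and> card A \<le> q \<and> (\<forall>x::real. \<exists>a\<in>A. (x - a)\<^sup>2 \<le> 4 / (real q)\<^sup>2 * (1 + \<bar>x\<bar>)^4)"
proof -
  \<comment> \<open>The one-sided grid and its mirror image share the point 0, so they have at most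
    2 N - 1 points; 2 N is at least q, which costs a factor 2, squared to 4.\<close>
  define N where "N = (q + 1) div 2"
  have N: "N \<ge> 1" "2 * N - 1 \<le> q" "2 * real N \<ge> real q" using assms unfolding N_def by auto
  define h where "h i = (real i / N) / (1 - real i / N)" for i :: nat
  define A where "A = h ` {..<N} \<union> (\<lambda>i. - h i) ` {1..<N}"
  have "card A \<le> card (h ` {..<N}) + card ((\<lambda>i. - h i) ` {1..<N})" unfolding A_def by (rule card_Un_le)
  also have "\<dots> \<le> card {..<N} + card {1..<N}" by (intro add_mono card_image_le) auto
  also have "\<dots> \<le> q" using N by auto
  finally have cA: "card A \<le> q" .
  have "\<exists>a\<in>A. (x - a)\<^sup>2 \<le> 4 / (real q)\<^sup>2 * (1 + \<bar>x\<bar>)^4" for x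
  proof -
    have "\<exists>a\<in>A. \<bar>x - a\<bar> \<le> (1 + \<bar>x\<bar>)\<^sup>2 / N"
    proof (cases "x \<ge> 0")
      case True
      then show ?thesis using companding_nonneg[OF True N(1)] unfolding A_def h_def by auto
    next
      case False
      then obtain i where i: "i < N" "\<bar>- x - h i\<bar> \<le> (1 - x)\<^sup>2 / N"
        using companding_nonneg[of "-x" N] N(1) unfolding h_def by auto
      have "- h i \<in> A" 
      proof (cases "i = 0")
        case True
        then have "- h i = h 0" by (simp add: h_def)
        then show ?thesis using N unfolding A_def by auto
      next
        case False
        then show ?thesis using i(1) unfolding A_def by auto
      qed
      moreover have "\<bar>x - (- h i)\<bar> \<le> (1 + \<bar>x\<bar>)\<^sup>2 / N" using i(2) False by (simp add: abs_if split: if_splits)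
      ultimately show ?thesis by blast
    qed
    then obtain a where a: "a \<in> A" "\<bar>x - a\<bar> \<le> (1 + \<bar>x\<bar>)\<^sup>2 / N" by blast
    have "1 / N \<le> 2 / real q" using N assms by (simp add: field_simps)
    then have "(1 + \<bar>x\<bar>)\<^sup>2 * (1 / N) \<le> (1 + \<bar>x\<bar>)\<^sup>2 * (2 / q)" by (rule mult_left_mono) simp
    then have "(1 + \<bar>x\<bar>)\<^sup>2 / N \<le> (1 + \<bar>x\<bar>)\<^sup>2 * (2 / q)" by simp
    with a(2) have "\<bar>x - a\<bar> \<le> (1 + \<bar>x\<bar>)\<^sup>2 * (2 / q)" by linarith
    then have "\<bar>x - a\<bar>\<^sup>2 \<le> ((1 + \<bar>x\<bar>)\<^sup>2 * (2 / q))\<^sup>2" by (rule power_mono) simp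
    then have "(x - a)\<^sup>2 \<le> 4 / (real q)\<^sup>2 * (1 + \<bar>x\<bar>)^4" by (simp add: power_mult_distrib power_divide field_simps)
    then show ?thesis using a(1) by blast
  qed
  moreover have "finite A" "A \<noteq> {}" using N unfolding A_def by (auto simp: lessThan_empty_iff)
  ultimately show ?thesis using cA by blast
qed

text \<open>A grid with floor (k^(1/l)) points per coordinate; the integer part is at least half,
  which turns the constant 4 into 16. The bound is pointwise and valid for every \<open>k\<close>,
  so it remains usable on an arbitrary exceptional set.\<close>

lemma product_quantizer:
  fixes k l :: nat
  assumes "k \<ge> 1" "l \<ge> 1"
  shows "\<exists>A :: (nat \<Rightarrow> real) set. finite A \<and> A \<noteq> {} \<and> card A \<le> k \<and>
    (\<forall>z. \<exists>a\<in>A. \<forall>i<l. (z i - a i)\<^sup>2 \<le> 16 * real k powr (- 2 / l) * (1 + \<bar>z i\<bar>)^4)"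
proof -
  define r where "r = real k powr (1 / l)"
  have r1: "r \<ge> 1" using assms unfolding r_def by (intro ge_one_powr_ge_zero) auto
  define q where "q = nat \<lfloor>r\<rfloor>"
  have q: "q \<ge> 1" "real q \<le> r" "r < real q + 1" using r1 unfolding q_def by (auto simp: le_nat_floor of_nat_nat)
  obtain B :: "real set" where B: "finite B" "B \<noteq> {}" "card B \<le> q"
      "\<And>x. \<exists>a\<in>B. (x - a)\<^sup>2 \<le> 4 / (real q)\<^sup>2 * (1 + \<bar>x\<bar>)^4"
    using companding_quantizer[OF q(1)] by metis
  let ?A = "PiE {..<l} (\<lambda>_. B)"
  have "real (card ?A) \<le> real (q ^ l)"
    using B(3) by (simp add: card_PiE power_mono del: of_nat_power)
  also have "\<dots> \<le> r ^ l" using q(2) by (simp add: power_mono)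
  also have "\<dots> = real k" using assms unfolding r_def by (simp add: powr_powr flip: powr_realpow)
  finally have c: "card ?A \<le> k" by simp
  have "2 * real q \<ge> r" using q by linarith
  then have "(2 * real q)\<^sup>2 \<ge> r\<^sup>2" using r1 by (intro power_mono) auto
  then have "4 / (real q)\<^sup>2 \<le> 16 / r\<^sup>2" using q(1) r1 by (simp add: field_simps power_mult_distrib)
  also have "16 / r\<^sup>2 = 16 * real k powr (- 2 / l)"
  proof -
    have "r\<^sup>2 = real k powr (2 / l)" using assms unfolding r_def by (simp add: powr_powr flip: powr_realpow)
    then show ?thesis by (simp add: powr_minus divide_inverse)
  qed
  finally have le: "4 / (real q)\<^sup>2 \<le> 16 * real k powr (- 2 / l)" .
  have "\<exists>a\<in>?A. \<forall>i<l. (z i - a i)\<^sup>2 \<le> 16 * real k powr (- 2 / l) * (1 + \<bar>z i\<bar>)^4" for z :: "nat \<Rightarrow> real"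
  proof -
    from B(4) obtain b where b: "\<And>x. b x \<in> B" "\<And>x. (x - b x)\<^sup>2 \<le> 4 / (real q)\<^sup>2 * (1 + \<bar>x\<bar>)^4" by metis
    have "(x - b x)\<^sup>2 \<le> 16 * real k powr (- 2 / l) * (1 + \<bar>x\<bar>)^4" for x
      by (rule order_trans[OF b(2)]) (rule mult_right_mono[OF le], simp)
    then show ?thesis using b(1) by (intro bexI[of _ "\<lambda>i\<in>{..<l}. b (z i)"]) auto
  qed
  then show ?thesis using c B by (intro exI[of _ ?A]) (auto intro!: finite_PiE simp: PiE_eq_empty_iff)
qed

lemma gaussian_product_component:
  assumes "i < l" and [measurable]: "f \<in> borel_measurable borel"
  shows "(\<integral>\<^sup>+ z. f (z i) \<partial>gaussian_product l) = (\<integral>\<^sup>+ x. f x \<partial>std_normal_distribution)"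
proof -
  have "distr (gaussian_product l) std_normal_distribution (\<lambda>z. z i) = std_normal_distribution"
    by (rule distr_PiM_component) (use assms prob_space_std_normal in auto)
  then have "(\<integral>\<^sup>+ x. f x \<partial>std_normal_distribution) = (\<integral>\<^sup>+ x. f x \<partial>distr (gaussian_product l) std_normal_distribution (\<lambda>z. z i))"
    by simp
  also have "\<dots> = (\<integral>\<^sup>+ z. f (z i) \<partial>gaussian_product l)"
    using assms(1) by (intro nn_integral_distr) auto
  finally show ?thesis ..
qed

text \<open>The eighth power is the square of the fourth power in \<open>product_quantizer\<close>;
  it arises when that error is restricted to a small event.\<close>

lemma eighth_moment_bound:
  "\<exists>C>0. (\<integral>\<^sup>+ x. ennreal ((1 + \<bar>x\<bar>)^8) \<partial>std_normal_distribution) \<le> ennreal C"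
proof -
  have i: "integrable std_normal_distribution (\<lambda>x. \<bar>x\<bar>^k)" for k
  proof -
    have "integrable lborel (\<lambda>x. std_normal_density x * \<bar>x\<bar>^k)" by (rule integrable_std_normal_moment_abs)
    then show ?thesis by (subst integrable_density) auto
  qed
  have i8: "integrable std_normal_distribution (\<lambda>x::real. (1 + \<bar>x\<bar>)^8)"
    unfolding binomial_ring by (auto intro!: Bochner_Integration.integrable_sum integrable_mult_right integrable_mult_left i)
  have "(\<integral>\<^sup>+ x. ennreal ((1 + \<bar>x\<bar>)^8) \<partial>std_normal_distribution) = ennreal (\<integral>x. (1 + \<bar>x\<bar>)^8 \<partial>std_normal_distribution)"
    by (rule nn_integral_eq_integral[OF i8]) auto
  also have "\<dots> \<le> ennreal (max 1 (\<integral>x. (1 + \<bar>x\<bar>)^8 \<partial>std_normal_distribution))" by (intro ennreal_leI) simp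
  finally show ?thesis by (intro exI[of _ "max 1 (\<integral>x. (1 + \<bar>x\<bar>)^8 \<partial>std_normal_distribution)"]) auto
qed

abbreviation sq_dist :: "nat \<Rightarrow> (nat \<Rightarrow> real) \<Rightarrow> (nat \<Rightarrow> real) \<Rightarrow> real" where
  "sq_dist l z a \<equiv> (\<Sum>i<l. (z i - a i)\<^sup>2)"

abbreviation min_sq_dist :: "nat \<Rightarrow> (nat \<Rightarrow> real) set \<Rightarrow> (nat \<Rightarrow> real) \<Rightarrow> real" where
  "min_sq_dist l A z \<equiv> Min ((\<lambda>a. sq_dist l z a) ` A)"

text \<open>Valued in \<open>ennreal\<close>, so that codes can be compared without integrability
  side conditions.\<close>

abbreviation code_error :: "nat \<Rightarrow> (nat \<Rightarrow> real) set \<Rightarrow> ennreal" where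
  "code_error l A \<equiv> (\<integral>\<^sup>+ z. ennreal (min_sq_dist l A z) \<partial>gaussian_product l)"

text \<open>Covers the low rates, where the target bound is no better than a single point at the
  origin.\<close>

lemma gaussian_trivial_quantizer:
  "code_error l {\<lambda>_. 0} = ennreal l"
proof -
  have "code_error l {\<lambda>_. 0} =
    (\<integral>\<^sup>+ z. (\<Sum>i<l. ennreal ((z i)\<^sup>2)) \<partial>gaussian_product l)"
    by (simp add: sum_ennreal)
  also have "\<dots> = (\<Sum>i<l. \<integral>\<^sup>+ z. ennreal ((z i)\<^sup>2) \<partial>gaussian_product l)"
    by (rule nn_integral_sum) auto
  also have "\<dots> = (\<Sum>i<l. \<integral>\<^sup>+ x. ennreal (x\<^sup>2) \<partial>std_normal_distribution)"
    by (intro sum.cong refl gaussian_product_component) auto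
  also have "(\<integral>\<^sup>+ x. ennreal (x\<^sup>2) \<partial>std_normal_distribution) = ennreal (\<integral>x. x\<^sup>2 \<partial>std_normal_distribution)"
    by (rule nn_integral_eq_integral) (use integrable_std_normal_distribution_moment[of 2] in auto)
  also have "(\<integral>x. x\<^sup>2 \<partial>std_normal_distribution) = 1"
    using std_normal_distribution_even_moments(1)[of 1] by simp
  finally show ?thesis by (simp add: ennreal_of_nat_eq_real_of_nat)
qed

text \<open>Points that are atypical or missed by the random code are served by the product quantizer, whose
  pointwise error keeps the factor \<open>k\<^bsup>-2/l\<^esup>\<close>; this makes the bound uniform in \<open>k\<close>.\<close>

lemma gaussian_random_coding_step:
  fixes k l :: nat and \<eta> s C D \<delta> :: real
  assumes \<eta>: "0 < \<eta>" "\<eta> \<le> 1" and l: "real l \<ge> 8 / \<eta>\<^sup>2" and k: "k \<ge> 1"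
    and s: "s > 0" and C: "(\<integral>\<^sup>+ x. ennreal ((1 + \<bar>x\<bar>)^8) \<partial>std_normal_distribution) \<le> ennreal C" "C > 0"
    and D: "D = real k powr (- 2 / l) * exp (4 * \<eta>)" "D < 1"
    and \<delta>: "\<delta> = 2 / (\<eta>\<^sup>2 * l) + exp (- exp (\<eta> * l / 2) / 2)"
  shows "\<exists>A. finite A \<and> A \<noteq> {} \<and> card A \<le> 2 * k \<and>
    code_error l A
      \<le> ennreal (l * real k powr (- 2 / l) * (exp (4 * \<eta>) * (1 + 2 * \<eta>) + 8 * s * C + 8 * \<delta> / s))"
proof -
  interpret prob_space "gaussian_product l" by (rule prob_space_gaussian_product)
  let ?G = "gaussian_product l"
  define \<kappa> where "\<kappa> = real k powr (- 2 / l)"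
  have "0 < 8 / \<eta>\<^sup>2" using \<eta> by simp
  then have l0: "real l > 0" using l by linarith
  have \<kappa>: "\<kappa> > 0" using k by (simp add: \<kappa>_def)
  have \<delta>0: "\<delta> \<ge> 0" unfolding \<delta> by simp
  have D0: "D > 0" using D k by simp
  define c where "c = sqrt (1 - D)"
  define R where "R = {x \<in> space (?G \<Otimes>\<^sub>M ?G). sq_dist l (fst x) (\<lambda>i. c * snd x i) \<le> D * l * (1 + 2 * \<eta>)}"
  define T where "T = {z \<in> space ?G. (\<Sum>i<l. (z i)\<^sup>2) \<le> (1 + \<eta>) * l}"
  define p where "p = D powr (real l / 2) * exp (- (3 / 2 * \<eta> * l)) / 2"
  have R[measurable]: "R \<in> sets (?G \<Otimes>\<^sub>M ?G)" unfolding R_def by measurable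
  have T[measurable]: "T \<in> sets ?G" unfolding T_def by measurable
  have p: "p \<le> prob (Pair z -` R)" if "z \<in> T" for z
  proof -
    have "Pair z -` R = {w \<in> space ?G. sq_dist l z (\<lambda>i. sqrt (1 - D) * w i) \<le> D * l * (1 + 2 * \<eta>)}"
      using that by (auto simp: R_def T_def space_pair_measure c_def)
    then show ?thesis unfolding p_def
      using gaussian_cover_prob[OF \<eta> l D0 D(2), of z] that by (simp add: T_def)
  qed
  have p0: "0 \<le> p" by (simp add: p_def)
  \<comment> \<open>Any point of \<open>T\<close> shows that \<open>p\<close> is bounded by a
    probability.\<close>
  have "(\<lambda>i\<in>{..<l}. 0) \<in> T" using \<eta> by (simp add: T_def space_PiM)
  then have p1: "p \<le> 1" using p prob_le_1 order_trans by blast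
  obtain A1 where A1: "finite A1" "card A1 \<le> k" "A1 \<subseteq> space ?G" "prob {z \<in> T. \<forall>a\<in>A1. (z, a) \<notin> R} \<le> (1 - p) ^ k"
    using greedy_cover[OF prob_space_gaussian_product prob_space_gaussian_product R T p p0 p1] by blast
  have DD: "D powr (real l / 2) = exp (2 * \<eta> * l) / k"
  proof -
    have "D powr (real l / 2) = real k powr (- 2 / l * (l / 2)) * exp (4 * \<eta>) powr (real l / 2)"
      unfolding D(1) by (simp add: powr_mult powr_powr)
    also have "- 2 / real l * (real l / 2) = - 1" using l0 by simp
    also have "real k powr (- 1) * exp (4 * \<eta>) powr (real l / 2) = exp (2 * \<eta> * l) / k"
    proof -
      have "exp (4 * \<eta>) powr (real l / 2) = exp (2 * \<eta> * l)" unfolding powr_def by (simp add: mult_ac)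
      moreover have "real k powr (- 1) = 1 / k" using k by (simp add: powr_minus_divide)
      ultimately show ?thesis by simp
    qed
    finally show ?thesis .
  qed
  \<comment> \<open>The slack exp (4 \<eta>) in \<open>D\<close> becomes exp (2 \<eta> l) and beats
    the loss exp (- 3/2 \<eta> l) of the covering bound. So p k is exponentially large in
    \<open>l\<close> whatever \<open>k\<close> is, and (1 - p)^k is at most exp (- p k).\<close>
  have "exp (2 * \<eta> * l) * exp (- (3 / 2 * \<eta> * l)) = exp (\<eta> * l / 2)"
    unfolding exp_add[symmetric] by (simp add: field_simps)
  then have pk: "p * k = exp (\<eta> * l / 2) / 2"
    unfolding p_def DD using k by simp
  have "(1 - p) ^ k \<le> exp (- p) ^ k" using p1 by (intro power_mono exp_ge_add_one_self[of "-p", simplified]) auto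
  also have "\<dots> = exp (- exp (\<eta> * l / 2) / 2)"
    using pk by (simp add: exp_of_nat_mult[symmetric] mult.commute)
  finally have unc: "prob {z \<in> T. \<forall>a\<in>A1. (z, a) \<notin> R} \<le> exp (- exp (\<eta> * l / 2) / 2)" using A1(4) by linarith
  define U where "U = {z \<in> space ?G. (\<Sum>i<l. (z i)\<^sup>2) \<ge> (1 + \<eta>) * l} \<union> {z \<in> T. \<forall>a\<in>A1. (z, a) \<notin> R}"
  have Um1: "{z \<in> T. \<forall>a\<in>A1. (z, a) \<notin> R} \<in> sets ?G"
  proof -
    have "{z \<in> T. \<forall>a\<in>A1. (z, a) \<notin> R} = T - (\<Union>a\<in>A1. (\<lambda>z. (z, a)) -` R \<inter> space ?G)"
      by (auto simp: T_def)
    also have "\<dots> \<in> sets ?G" 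
      using A1 by (intro sets.Diff sets.finite_UN T measurable_sets[OF _ R]) auto
    finally show ?thesis .
  qed
  have Um[measurable]: "U \<in> sets ?G" unfolding U_def by (intro sets.Un Um1) measurable
  have "prob U \<le> prob {z \<in> space ?G. (\<Sum>i<l. (z i)\<^sup>2) \<ge> (1 + \<eta>) * l} + prob {z \<in> T. \<forall>a\<in>A1. (z, a) \<notin> R}"
    unfolding U_def by (intro measure_Un_le Um1) measurable
  also have "\<dots> \<le> \<delta>"
    unfolding \<delta> using gaussian_product_typical(2)[OF \<eta> l, of "\<lambda>_. 0"] unc \<eta> by (intro add_mono) auto
  finally have U: "prob U \<le> \<delta>" .
  obtain A2 :: "(nat \<Rightarrow> real) set" where A2: "finite A2" "A2 \<noteq> {}" "card A2 \<le> k"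
    "\<And>z. \<exists>a\<in>A2. \<forall>i<l. (z i - a i)\<^sup>2 \<le> 16 * \<kappa> * (1 + \<bar>z i\<bar>)^4"
    using product_quantizer[OF k, of l] l0 unfolding \<kappa>_def by auto
  define A where "A = (\<lambda>w i. c * w i) ` A1 \<union> A2"
  have finA: "finite A" and neA: "A \<noteq> {}" using A1 A2 by (auto simp: A_def)
  have "card A \<le> card ((\<lambda>w i. c * w i) ` A1) + card A2" unfolding A_def by (rule card_Un_le)
  also have "\<dots> \<le> card A1 + card A2" using A1(1) by (intro add_right_mono card_image_le)
  finally have cA: "card A \<le> 2 * k" using A1(2) A2(3) by linarith
  have pt: "ennreal (min_sq_dist l A z) \<le> ennreal (D * l * (1 + 2 * \<eta>)) +
     (\<Sum>i<l. ennreal (8 * \<kappa> * s) * ennreal ((1 + \<bar>z i\<bar>)^8) + ennreal (8 * \<kappa> / s) * indicator U z)"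
    if z: "z \<in> space ?G" for z
  proof (cases "z \<in> U")
    case False
    then have "z \<in> T" using z unfolding U_def T_def by auto
    then obtain a where a: "a \<in> A1" "(z, a) \<in> R" using False unfolding U_def by auto
    have "min_sq_dist l A z \<le> sq_dist l z (\<lambda>i. c * a i)"
      using a(1) finA by (intro Min_le) (auto simp: A_def)
    also have "\<dots> \<le> D * l * (1 + 2 * \<eta>)" using a(2) by (simp add: R_def)
    finally have "ennreal (min_sq_dist l A z) \<le> ennreal (D * l * (1 + 2 * \<eta>))" by (rule ennreal_leI)
    then show ?thesis by (rule order_trans) simp
  next
    case True
    obtain a where a: "a \<in> A2" "\<And>i. i < l \<Longrightarrow> (z i - a i)\<^sup>2 \<le> 16 * \<kappa> * (1 + \<bar>z i\<bar>)^4" using A2(4) by blast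
    \<comment> \<open>The fourth power must be paired with the small probability of
      \<open>U\<close>. The arithmetic-geometric mean inequality with a free parameter
      \<open>s\<close> splits it into a small multiple of the eighth power, integrated over the
      whole space, and a constant, integrated over \<open>U\<close> only.\<close>
    have am: "16 * \<kappa> * y^4 \<le> 8 * \<kappa> * s * y^8 + 8 * \<kappa> / s" for y :: real
    proof -
      have "0 \<le> 8 * \<kappa> / s * (s * y^4 - 1)\<^sup>2" using \<kappa> s by simp
      also have "\<dots> = 8 * \<kappa> * s * y^8 + 8 * \<kappa> / s - 16 * \<kappa> * y^4"
        using s by (simp add: power2_eq_square field_simps flip: power_add)
      finally show ?thesis by simp
    qed
    have "min_sq_dist l A z \<le> sq_dist l z a"
      using a(1) finA by (intro Min_le) (auto simp: A_def)
    also have "\<dots> \<le> (\<Sum>i<l. 8 * \<kappa> * s * (1 + \<bar>z i\<bar>)^8 + 8 * \<kappa> / s)"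
      using a(2) by (intro sum_mono order_trans[OF a(2) am]) auto
    finally have "ennreal (min_sq_dist l A z) \<le> ennreal (\<Sum>i<l. 8 * \<kappa> * s * (1 + \<bar>z i\<bar>)^8 + 8 * \<kappa> / s)"
      by (rule ennreal_leI)
    also have "\<dots> = (\<Sum>i<l. ennreal (8 * \<kappa> * s) * ennreal ((1 + \<bar>z i\<bar>)^8) + ennreal (8 * \<kappa> / s))"
      using \<kappa> s by (subst sum_ennreal[symmetric]) (auto simp: ennreal_plus ennreal_mult)
    finally show ?thesis using True by (simp add: add_increasing)
  qed
  have "code_error l A \<le> (\<integral>\<^sup>+ z. ennreal (D * l * (1 + 2 * \<eta>)) +
     (\<Sum>i<l. ennreal (8 * \<kappa> * s) * ennreal ((1 + \<bar>z i\<bar>)^8) + ennreal (8 * \<kappa> / s) * indicator U z) \<partial>?G)"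
    by (rule nn_integral_mono) (rule pt)
  also have "\<dots> = ennreal (D * l * (1 + 2 * \<eta>)) + (\<Sum>i<l. \<integral>\<^sup>+ z. ennreal (8 * \<kappa> * s) * ennreal ((1 + \<bar>z i\<bar>)^8) + ennreal (8 * \<kappa> / s) * indicator U z \<partial>?G)"
    by (simp add: nn_integral_add nn_integral_sum emeasure_space_1)
  also have "\<dots> \<le> ennreal (D * l * (1 + 2 * \<eta>)) + (\<Sum>i<l. ennreal (8 * \<kappa> * s * C + 8 * \<kappa> / s * \<delta>))"
  proof (intro add_left_mono sum_mono)
    fix i assume i: "i \<in> {..<l}"
    have "(\<integral>\<^sup>+ z. ennreal (8 * \<kappa> * s) * ennreal ((1 + \<bar>z i\<bar>)^8) + ennreal (8 * \<kappa> / s) * indicator U z \<partial>?G) =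
       ennreal (8 * \<kappa> * s) * (\<integral>\<^sup>+ z. ennreal ((1 + \<bar>z i\<bar>)^8) \<partial>?G) + ennreal (8 * \<kappa> / s) * emeasure ?G U"
      using i by (simp add: nn_integral_add nn_integral_cmult nn_integral_cmult_indicator)
    also have "(\<integral>\<^sup>+ z. ennreal ((1 + \<bar>z i\<bar>)^8) \<partial>?G) = (\<integral>\<^sup>+ x. ennreal ((1 + \<bar>x\<bar>)^8) \<partial>std_normal_distribution)"
      using i by (intro gaussian_product_component) auto
    also have "ennreal (8 * \<kappa> * s) * (\<integral>\<^sup>+ x. ennreal ((1 + \<bar>x\<bar>)^8) \<partial>std_normal_distribution) + ennreal (8 * \<kappa> / s) * emeasure ?G U
      \<le> ennreal (8 * \<kappa> * s) * ennreal C + ennreal (8 * \<kappa> / s) * ennreal \<delta>"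
      using U by (intro add_mono mult_left_mono C(1)) (auto simp: emeasure_eq_measure intro!: ennreal_leI)
    also have "\<dots> = ennreal (8 * \<kappa> * s * C + 8 * \<kappa> / s * \<delta>)"
    proof -
      have "ennreal (8 * \<kappa> * s) * ennreal C = ennreal (8 * \<kappa> * s * C)"
        by (rule ennreal_mult[symmetric]) (use \<kappa> s C in auto)
      moreover have "ennreal (8 * \<kappa> / s) * ennreal \<delta> = ennreal (8 * \<kappa> / s * \<delta>)"
        by (rule ennreal_mult[symmetric]) (use \<kappa> s \<delta>0 in auto)
      moreover have "ennreal (8 * \<kappa> * s * C) + ennreal (8 * \<kappa> / s * \<delta>) = ennreal (8 * \<kappa> * s * C + 8 * \<kappa> / s * \<delta>)"
        by (rule ennreal_plus[symmetric]) (use \<kappa> s C \<delta>0 in auto)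
      ultimately show ?thesis by simp
    qed
    finally show "(\<integral>\<^sup>+ z. ennreal (8 * \<kappa> * s) * ennreal ((1 + \<bar>z i\<bar>)^8) + ennreal (8 * \<kappa> / s) * indicator U z \<partial>?G) \<le> ennreal (8 * \<kappa> * s * C + 8 * \<kappa> / s * \<delta>)" .
  qed
  also have "\<dots> = ennreal (D * l * (1 + 2 * \<eta>) + (\<Sum>i<l. 8 * \<kappa> * s * C + 8 * \<kappa> / s * \<delta>))"
  proof -
    have nn: "0 \<le> 8 * \<kappa> * s * C + 8 * \<kappa> / s * \<delta>" using \<kappa> s C \<delta>0 by (intro add_nonneg_nonneg) auto
    have "ennreal (D * l * (1 + 2 * \<eta>)) + ennreal (\<Sum>i<l. 8 * \<kappa> * s * C + 8 * \<kappa> / s * \<delta>) =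
       ennreal (D * l * (1 + 2 * \<eta>) + (\<Sum>i<l. 8 * \<kappa> * s * C + 8 * \<kappa> / s * \<delta>))"
      by (rule ennreal_plus[symmetric]) (use nn D0 \<eta> in \<open>auto intro!: sum_nonneg mult_nonneg_nonneg\<close>)
    then show ?thesis by (subst sum_ennreal) (use nn in auto)
  qed
  also have "D * l * (1 + 2 * \<eta>) + (\<Sum>i<l. 8 * \<kappa> * s * C + 8 * \<kappa> / s * \<delta>) =
     l * \<kappa> * (exp (4 * \<eta>) * (1 + 2 * \<eta>) + 8 * s * C + 8 * \<delta> / s)"
    unfolding D(1) \<kappa>_def[symmetric] by (simp add: algebra_simps)
  finally show ?thesis using finA neA cA unfolding \<kappa>_def by blast
qed

text \<open>The threshold depends on \<open>\<epsilon>\<close> alone. Constants are fixed in the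
  order \<open>\<eta>\<close> for the main term, \<open>s\<close> for the moment term,
  \<open>l0\<close> for the exceptional set.\<close>

theorem gaussian_random_coding:
  fixes \<epsilon> :: real
  assumes \<epsilon>: "\<epsilon> > 0"
  shows "\<exists>l0\<ge>1. \<forall>l\<ge>l0. \<forall>k\<ge>1. \<exists>A. finite A \<and> A \<noteq> {} \<and> card A \<le> k \<and>
    code_error l A
      \<le> ennreal ((1 + \<epsilon>) * (l * real k powr (- 2 / l)))"
proof -
  have "((\<lambda>\<eta>. exp (4 * \<eta>) * (1 + 2 * \<eta>) + \<eta>) \<longlongrightarrow> exp (4 * 0) * (1 + 2 * 0) + 0) (at_right (0::real))"
    by (intro tendsto_intros)
  then have "\<forall>\<^sub>F \<eta> in at_right (0::real). exp (4 * \<eta>) * (1 + 2 * \<eta>) + \<eta> < 1 + \<epsilon> / 2"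
    by (rule order_tendstoD) (use \<epsilon> in simp)
  moreover have "\<forall>\<^sub>F \<eta> in at_right (0::real). \<eta> \<in> {0<..<1}"
    by (rule eventually_at_right_real) simp
  ultimately have "\<forall>\<^sub>F \<eta> in at_right (0::real). exp (4 * \<eta>) * (1 + 2 * \<eta>) + \<eta> < 1 + \<epsilon> / 2 \<and> \<eta> \<in> {0<..<1}"
    by (rule eventually_conj)
  from eventually_happens[OF this] obtain \<eta> :: real where
    \<eta>: "exp (4 * \<eta>) * (1 + 2 * \<eta>) + \<eta> < 1 + \<epsilon> / 2" "0 < \<eta>" "\<eta> \<le> 1"
    by (auto simp: trivial_limit_at_right_real)
  obtain C where C: "C > 0" "(\<integral>\<^sup>+ x. ennreal ((1 + \<bar>x\<bar>)^8) \<partial>std_normal_distribution) \<le> ennreal C"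
    using eighth_moment_bound by blast
  \<comment> \<open>Makes 8 s C equal to \<eta> / 2; large \<open>l\<close> brings 8 \<delta> / s
    below \<eta> / 2. The two use up the summand \<eta> reserved in the choice of
    \<open>\<eta>\<close>.\<close>
  define s where "s = \<eta> / (16 * C)"
  have s: "s > 0" "8 * s * C = \<eta> / 2" using \<eta> C by (auto simp: s_def)
  \<comment> \<open>Chosen to give \<delta> at most K / l: the first summand is the Chebyshev term,
    the second bounds exp (- exp (\<eta> l / 2) / 2) by 4 / (\<eta> l).\<close>
  define K where "K = 2 / \<eta>\<^sup>2 + 4 / \<eta>"
  have "((\<lambda>l. 3 powr (2 / real l)) \<longlongrightarrow> (3::real) powr 0) sequentially"
    by (intro tendsto_intros lim_const_over_n) auto
  then have "((\<lambda>l. 3 powr (2 / real l) * (1 + \<epsilon> / 2)) \<longlongrightarrow> (3::real) powr 0 * (1 + \<epsilon> / 2)) sequentially"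
    by (rule tendsto_mult[OF _ tendsto_const])
  then have ev1: "\<forall>\<^sub>F l in sequentially. 3 powr (2 / real l) * (1 + \<epsilon> / 2) < 1 + \<epsilon>"
    by (rule order_tendstoD) (use \<epsilon> in simp)
  have ev2: "\<forall>\<^sub>F l in sequentially. real l \<ge> max (8 / \<eta>\<^sup>2) (16 * K / (s * \<eta>))"
    using filterlim_real_sequentially unfolding filterlim_at_top by blast
  obtain l0 where l0: "\<And>l. l \<ge> l0 \<Longrightarrow> 3 powr (2 / real l) * (1 + \<epsilon> / 2) < 1 + \<epsilon>"
     "\<And>l. l \<ge> l0 \<Longrightarrow> real l \<ge> max (8 / \<eta>\<^sup>2) (16 * K / (s * \<eta>))"
    using eventually_conj[OF ev1 ev2] unfolding eventually_sequentially by blast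
  have "\<exists>A. finite A \<and> A \<noteq> {} \<and> card A \<le> k \<and>
    code_error l A
      \<le> ennreal ((1 + \<epsilon>) * (l * real k powr (- 2 / l)))" if l: "l \<ge> l0" and k: "k \<ge> 1" for l k
  proof -
    have l8: "real l \<ge> 8 / \<eta>\<^sup>2" and lK: "real l \<ge> 16 * K / (s * \<eta>)" using l0(2)[OF l] by auto
    have "0 < 8 / \<eta>\<^sup>2" using \<eta> by simp
    then have lpos: "real l > 0" using l8 by linarith
    have triv: ?thesis if "real l \<le> (1 + \<epsilon>) * (l * real k powr (- 2 / l))"
      using k that
      by (intro exI[of _ "{\<lambda>_. 0}"] conjI order_trans[OF eq_refl[OF gaussian_trivial_quantizer]] ennreal_leI) auto
    show ?thesis
    proof (cases "k = 1")
      case True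
      then show ?thesis using \<epsilon> by (intro triv) (simp add: algebra_simps)
    next
      case False
      \<comment> \<open>Random code and product quantizer get k' points each. Since k is at most 3
        k', the halving costs only 3^(2/l), which tends to 1.\<close>
      define k' where "k' = k div 2"
      have k': "k' \<ge> 1" "2 * k' \<le> k" "k \<le> 3 * k'" using k False by (auto simp: k'_def)
      define \<kappa> where "\<kappa> = real k' powr (- 2 / l)"
      have \<kappa>: "\<kappa> > 0" using k' by (simp add: \<kappa>_def)
      have "real k powr (2 / l) \<le> (3 * real k') powr (2 / l)"
        using k' by (intro powr_mono2) (auto simp flip: of_nat_mult)
      also have "\<dots> = 3 powr (2 / l) * real k' powr (2 / l)" by (simp add: powr_mult)
      finally have "real k powr (2 / l) \<le> 3 powr (2 / l) * real k' powr (2 / l)" .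
      then have \<kappa>le: "\<kappa> \<le> 3 powr (2 / l) * real k powr (- 2 / l)"
        using k k' by (simp add: \<kappa>_def powr_minus divide_simps)
      have up: "l * \<kappa> * (1 + \<epsilon> / 2) \<le> (1 + \<epsilon>) * (l * real k powr (- 2 / l))"
      proof -
        have "l * \<kappa> * (1 + \<epsilon> / 2) \<le> l * (3 powr (2 / l) * real k powr (- 2 / l)) * (1 + \<epsilon> / 2)"
          using \<kappa>le \<epsilon> by (intro mult_right_mono mult_left_mono) auto
        also have "\<dots> = (3 powr (2 / l) * (1 + \<epsilon> / 2)) * (l * real k powr (- 2 / l))" by (simp add: mult_ac)
        also have "\<dots> \<le> (1 + \<epsilon>) * (l * real k powr (- 2 / l))"
          using l0(1)[OF l] by (intro mult_right_mono) auto
        finally show ?thesis .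
      qed
      define D where "D = \<kappa> * exp (4 * \<eta>)"
      show ?thesis
      proof (cases "D < 1")
        \<comment> \<open>The allowed distortion per coordinate is at least the variance, so the
          code consisting of 0 suffices.\<close>
        case False
        have "exp (4 * \<eta>) * 1 \<le> exp (4 * \<eta>) * (1 + 2 * \<eta>)" using \<eta> by (intro mult_left_mono) auto
        then have "exp (4 * \<eta>) \<le> 1 + \<epsilon> / 2" using \<eta> by linarith
        have "real l * 1 \<le> l * D" using False by (intro mult_left_mono) auto
        also have "\<dots> = l * \<kappa> * exp (4 * \<eta>)" by (simp add: D_def)
        also have "\<dots> \<le> l * \<kappa> * (1 + \<epsilon> / 2)" using \<open>exp (4 * \<eta>) \<le> 1 + \<epsilon> / 2\<close> \<kappa> by (intro mult_left_mono) auto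
        finally show ?thesis using up by (intro triv) linarith
      next
        case True
        define \<delta> where "\<delta> = 2 / (\<eta>\<^sup>2 * l) + exp (- exp (\<eta> * l / 2) / 2)"
        have "\<delta> \<le> K / l"
        proof -
          have x: "\<eta> * l / 2 > 0" using \<eta> lpos by simp
          have "exp (\<eta> * l / 2) \<ge> \<eta> * l / 2" using exp_ge_add_one_self[of "\<eta> * l / 2"] by linarith
          then have y: "exp (\<eta> * l / 2) / 2 \<ge> \<eta> * l / 4" by simp
          have "exp (exp (\<eta> * l / 2) / 2) \<ge> \<eta> * l / 4" using exp_ge_add_one_self[of "exp (\<eta> * l / 2) / 2"] y by linarith
          then have "1 / exp (exp (\<eta> * l / 2) / 2) \<le> 1 / (\<eta> * l / 4)"
            using x by (intro frac_le) auto
          moreover have "exp (- exp (\<eta> * l / 2) / 2) = 1 / exp (exp (\<eta> * l / 2) / 2)"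
            by (simp add: exp_minus inverse_eq_divide)
          ultimately have "exp (- exp (\<eta> * l / 2) / 2) \<le> 1 / (\<eta> * l / 4)" by simp
          also have "\<dots> = (4 / \<eta>) / l" by simp
          finally show ?thesis unfolding \<delta>_def K_def by (simp add: add_divide_distrib)
        qed
        also have "K / l \<le> s * \<eta> / 16"
          using lK s \<eta> lpos by (simp add: field_simps)
        finally have "8 * \<delta> / s \<le> \<eta> / 2" using s by (simp add: field_simps)
        then have sm: "exp (4 * \<eta>) * (1 + 2 * \<eta>) + 8 * s * C + 8 * \<delta> / s \<le> 1 + \<epsilon> / 2"
          using \<eta>(1) s(2) by linarith
        obtain A where A: "finite A" "A \<noteq> {}" "card A \<le> 2 * k'"
          "code_error l A
            \<le> ennreal (l * \<kappa> * (exp (4 * \<eta>) * (1 + 2 * \<eta>) + 8 * s * C + 8 * \<delta> / s))"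
          using gaussian_random_coding_step[OF \<eta>(2,3) l8 k'(1) s(1) C(2,1) _ True \<delta>_def]
          unfolding D_def \<kappa>_def by blast
        have "l * \<kappa> * (exp (4 * \<eta>) * (1 + 2 * \<eta>) + 8 * s * C + 8 * \<delta> / s) \<le> l * \<kappa> * (1 + \<epsilon> / 2)"
          using sm \<kappa> by (intro mult_left_mono) auto
        with up have "l * \<kappa> * (exp (4 * \<eta>) * (1 + 2 * \<eta>) + 8 * s * C + 8 * \<delta> / s) \<le> (1 + \<epsilon>) * (l * real k powr (- 2 / l))"
          by linarith
        then have "code_error l A \<le> ennreal ((1 + \<epsilon>) * (l * real k powr (- 2 / l)))"
          by (intro order_trans[OF A(4)] ennreal_leI)
        then show ?thesis using A k' by (intro exI[of _ A]) auto
      qed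
    qed
  qed
  then show ?thesis by (intro exI[of _ "max 1 l0"]) auto
qed

subsection \<open>Lower bound for the quantization error\<close>

lemma prod_mono_ennreal:
  fixes f g :: "'i \<Rightarrow> ennreal"
  assumes "\<And>i. i \<in> I \<Longrightarrow> f i \<le> g i"
  shows "prod f I \<le> prod g I"
  using assms by (induction I rule: infinite_finite_induct) (auto intro!: mult_mono)

text \<open>Completing the square. For L at least th the first term cancels the exponent of the
  normal density, and sqrt (th / L) times another normal density remains, whose integral does not
  depend on \<open>a\<close>. For L below th the two quadratic terms cancel each other and the
  integral is largest at a = 0.\<close>

lemma std_normal_exp_bound:
  fixes L th a :: real
  assumes L: "L > 0" and th: "th > 0"
  shows "(\<integral>\<^sup>+ x. ennreal (exp (L * x\<^sup>2 / (2 * max L th) - (sqrt L * x - a)\<^sup>2 / (2 * th))) \<partial>std_normal_distribution)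
    \<le> ennreal (exp (- max 0 (ln (L / th)) / 2))"
proof (cases "L \<ge> th")
  case True
  define \<sigma> where "\<sigma> = sqrt (th / L)"
  have \<sigma>: "\<sigma> > 0" "\<sigma>\<^sup>2 = th / L" using L th by (auto simp: \<sigma>_def)
  have eq: "std_normal_density x * exp (L * x\<^sup>2 / (2 * max L th) - (sqrt L * x - a)\<^sup>2 / (2 * th)) = \<sigma> * normal_density (a / sqrt L) \<sigma> x" for x
  proof -
    have "(sqrt L * x - a)\<^sup>2 = (sqrt L * (x - a / sqrt L))\<^sup>2" using L by (simp add: right_diff_distrib)
    also have "\<dots> = L * (x - a / sqrt L)\<^sup>2" using L by (simp add: power_mult_distrib)
    finally have e: "(sqrt L * x - a)\<^sup>2 / (2 * th) = (x - a / sqrt L)\<^sup>2 / (2 * \<sigma>\<^sup>2)"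
      unfolding \<sigma> using L th by (simp add: field_simps)
    have m: "L * x\<^sup>2 / (2 * max L th) = x\<^sup>2 / 2" using True L by (simp add: max_def)
    have "exp (- x\<^sup>2 / 2) * exp (x\<^sup>2 / 2 - (x - a / sqrt L)\<^sup>2 / (2 * \<sigma>\<^sup>2)) = exp (- (x - a / sqrt L)\<^sup>2 / (2 * \<sigma>\<^sup>2))"
      unfolding exp_add[symmetric] by simp
    moreover have "\<sigma> * (1 / sqrt (2 * pi * \<sigma>\<^sup>2)) = 1 / sqrt (2 * pi)"
      using \<sigma>(1) by (simp add: real_sqrt_mult)
    ultimately show ?thesis
      unfolding std_normal_density_def unfolding normal_density_def e m
      by (metis (no_types, opaque_lifting) mult.assoc)
  qed
  have "(\<integral>\<^sup>+ x. ennreal (exp (L * x\<^sup>2 / (2 * max L th) - (sqrt L * x - a)\<^sup>2 / (2 * th))) \<partial>std_normal_distribution) =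
    (\<integral>\<^sup>+ x. ennreal (\<sigma> * normal_density (a / sqrt L) \<sigma> x) \<partial>lborel)"
    by (subst nn_integral_density) (auto simp: ennreal_mult[symmetric] eq)
  also have "\<dots> = ennreal (\<integral>x. \<sigma> * normal_density (a / sqrt L) \<sigma> x \<partial>lborel)"
    using \<sigma> by (intro nn_integral_eq_integral) auto
  also have "\<dots> = ennreal \<sigma>" using \<sigma> by simp
  also have "\<sigma> = exp (- max 0 (ln (L / th)) / 2)"
  proof -
    have "ln (L / th) \<ge> 0" using True L th by simp
    then have "exp (- max 0 (ln (L / th)) / 2) = exp (ln (th / L) / 2)"
      using L th by (simp add: ln_div max_def)
    also have "\<dots> = exp (ln (th / L)) powr (1 / 2)" by (simp add: powr_def)
    also have "\<dots> = \<sigma>" using L th by (simp add: \<sigma>_def powr_half_sqrt)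
    finally show ?thesis ..
  qed
  finally show ?thesis by simp
next
  case False
  define m where "m = sqrt L * a / th"
  have eq: "std_normal_density x * exp (L * x\<^sup>2 / (2 * max L th) - (sqrt L * x - a)\<^sup>2 / (2 * th)) =
    exp (m\<^sup>2 / 2 - a\<^sup>2 / (2 * th)) * normal_density m 1 x" for x
  proof -
    have sq: "(sqrt L * x - a)\<^sup>2 = L * x\<^sup>2 - 2 * (sqrt L * a * x) + a\<^sup>2" using L by (simp add: power2_diff power_mult_distrib mult_ac)
    have ex: "L * x\<^sup>2 / (2 * max L th) - (sqrt L * x - a)\<^sup>2 / (2 * th) = m * x - a\<^sup>2 / (2 * th)"
      using False th L unfolding m_def sq by (simp add: max_def field_simps)
    have "exp (- x\<^sup>2 / 2) * exp (m * x - a\<^sup>2 / (2 * th)) = exp (m\<^sup>2 / 2 - a\<^sup>2 / (2 * th)) * exp (- (x - m)\<^sup>2 / 2)"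
      unfolding exp_add[symmetric] by (simp add: power2_diff field_simps)
    then show ?thesis unfolding std_normal_density_def normal_density_def ex by simp
  qed
  have "(\<integral>\<^sup>+ x. ennreal (exp (L * x\<^sup>2 / (2 * max L th) - (sqrt L * x - a)\<^sup>2 / (2 * th))) \<partial>std_normal_distribution) =
    (\<integral>\<^sup>+ x. ennreal (exp (m\<^sup>2 / 2 - a\<^sup>2 / (2 * th)) * normal_density m 1 x) \<partial>lborel)"
    by (subst nn_integral_density) (auto simp: ennreal_mult[symmetric] eq)
  also have "\<dots> = ennreal (\<integral>x. exp (m\<^sup>2 / 2 - a\<^sup>2 / (2 * th)) * normal_density m 1 x \<partial>lborel)"
    by (intro nn_integral_eq_integral) auto
  also have "\<dots> = ennreal (exp (m\<^sup>2 / 2 - a\<^sup>2 / (2 * th)))" by simp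
  also have "\<dots> \<le> ennreal (exp (- max 0 (ln (L / th)) / 2))"
  proof (intro ennreal_leI)
    have "m\<^sup>2 = L * a\<^sup>2 / (th * th)" using L by (simp add: m_def power_divide power_mult_distrib power2_eq_square)
    also have "\<dots> \<le> th * a\<^sup>2 / (th * th)" using False th by (intro divide_right_mono mult_right_mono) auto
    also have "\<dots> = a\<^sup>2 / th" using th by simp
    finally have "m\<^sup>2 / 2 - a\<^sup>2 / (2 * th) \<le> 0" using th by (simp add: field_simps)
    moreover have "ln (L / th) \<le> 0" using False L th by simp
    ultimately show "exp (m\<^sup>2 / 2 - a\<^sup>2 / (2 * th)) \<le> exp (- max 0 (ln (L / th)) / 2)" by simp
  qed
  finally show ?thesis .
qed

context gaussian_eigen
begin

lemma Z_nn_integral: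
  assumes [measurable]: "f \<in> borel_measurable borel"
  shows "(\<integral>\<^sup>+ \<omega>. f (Z i \<omega>) \<partial>M) = (\<integral>\<^sup>+ x. f x \<partial>std_normal_distribution)"
proof -
  have "std_normal_distribution = distr M lborel (Z i)"
    using Z_std_normal[of i] by (simp add: distributed_def)
  then show ?thesis by (simp add: nn_integral_distr)
qed

lemma coord_eq_Z: "X \<omega> \<bullet> v i = sqrt (L i) * Z i \<omega>"
  using L_pos[of i] by (simp add: Z_def)

abbreviation min_dist_sq :: "'h set \<Rightarrow> 'w \<Rightarrow> real" where
  "min_dist_sq A \<omega> \<equiv> (Min ((\<lambda>a. dist (X \<omega>) a) ` A))\<^sup>2"

lemma Min_dist_sq_measurable:
  assumes "finite A"
  shows "(\<lambda>\<omega>. min_dist_sq A \<omega>) \<in> borel_measurable M"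
  using assms by (intro borel_measurable_power borel_measurable_Min) auto

lemma Min_dist_sq_integrable:
  assumes A: "finite A" "A \<noteq> {}"
  shows "integrable M (\<lambda>\<omega>. min_dist_sq A \<omega>)"
proof -
  obtain a where a: "a \<in> A" using A by blast
  show ?thesis
  proof (rule Bochner_Integration.integrable_bound)
    show "integrable M (\<lambda>\<omega>. 2 * (norm (X \<omega>))\<^sup>2 + 2 * (norm a)\<^sup>2)" using norm_X_sq_integrable by simp
    show "(\<lambda>\<omega>. min_dist_sq A \<omega>) \<in> borel_measurable M" by (rule Min_dist_sq_measurable[OF A(1)])
    show "AE \<omega> in M. norm (min_dist_sq A \<omega>) \<le> norm (2 * (norm (X \<omega>))\<^sup>2 + 2 * (norm a)\<^sup>2)"
    proof (rule AE_I2)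
      fix \<omega>
      have "0 \<le> Min ((\<lambda>a. dist (X \<omega>) a) ` A)" using A by (subst Min_ge_iff) auto
      moreover have "Min ((\<lambda>a. dist (X \<omega>) a) ` A) \<le> norm (X \<omega>) + norm a"
        using A a by (intro order_trans[OF Min_le[of _ "dist (X \<omega>) a"]]) (auto simp: dist_norm norm_triangle_ineq4)
      ultimately have "min_dist_sq A \<omega> \<le> (norm (X \<omega>) + norm a)\<^sup>2" by (intro power_mono)
      also have "\<dots> \<le> 2 * (norm (X \<omega>))\<^sup>2 + 2 * (norm a)\<^sup>2"
        using sum_squares_bound[of "norm (X \<omega>)" "norm a"] by (simp add: power2_sum)
      finally show "norm (min_dist_sq A \<omega>) \<le> norm (2 * (norm (X \<omega>))\<^sup>2 + 2 * (norm a)\<^sup>2)" by simp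
    qed
  qed
qed

text \<open>Shannon's lower bound by duality. By Jensen's inequality,
  \<open>E Y \<le> ln E exp Y\<close> for \<open>Y = (\<Sum>i<N. x\<^sub>i\<^sup>2 / (2 max(L\<^sub>i, th))) - min\<^sub>a \<parallel>x - a\<parallel>\<^sup>2 / (2 th)\<close>, and
  for a single \<open>a\<close> the exponential moment factorizes and is bounded uniformly in \<open>a\<close>.\<close>

lemma quantization_lower_bound:
  assumes A: "finite A" "A \<noteq> {}" "card A \<le> n" and th: "th > 0"
  shows "expectation (\<lambda>\<omega>. min_dist_sq A \<omega>) \<ge>
    (\<Sum>i<N. min th (L i) + th * max 0 (ln (L i / th))) - 2 * th * ln n"
proof -
  define f where "f \<omega> = min_dist_sq A \<omega>" for \<omega>
  define c where "c i = 1 / (2 * max (L i) th)" for i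
  define Y where "Y \<omega> = (\<Sum>i<N. c i * (X \<omega> \<bullet> v i)\<^sup>2) - f \<omega> / (2 * th)" for \<omega>
  define e where "e i a x = exp (L i * x\<^sup>2 / (2 * max (L i) th) - (sqrt (L i) * x - a \<bullet> v i)\<^sup>2 / (2 * th))" for i a x
  define \<rho> where "\<rho> = (\<Prod>i<N. exp (- max 0 (ln (L i / th)) / 2))"
  have n: "n \<ge> 1" using A by (metis One_nat_def Suc_leI card_gt_0_iff le_trans)
  have \<rho>: "\<rho> > 0" unfolding \<rho>_def by (intro prod_pos) auto
  have if': "integrable M f" unfolding f_def by (rule Min_dist_sq_integrable[OF A(1,2)])
  have [measurable]: "f \<in> borel_measurable M" using if' by simp
  have iY: "integrable M Y" unfolding Y_def using if' coord_sq_integrable by auto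
  have EY: "expectation Y = (\<Sum>i<N. c i * L i) - expectation f / (2 * th)"
    unfolding Y_def using if' coord_sq_integrable by (simp add: coord_variance)
  \<comment> \<open>Coordinates from N on are dropped by Bessel's inequality, and the exponential at
    the nearest codeword is bounded by the sum over all codewords; this sum is where
    \<open>n\<close> enters.\<close>
  have pt: "ennreal (exp (Y \<omega>)) \<le> (\<Sum>a\<in>A. \<Prod>i<N. ennreal (e i a (Z i \<omega>)))" for \<omega>
  proof -
    have "Min ((\<lambda>a. dist (X \<omega>) a) ` A) \<in> (\<lambda>a. dist (X \<omega>) a) ` A" using A by (intro Min_in) auto
    then obtain a where a: "a \<in> A" "f \<omega> = (dist (X \<omega>) a)\<^sup>2" unfolding f_def by force
    have "(\<Sum>i<N. ((X \<omega> - a) \<bullet> v i)\<^sup>2) \<le> f \<omega>"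
      unfolding a(2) dist_norm by (rule bessel_ineq_seq[OF v]) simp
    then have "Y \<omega> \<le> (\<Sum>i<N. c i * (X \<omega> \<bullet> v i)\<^sup>2) - (\<Sum>i<N. ((X \<omega> - a) \<bullet> v i)\<^sup>2) / (2 * th)"
      unfolding Y_def using th by (simp add: divide_right_mono)
    also have "\<dots> = (\<Sum>i<N. L i * (Z i \<omega>)\<^sup>2 / (2 * max (L i) th) - (sqrt (L i) * Z i \<omega> - a \<bullet> v i)\<^sup>2 / (2 * th))"
      unfolding sum_divide_distrib sum_subtractf[symmetric]
      using L_pos by (intro sum.cong) (auto simp: c_def coord_eq_Z inner_diff_left power_mult_distrib less_imp_le)
    finally have "exp (Y \<omega>) \<le> (\<Prod>i<N. e i a (Z i \<omega>))" by (simp add: e_def exp_sum[symmetric])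
    then have "ennreal (exp (Y \<omega>)) \<le> (\<Prod>i<N. ennreal (e i a (Z i \<omega>)))"
      by (subst prod_ennreal) (auto simp: e_def intro!: ennreal_leI)
    also have "\<dots> \<le> (\<Sum>a\<in>A. \<Prod>i<N. ennreal (e i a (Z i \<omega>)))"
      using A a(1) by (intro member_le_sum) auto
    finally show ?thesis .
  qed
  have em[measurable]: "e i a \<in> borel_measurable borel" for i a unfolding e_def by measurable
  have fac: "(\<integral>\<^sup>+ \<omega>. (\<Prod>i<N. ennreal (e i a (Z i \<omega>))) \<partial>M) \<le> ennreal \<rho>" for a
  proof -
    have ind: "indep_vars (\<lambda>_. borel) Z {..<N}" by (rule indep_vars_subset[OF Z_indep]) auto
    have "(\<integral>\<^sup>+ \<omega>. (\<Prod>i<N. ennreal (e i a (Z i \<omega>))) \<partial>M) = (\<Prod>i<N. \<integral>\<^sup>+ \<omega>. ennreal (e i a (Z i \<omega>)) \<partial>M)"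
      by (rule indep_vars_nn_integral[OF _ indep_vars_compose2[OF ind]]) auto
    also have "\<dots> = (\<Prod>i<N. \<integral>\<^sup>+ x. ennreal (e i a x) \<partial>std_normal_distribution)"
      by (intro prod.cong refl Z_nn_integral) measurable
    also have "\<dots> \<le> (\<Prod>i<N. ennreal (exp (- max 0 (ln (L i / th)) / 2)))"
      unfolding e_def using L_pos th by (intro prod_mono_ennreal std_normal_exp_bound) auto
    also have "\<dots> = ennreal \<rho>" unfolding \<rho>_def by (rule prod_ennreal) auto
    finally show ?thesis .
  qed
  have "(\<integral>\<^sup>+ \<omega>. ennreal (exp (Y \<omega>)) \<partial>M) \<le> (\<integral>\<^sup>+ \<omega>. (\<Sum>a\<in>A. \<Prod>i<N. ennreal (e i a (Z i \<omega>))) \<partial>M)"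
    by (rule nn_integral_mono) (rule pt)
  also have "\<dots> = (\<Sum>a\<in>A. \<integral>\<^sup>+ \<omega>. (\<Prod>i<N. ennreal (e i a (Z i \<omega>))) \<partial>M)"
    by (rule nn_integral_sum) measurable
  also have "\<dots> \<le> (\<Sum>a\<in>A. ennreal \<rho>)" by (intro sum_mono fac)
  also have "\<dots> = ennreal (card A * \<rho>)" using \<rho> by (simp add: ennreal_mult ennreal_of_nat_eq_real_of_nat)
  also have "\<dots> \<le> ennreal (n * \<rho>)" using A(3) \<rho> by (intro ennreal_leI mult_right_mono) auto
  finally have K: "(\<integral>\<^sup>+ \<omega>. ennreal (exp (Y \<omega>)) \<partial>M) \<le> ennreal (n * \<rho>)" .
  have [measurable]: "Y \<in> borel_measurable M" using iY by simp
  have n\<rho>: "n * \<rho> > 0" using n \<rho> by simp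
  have iE: "integrable M (\<lambda>\<omega>. exp (Y \<omega>))"
    using K by (intro integrableI_nonneg) (auto simp: less_top[symmetric] top_unique)
  have EE: "expectation (\<lambda>\<omega>. exp (Y \<omega>)) \<le> n * \<rho>"
    using K n\<rho> by (subst (asm) nn_integral_eq_integral[OF iE]) auto
  \<comment> \<open>Jensen's inequality in elementary form: 1 + x is at most exp x, normalized by
    the bound n \<rho> on the exponential moment.\<close>
  have "1 + (expectation Y - ln (n * \<rho>)) = expectation (\<lambda>\<omega>. 1 + (Y \<omega> - ln (n * \<rho>)))"
    using iY by (simp add: prob_space)
  also have "\<dots> \<le> expectation (\<lambda>\<omega>. exp (Y \<omega>) * (1 / (n * \<rho>)))"
  proof (rule integral_mono)
    fix \<omega>
    have "exp (Y \<omega>) * (1 / (n * \<rho>)) = exp (Y \<omega> - ln (n * \<rho>))" using n\<rho> by (simp add: exp_diff)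
    then show "1 + (Y \<omega> - ln (n * \<rho>)) \<le> exp (Y \<omega>) * (1 / (n * \<rho>))" using exp_ge_add_one_self[of "Y \<omega> - ln (n * \<rho>)"] by simp
  qed (use iY iE in auto)
  also have "\<dots> = expectation (\<lambda>\<omega>. exp (Y \<omega>)) / (n * \<rho>)" by simp
  also have "\<dots> \<le> 1" using EE n\<rho> by (simp add: divide_le_eq)
  finally have "expectation Y \<le> ln (n * \<rho>)" by simp
  also have "ln (n * \<rho>) = ln n + ln \<rho>" using n \<rho> by (simp add: ln_mult)
  also have "ln \<rho> = - (\<Sum>i<N. max 0 (ln (L i / th))) / 2"
    unfolding \<rho>_def by (subst ln_prod) (auto simp: sum_negf sum_divide_distrib)
  finally have "(\<Sum>i<N. c i * L i) - expectation f / (2 * th) \<le> ln n - (\<Sum>i<N. max 0 (ln (L i / th))) / 2"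
    unfolding EY by simp
  then have "2 * th * ((\<Sum>i<N. c i * L i) - expectation f / (2 * th)) \<le> 2 * th * (ln n - (\<Sum>i<N. max 0 (ln (L i / th))) / 2)"
    using th by (intro mult_left_mono) auto
  then have "(\<Sum>i<N. 2 * th * (c i * L i)) + (\<Sum>i<N. th * max 0 (ln (L i / th))) - 2 * th * ln n \<le> expectation f"
    using th by (simp add: right_diff_distrib sum_distrib_left[symmetric])
  moreover have "2 * th * (c i * L i) = min th (L i)" for i
    using th L_pos[of i] by (auto simp: c_def max_def min_def field_simps)
  ultimately show ?thesis unfolding f_def by (simp add: sum.distrib)
qed

end

subsection \<open>Block quantization\<close>

lemma euclid_dist_sq: "(euclid_dist l x y)\<^sup>2 = sq_dist l x y"
  unfolding euclid_dist_def by (simp add: sum_nonneg)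

lemma Min_euclid_dist_sq:
  assumes "finite A" "A \<noteq> {}"
  shows "(Min ((\<lambda>a. euclid_dist l x a) ` A))\<^sup>2 = min_sq_dist l A x"
proof -
  have m: "mono (\<lambda>x::real. sqrt x)" by (simp add: mono_def)
  have "Min ((\<lambda>a. euclid_dist l x a) ` A) = Min (sqrt ` (\<lambda>a. sq_dist l x a) ` A)"
    by (simp add: euclid_dist_def image_image)
  also have "\<dots> = sqrt (min_sq_dist l A x)"
    using assms by (intro mono_Min_commute[OF m, symmetric]) auto
  finally show ?thesis
    using assms by (simp add: Min_ge_iff sum_nonneg)
qed

lemma quant_err_nonneg: "quant_err M d Y \<alpha> \<ge> 0"
  unfolding quant_err_def by (simp add: Bochner_Integration.integral_nonneg)

lemma quant_err_sq: "(quant_err M d Y \<alpha>)\<^sup>2 = (\<integral>\<omega>. (Min ((\<lambda>a. d (Y \<omega>) a) ` \<alpha>))\<^sup>2 \<partial>M)"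
  unfolding quant_err_def by (simp add: Bochner_Integration.integral_nonneg)

lemma quant_number_le:
  assumes "\<alpha> \<subseteq> S" "finite \<alpha>" "\<alpha> \<noteq> {}" "card \<alpha> \<le> k"
  shows "quant_number M S d Y k \<le> quant_err M d Y \<alpha>"
  unfolding quant_number_def
  by (rule cInf_lower) (use assms in \<open>auto intro!: bdd_belowI[of _ 0] quant_err_nonneg\<close>)

text \<open>By optimality any code for the Gaussian law may be compared with
  \<open>\<alpha>\<close>. Codewords of \<open>A\<close> may have entries outside
  \<open>{..<l}\<close>, which the distance ignores; cutting them off gives a competitor inside
  \<open>Rl l\<close>.\<close>

lemma (in prob_space) optimal_gaussian_quantizer_error:
  assumes W[measurable]: "\<And>k. (\<lambda>\<omega>. W \<omega> k) \<in> borel_measurable M"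
    and law: "distr M (PiM {..<l} (\<lambda>_. borel)) (\<lambda>\<omega>. \<lambda>k\<in>{..<l}. W \<omega> k) = gaussian_product l"
    and A: "finite A" "A \<noteq> {}" "card A \<le> k"
    and B: "code_error l A \<le> ennreal B" "B \<ge> 0"
    and opt: "optimal_quantizer M (Rl l) (euclid_dist l) W k \<alpha>"
  shows "(quant_err M (euclid_dist l) W \<alpha>)\<^sup>2 \<le> B"
proof -
  define A' where "A' = (\<lambda>a k. if k < l then a k else 0) ` A"
  have A': "finite A'" "A' \<noteq> {}" "A' \<subseteq> Rl l" using A by (auto simp: A'_def Rl_def)
  have cA': "card A' \<le> k" unfolding A'_def using A card_image_le order_trans by blast
  have "quant_err M (euclid_dist l) W \<alpha> \<le> quant_err M (euclid_dist l) W A'"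
    using opt quant_number_le[OF A'(3,1,2) cA'] unfolding optimal_quantizer_def by metis
  then have "(quant_err M (euclid_dist l) W \<alpha>)\<^sup>2 \<le> (quant_err M (euclid_dist l) W A')\<^sup>2"
    by (intro power_mono quant_err_nonneg)
  also have "\<dots> = (\<integral>\<omega>. min_sq_dist l A (W \<omega>) \<partial>M)"
  proof -
    have sd: "sq_dist l w (\<lambda>k. if k < l then a k else 0) = sq_dist l w a" for w a :: "nat \<Rightarrow> real"
      by (rule sum.cong) auto
    have "(Min ((\<lambda>a. euclid_dist l (W \<omega>) a) ` A'))\<^sup>2 = min_sq_dist l A (W \<omega>)" for \<omega>
      unfolding Min_euclid_dist_sq[OF A'(1,2)] unfolding A'_def image_image sd ..
    then show ?thesis unfolding quant_err_sq by simp
  qed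
  also have "\<dots> = enn2real (\<integral>\<^sup>+ \<omega>. ennreal (min_sq_dist l A (W \<omega>)) \<partial>M)"
    using A by (intro integral_eq_nn_integral) (auto simp: Min_ge_iff sum_nonneg)
  also have "(\<integral>\<^sup>+ \<omega>. ennreal (min_sq_dist l A (W \<omega>)) \<partial>M) =
      (\<integral>\<^sup>+ z. ennreal (min_sq_dist l A z) \<partial>distr M (PiM {..<l} (\<lambda>_. borel)) (\<lambda>\<omega>. \<lambda>k\<in>{..<l}. W \<omega> k))"
    using A by (subst nn_integral_distr) auto
  also have "\<dots> = code_error l A"
    unfolding law ..
  also have "enn2real \<dots> \<le> B"
    using enn2real_mono[OF B(1)] B(2) by simp
  finally show ?thesis .
qed

text \<open>The cells partition \<open>Rl l\<close>, so exactly one indicator equals 1 and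
  \<open>What\<close> is the codeword of that cell, which is a nearest one.\<close>

lemma voronoi_quantizationD:
  assumes vor: "voronoi_quantization l M \<alpha> W What" and fin: "finite \<alpha>" "\<alpha> \<noteq> {}"
    and W: "\<And>k. (\<lambda>\<omega>. W \<omega> k) \<in> borel_measurable M" and WR: "\<And>\<omega>. W \<omega> \<in> Rl l"
  shows "\<And>\<omega>. \<omega> \<in> space M \<Longrightarrow> What \<omega> \<in> \<alpha>"
    and "\<And>k. (\<lambda>\<omega>. What \<omega> k) \<in> borel_measurable M"
    and "(quant_err M (euclid_dist l) W \<alpha>)\<^sup>2 = (\<integral>\<omega>. sq_dist l (W \<omega>) (What \<omega>) \<partial>M)"
proof -
  from vor obtain C where C0: "(\<forall>a\<in>\<alpha>. C a \<in> sets borel \<and>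
         C a \<subseteq> {x \<in> Rl l. \<forall>c\<in>\<alpha>. euclid_dist l x a \<le> euclid_dist l x c}) \<and>
      disjoint_family_on C \<alpha> \<and> (\<Union>a\<in>\<alpha>. C a) = Rl l \<and>
      (\<forall>\<omega>\<in>space M. What \<omega> = (\<lambda>k. \<Sum>a\<in>\<alpha>. indicator (C a) (W \<omega>) * a k))"
    unfolding voronoi_quantization_def by (rule exE)
  have C: "\<And>a. a \<in> \<alpha> \<Longrightarrow> C a \<in> sets borel"
    "\<And>a. a \<in> \<alpha> \<Longrightarrow> C a \<subseteq> {x \<in> Rl l. \<forall>c\<in>\<alpha>. euclid_dist l x a \<le> euclid_dist l x c}"
    "disjoint_family_on C \<alpha>" "(\<Union>a\<in>\<alpha>. C a) = Rl l"
    "\<And>\<omega>. \<omega> \<in> space M \<Longrightarrow> What \<omega> = (\<lambda>k. \<Sum>a\<in>\<alpha>. indicator (C a) (W \<omega>) * a k)"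
    using C0 by simp_all
  have key: "\<exists>a\<in>\<alpha>. What \<omega> = a \<and> W \<omega> \<in> C a" if \<omega>: "\<omega> \<in> space M" for \<omega>
  proof -
    obtain a where a: "a \<in> \<alpha>" "W \<omega> \<in> C a" using C(4) WR[of \<omega>] by blast
    have "W \<omega> \<notin> C c" if "c \<in> \<alpha>" "c \<noteq> a" for c
      using disjoint_family_onD[OF C(3) that(1) a(1) that(2)] a(2) by blast
    then have "(\<Sum>c\<in>\<alpha>. indicator (C c) (W \<omega>) * c k) = a k" for k
      using a fin by (subst sum.remove[of _ a]) (auto intro!: sum.neutral)
    then have "What \<omega> = a" using C(5)[OF \<omega>] by auto
    then show ?thesis using a by blast
  qed
  then show "\<And>\<omega>. \<omega> \<in> space M \<Longrightarrow> What \<omega> \<in> \<alpha>" by blast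
  \<comment> \<open>The Borel sets of \<open>nat \<Rightarrow> real\<close> come from the product
    topology, so measurability of every coordinate suffices.\<close>
  have Wm[measurable]: "W \<in> borel_measurable M"
    by (rule measurable_coordinatewise_then_product) (rule W)
  have ind: "(\<lambda>\<omega>. indicator (C a) (W \<omega>) :: real) \<in> borel_measurable M" if "a \<in> \<alpha>" for a
    by (rule measurable_compose[OF Wm borel_measurable_indicator[OF C(1)[OF that]]])
  show "(\<lambda>\<omega>. What \<omega> k) \<in> borel_measurable M" for k
  proof (subst measurable_cong)
    show "\<omega> \<in> space M \<Longrightarrow> What \<omega> k = (\<Sum>a\<in>\<alpha>. indicator (C a) (W \<omega>) * a k)" for \<omega>
      using C(5) by simp
    show "(\<lambda>\<omega>. \<Sum>a\<in>\<alpha>. indicator (C a) (W \<omega>) * a k) \<in> borel_measurable M"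
      by (intro borel_measurable_sum borel_measurable_times borel_measurable_const ind)
  qed
  show "(quant_err M (euclid_dist l) W \<alpha>)\<^sup>2 = (\<integral>\<omega>. sq_dist l (W \<omega>) (What \<omega>) \<partial>M)"
    unfolding quant_err_sq
  proof (rule Bochner_Integration.integral_cong[OF refl])
    fix \<omega> assume "\<omega> \<in> space M"
    then obtain a where a: "a \<in> \<alpha>" "What \<omega> = a" "W \<omega> \<in> C a" using key by blast
    have "Min ((\<lambda>a. euclid_dist l (W \<omega>) a) ` \<alpha>) = euclid_dist l (W \<omega>) a"
      using a C(2)[OF a(1)] fin by (intro Min_eqI) auto
    then show "(Min ((\<lambda>a. euclid_dist l (W \<omega>) a) ` \<alpha>))\<^sup>2 = sq_dist l (W \<omega>) (What \<omega>)"
      by (simp add: euclid_dist_sq a(2))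
  qed
qed

context gaussian_eigen
begin

text \<open>Needed for the shift from k to j l + k. Independence factorizes the characteristic
  functions over the image of \<open>p\<close>, and the criterion is applied again to the reindexed
  family.\<close>

lemma Z_indep_reindex:
  assumes p: "inj p"
  shows "indep_vars (\<lambda>_. borel) (\<lambda>k. Z (p k)) UNIV"
proof (rule indep_vars_if_char_factorizes)
  fix J :: "'a set" and t assume J: "finite J"
  have inj: "inj_on p J" using p by (rule inj_on_subset) simp
  have 1: "(CLINT \<omega>|M. iexp (\<Sum>i\<in>I. s i * Z i \<omega>)) = (\<Prod>i\<in>I. CLINT \<omega>|M. iexp (s i * Z i \<omega>))" if "finite I" for I s
  proof -
    have "(CLINT \<omega>|M. (\<Prod>i\<in>I. iexp (s i * Z i \<omega>))) = (\<Prod>i\<in>I. CLINT \<omega>|M. iexp (s i * Z i \<omega>))"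
    proof (rule indep_vars_lebesgue_integral[OF that])
      have "indep_vars (\<lambda>_. borel) Z I" by (rule indep_vars_subset[OF Z_indep]) auto
      then show "indep_vars (\<lambda>_. borel) (\<lambda>i \<omega>. iexp (s i * Z i \<omega>)) I"
        by (rule indep_vars_compose2) auto
      show "integrable M (\<lambda>\<omega>. iexp (s i * Z i \<omega>))" for i
        by (intro integrable_const_bound[where B=1]) auto
    qed
    moreover have "(\<Prod>i\<in>I. iexp (s i * Z i \<omega>)) = iexp (\<Sum>i\<in>I. s i * Z i \<omega>)" for \<omega>
      using that by (simp add: exp_sum[symmetric] sum_distrib_left)
    ultimately show ?thesis by simp
  qed
  have "(\<Sum>j\<in>J. t j * Z (p j) \<omega>) = (\<Sum>i\<in>p ` J. t (inv p i) * Z i \<omega>)" for \<omega>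
    using p by (subst sum.reindex[OF inj]) simp
  moreover have "(\<Prod>j\<in>J. CLINT \<omega>|M. iexp (t j * Z (p j) \<omega>)) = (\<Prod>i\<in>p ` J. CLINT \<omega>|M. iexp (t (inv p i) * Z i \<omega>))"
    using p by (subst prod.reindex[OF inj]) simp
  ultimately show "(CLINT \<omega>|M. iexp (\<Sum>j\<in>J. t j * Z (p j) \<omega>)) = (\<Prod>j\<in>J. CLINT \<omega>|M. iexp (t j * Z (p j) \<omega>))"
    using 1[of "p ` J" "\<lambda>i. t (inv p i)"] J by simp
qed simp

text \<open>Blocks are counted from 0, so this becomes \<open>Zblock\<close> with index
  \<open>Suc j\<close>; the zeros from \<open>l\<close> on place it in \<open>Rl l\<close>.\<close>

definition block :: "nat \<Rightarrow> nat \<Rightarrow> 'w \<Rightarrow> nat \<Rightarrow> real" where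
  "block l j \<omega> = (\<lambda>k. if k < l then Z (j * l + k) \<omega> else 0)"

lemma block_measurable: "(\<lambda>\<omega>. block l j \<omega> k) \<in> borel_measurable M"
  unfolding block_def by measurable

lemma block_Rl: "block l j \<omega> \<in> Rl l"
  by (simp add: block_def Rl_def)

lemma block_law:
  assumes l: "l \<ge> 1"
  shows "distr M (PiM {..<l} (\<lambda>_. borel)) (\<lambda>\<omega>. \<lambda>k\<in>{..<l}. block l j \<omega> k) = gaussian_product l"
proof -
  have law1: "distr M borel (Z i) = std_normal_distribution" for i
  proof -
    have "distr M borel (Z i) = distr M lborel (Z i)" by (rule distr_cong) auto
    then show ?thesis using Z_std_normal[of i] by (simp add: distributed_def)
  qed
  have "indep_vars (\<lambda>_. borel) (\<lambda>k. Z (j * l + k)) {..<l}"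
    by (rule indep_vars_subset[OF Z_indep_reindex]) (auto simp: inj_def)
  then have "distr M (PiM {..<l} (\<lambda>_. borel)) (\<lambda>\<omega>. \<lambda>k\<in>{..<l}. Z (j * l + k) \<omega>) =
    PiM {..<l} (\<lambda>k. distr M borel (Z (j * l + k)))"
    using l by (subst (asm) indep_vars_iff_distr_eq_PiM') (auto simp: lessThan_empty_iff)
  also have "\<dots> = gaussian_product l" unfolding law1 ..
  also have "(\<lambda>\<omega>. \<lambda>k\<in>{..<l}. Z (j * l + k) \<omega>) = (\<lambda>\<omega>. \<lambda>k\<in>{..<l}. block l j \<omega> k)"
    by (auto simp: block_def fun_eq_iff)
  finally show ?thesis .
qed

text \<open>Pythagoras, with the part of \<open>X\<close> outside the chosen coordinates written as
  a difference, so that no series expansion of \<open>X\<close> is involved.\<close>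

lemma norm_X_diff_sq:
  assumes "finite I"
  shows "(norm (X \<omega> - (\<Sum>i\<in>I. c i *\<^sub>R v i)))\<^sup>2 = (norm (X \<omega>))\<^sup>2 - (\<Sum>i\<in>I. (X \<omega> \<bullet> v i)\<^sup>2) + (\<Sum>i\<in>I. (X \<omega> \<bullet> v i - c i)\<^sup>2)"
proof -
  let ?y = "\<Sum>i\<in>I. c i *\<^sub>R v i"
  have "(norm (X \<omega> - ?y))\<^sup>2 = (norm (X \<omega>))\<^sup>2 - 2 * (X \<omega> \<bullet> ?y) + (norm ?y)\<^sup>2"
    by (simp add: power2_norm_eq_inner inner_diff_left inner_diff_right inner_commute)
  also have "(norm ?y)\<^sup>2 = (\<Sum>i\<in>I. (c i)\<^sup>2)" by (rule orthonormal_seq_norm_sum[OF v assms])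
  also have "X \<omega> \<bullet> ?y = (\<Sum>i\<in>I. c i * (X \<omega> \<bullet> v i))" by (simp add: inner_sum_right)
  finally show ?thesis
    by (simp add: power2_diff sum.distrib sum_subtractf sum_distrib_left mult_ac)
qed


text \<open>Orthogonality makes the block errors add up, and replacing all eigenvalues of a block by
  the leading one produces the error of the whole block vector. The second conclusion holds because
  \<open>Xhat\<close> takes its values among at most n points, one for each tuple of
  codewords.\<close>

lemma block_sum_quantization:
  fixes \<alpha> :: "nat \<Rightarrow> (nat \<Rightarrow> real) set" and Zh :: "nat \<Rightarrow> 'w \<Rightarrow> nat \<Rightarrow> real"
  assumes l: "l \<ge> 1" and dec: "\<And>i. L (Suc i) \<le> L i"
    and \<alpha>: "\<And>j. j < m \<Longrightarrow> finite (\<alpha> j)"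
    and Zh: "\<And>j \<omega>. j < m \<Longrightarrow> \<omega> \<in> space M \<Longrightarrow> Zh j \<omega> \<in> \<alpha> j"
    and Zhm: "\<And>j k. j < m \<Longrightarrow> (\<lambda>\<omega>. Zh j \<omega> k) \<in> borel_measurable M"
    and n: "(\<Prod>j<m. card (\<alpha> j)) \<le> n"
  defines "Xhat \<equiv> \<lambda>\<omega>. \<Sum>i<m * l. (sqrt (L i) * Zh (i div l) \<omega> (i mod l)) *\<^sub>R v i"
  shows "expectation (\<lambda>\<omega>. (norm (X \<omega> - Xhat \<omega>))\<^sup>2) \<le> (suminf L - (\<Sum>i<m * l. L i)) +
      (\<Sum>j<m. L (j * l) * expectation (\<lambda>\<omega>. sq_dist l (block l j \<omega>) (Zh j \<omega>)))"
    and "quant_number M UNIV dist X n \<le> sqrt (expectation (\<lambda>\<omega>. (norm (X \<omega> - Xhat \<omega>))\<^sup>2))"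
proof -
  define c where "c i \<omega> = sqrt (L i) * Zh (i div l) \<omega> (i mod l)" for i \<omega>
  have Xhat: "Xhat \<omega> = (\<Sum>i<m * l. c i \<omega> *\<^sub>R v i)" for \<omega> by (simp add: Xhat_def c_def)
  have il: "i div l < m" if "i < m * l" for i using that by (simp add: less_mult_imp_div_less)
  have cm: "c i \<in> borel_measurable M" if "i < m * l" for i
    unfolding c_def using Zhm[OF il[OF that]] by (intro borel_measurable_times) auto
  have zint: "integrable M (\<lambda>\<omega>. (Z (j * l + k) \<omega> - Zh j \<omega> k)\<^sup>2)" if j: "j < m" for j k
  proof (rule Bochner_Integration.integrable_bound)
    \<comment> \<open>The quantizer takes finitely many values, so its k-th coordinate is
      bounded.\<close>
    define K where "K = Max (insert 0 ((\<lambda>a. (a k)\<^sup>2) ` \<alpha> j))"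
    have iz: "integrable M (\<lambda>\<omega>. (Z i \<omega>)\<^sup>2)" for i
      using coord_sq_integrable[of i] unfolding Z_def by (simp add: power_divide)
    then show "integrable M (\<lambda>\<omega>. 2 * (Z (j * l + k) \<omega>)\<^sup>2 + 2 * K)" by simp
    show "(\<lambda>\<omega>. (Z (j * l + k) \<omega> - Zh j \<omega> k)\<^sup>2) \<in> borel_measurable M"
      using Zhm[OF j] by (intro borel_measurable_power borel_measurable_diff) auto
    show "AE \<omega> in M. norm ((Z (j * l + k) \<omega> - Zh j \<omega> k)\<^sup>2) \<le> norm (2 * (Z (j * l + k) \<omega>)\<^sup>2 + 2 * K)"
    proof (rule AE_I2)
      fix \<omega> assume \<omega>: "\<omega> \<in> space M"
      have "(Zh j \<omega> k)\<^sup>2 \<le> K" unfolding K_def using \<alpha>[OF j] Zh[OF j \<omega>] by (intro Max_ge) auto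
      moreover have "(x - y)\<^sup>2 \<le> 2 * x\<^sup>2 + 2 * y\<^sup>2" for x y :: real
        using sum_squares_ge_zero[of "x + y" 0] by (simp add: power2_eq_square algebra_simps)
      ultimately have "(Z (j * l + k) \<omega> - Zh j \<omega> k)\<^sup>2 \<le> 2 * (Z (j * l + k) \<omega>)\<^sup>2 + 2 * K"
        by (smt (verit))
      then show "norm ((Z (j * l + k) \<omega> - Zh j \<omega> k)\<^sup>2) \<le> norm (2 * (Z (j * l + k) \<omega>)\<^sup>2 + 2 * K)"
        by simp
    qed
  qed
  have ceq: "(X \<omega> \<bullet> v (j * l + k) - c (j * l + k) \<omega>)\<^sup>2 = L (j * l + k) * (Z (j * l + k) \<omega> - Zh j \<omega> k)\<^sup>2"
    if "k < l" for j k \<omega>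
  proof -
    have "X \<omega> \<bullet> v (j * l + k) - c (j * l + k) \<omega> = sqrt (L (j * l + k)) * (Z (j * l + k) \<omega> - Zh j \<omega> k)"
      using that by (simp add: c_def coord_eq_Z right_diff_distrib)
    then show ?thesis using L_pos[of "j * l + k"] by (simp add: power_mult_distrib)
  qed
  have cint: "integrable M (\<lambda>\<omega>. (X \<omega> \<bullet> v i - c i \<omega>)\<^sup>2)" if "i < m * l" for i
  proof -
    have "i mod l < l" using l by simp
    then show ?thesis
      using zint[OF il[OF that], of "i mod l"] ceq[of "i mod l" _ "i div l"] by simp
  qed
  have nsq: "(norm (X \<omega> - Xhat \<omega>))\<^sup>2 = (norm (X \<omega>))\<^sup>2 - (\<Sum>i<m * l. (X \<omega> \<bullet> v i)\<^sup>2) + (\<Sum>i<m * l. (X \<omega> \<bullet> v i - c i \<omega>)\<^sup>2)" for \<omega>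
    unfolding Xhat by (rule norm_X_diff_sq) simp
  have i1: "integrable M (\<lambda>\<omega>. \<Sum>i<m * l. (X \<omega> \<bullet> v i)\<^sup>2)"
    by (intro Bochner_Integration.integrable_sum coord_sq_integrable)
  have i2: "integrable M (\<lambda>\<omega>. \<Sum>i<m * l. (X \<omega> \<bullet> v i - c i \<omega>)\<^sup>2)"
    by (intro Bochner_Integration.integrable_sum cint) simp
  have Uint: "integrable M (\<lambda>\<omega>. (norm (X \<omega> - Xhat \<omega>))\<^sup>2)"
    unfolding nsq
    by (intro Bochner_Integration.integrable_add Bochner_Integration.integrable_diff norm_X_sq_integrable i1 i2)
  have E: "expectation (\<lambda>\<omega>. (norm (X \<omega> - Xhat \<omega>))\<^sup>2) =
    suminf L - (\<Sum>i<m * l. L i) + (\<Sum>i<m * l. expectation (\<lambda>\<omega>. (X \<omega> \<bullet> v i - c i \<omega>)\<^sup>2))"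
  proof -
    have "expectation (\<lambda>\<omega>. (norm (X \<omega> - Xhat \<omega>))\<^sup>2) = expectation (\<lambda>\<omega>. (norm (X \<omega>))\<^sup>2)
       - expectation (\<lambda>\<omega>. \<Sum>i<m * l. (X \<omega> \<bullet> v i)\<^sup>2) + expectation (\<lambda>\<omega>. \<Sum>i<m * l. (X \<omega> \<bullet> v i - c i \<omega>)\<^sup>2)"
      unfolding nsq
      by (subst Bochner_Integration.integral_add[OF Bochner_Integration.integrable_diff[OF norm_X_sq_integrable i1] i2],
          subst Bochner_Integration.integral_diff[OF norm_X_sq_integrable i1]) (rule refl)
    also have "expectation (\<lambda>\<omega>. (norm (X \<omega>))\<^sup>2) = suminf L" using L_sums by (simp add: sums_iff)
    also have "expectation (\<lambda>\<omega>. \<Sum>i<m * l. (X \<omega> \<bullet> v i)\<^sup>2) = (\<Sum>i<m * l. L i)"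
      by (subst Bochner_Integration.integral_sum[OF coord_sq_integrable]) (simp add: coord_variance)
    also have "expectation (\<lambda>\<omega>. \<Sum>i<m * l. (X \<omega> \<bullet> v i - c i \<omega>)\<^sup>2) = (\<Sum>i<m * l. expectation (\<lambda>\<omega>. (X \<omega> \<bullet> v i - c i \<omega>)\<^sup>2))"
      by (rule Bochner_Integration.integral_sum) (simp add: cint)
    finally show ?thesis .
  qed
  have "(\<Sum>i<m * l. expectation (\<lambda>\<omega>. (X \<omega> \<bullet> v i - c i \<omega>)\<^sup>2)) =
     (\<Sum>j<m. \<Sum>i\<in>{j * l..<j * l + l}. expectation (\<lambda>\<omega>. (X \<omega> \<bullet> v i - c i \<omega>)\<^sup>2))"
    by (rule sum.nat_group[symmetric])
  also have "\<dots> = (\<Sum>j<m. \<Sum>k<l. L (j * l + k) * expectation (\<lambda>\<omega>. (Z (j * l + k) \<omega> - Zh j \<omega> k)\<^sup>2))"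
  proof (rule sum.cong[OF refl])
    fix j
    have "(\<Sum>i\<in>{j * l..<j * l + l}. expectation (\<lambda>\<omega>. (X \<omega> \<bullet> v i - c i \<omega>)\<^sup>2)) =
       (\<Sum>k<l. expectation (\<lambda>\<omega>. (X \<omega> \<bullet> v (j * l + k) - c (j * l + k) \<omega>)\<^sup>2))"
      by (rule sum.reindex_bij_witness[of _ "\<lambda>k. j * l + k" "\<lambda>i. i - j * l"]) auto
    also have "\<dots> = (\<Sum>k<l. L (j * l + k) * expectation (\<lambda>\<omega>. (Z (j * l + k) \<omega> - Zh j \<omega> k)\<^sup>2))"
      by (rule sum.cong) (simp_all add: ceq)
    finally show "(\<Sum>i\<in>{j * l..<j * l + l}. expectation (\<lambda>\<omega>. (X \<omega> \<bullet> v i - c i \<omega>)\<^sup>2)) =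
      (\<Sum>k<l. L (j * l + k) * expectation (\<lambda>\<omega>. (Z (j * l + k) \<omega> - Zh j \<omega> k)\<^sup>2))" .
  qed
  also have "\<dots> \<le> (\<Sum>j<m. L (j * l) * expectation (\<lambda>\<omega>. sq_dist l (block l j \<omega>) (Zh j \<omega>)))"
  proof (rule sum_mono)
    fix j assume j: "j \<in> {..<m}"
    have anti: "L (j * l + k) \<le> L (j * l)" for k
      by (rule lift_Suc_antimono_le[of L]) (use dec in auto)
    have "(\<Sum>k<l. L (j * l + k) * expectation (\<lambda>\<omega>. (Z (j * l + k) \<omega> - Zh j \<omega> k)\<^sup>2)) \<le>
      (\<Sum>k<l. L (j * l) * expectation (\<lambda>\<omega>. (Z (j * l + k) \<omega> - Zh j \<omega> k)\<^sup>2))"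
      by (intro sum_mono mult_right_mono anti Bochner_Integration.integral_nonneg) simp
    also have "\<dots> = L (j * l) * expectation (\<lambda>\<omega>. \<Sum>k<l. (Z (j * l + k) \<omega> - Zh j \<omega> k)\<^sup>2)"
      using j by (subst Bochner_Integration.integral_sum[OF zint]) (auto simp: sum_distrib_left)
    also have "(\<lambda>\<omega>. \<Sum>k<l. (Z (j * l + k) \<omega> - Zh j \<omega> k)\<^sup>2) = (\<lambda>\<omega>. sq_dist l (block l j \<omega>) (Zh j \<omega>))"
      by (intro ext sum.cong) (auto simp: block_def)
    finally show "(\<Sum>k<l. L (j * l + k) * expectation (\<lambda>\<omega>. (Z (j * l + k) \<omega> - Zh j \<omega> k)\<^sup>2)) \<le>
       L (j * l) * expectation (\<lambda>\<omega>. sq_dist l (block l j \<omega>) (Zh j \<omega>))" .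
  qed
  finally show "expectation (\<lambda>\<omega>. (norm (X \<omega> - Xhat \<omega>))\<^sup>2) \<le> (suminf L - (\<Sum>i<m * l. L i)) +
      (\<Sum>j<m. L (j * l) * expectation (\<lambda>\<omega>. sq_dist l (block l j \<omega>) (Zh j \<omega>)))"
    unfolding E by (rule add_left_mono)
  define G where "G a = (\<Sum>i<m * l. (sqrt (L i) * a (i div l) (i mod l)) *\<^sub>R v i)" for a :: "nat \<Rightarrow> nat \<Rightarrow> real"
  define A where "A = G ` PiE {..<m} \<alpha>"
  have finP: "finite (PiE {..<m} \<alpha>)" using \<alpha> by (intro finite_PiE) auto
  then have finA: "finite A" by (simp add: A_def)
  have "card A \<le> card (PiE {..<m} \<alpha>)" unfolding A_def by (rule card_image_le[OF finP])
  also have "\<dots> \<le> n" using n by (simp add: card_PiE)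
  finally have cA: "card A \<le> n" .
  have XA: "Xhat \<omega> \<in> A" if "\<omega> \<in> space M" for \<omega>
  proof -
    have "Xhat \<omega> = G (\<lambda>j\<in>{..<m}. Zh j \<omega>)"
      unfolding Xhat_def G_def using il by (intro sum.cong) auto
    moreover have "(\<lambda>j\<in>{..<m}. Zh j \<omega>) \<in> PiE {..<m} \<alpha>" using Zh that by auto
    ultimately show ?thesis unfolding A_def by blast
  qed
  have neA: "A \<noteq> {}" using XA not_empty by blast
  have "quant_number M UNIV dist X n \<le> quant_err M dist X A"
    by (rule quant_number_le) (use finA neA cA in auto)
  also have "\<dots> \<le> sqrt (expectation (\<lambda>\<omega>. (norm (X \<omega> - Xhat \<omega>))\<^sup>2))"
    unfolding quant_err_def
  proof (rule real_sqrt_le_mono, rule integral_mono[OF Min_dist_sq_integrable[OF finA neA] Uint])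
    fix \<omega> assume \<omega>: "\<omega> \<in> space M"
    have "0 \<le> Min ((\<lambda>a. dist (X \<omega>) a) ` A)" using finA neA by (subst Min_ge_iff) auto
    moreover have "Min ((\<lambda>a. dist (X \<omega>) a) ` A) \<le> dist (X \<omega>) (Xhat \<omega>)"
      using finA XA[OF \<omega>] by (intro Min_le) auto
    ultimately show "min_dist_sq A \<omega> \<le> (norm (X \<omega> - Xhat \<omega>))\<^sup>2"
      by (intro power_mono) (auto simp: dist_norm)
  qed
  finally show "quant_number M UNIV dist X n \<le> sqrt (expectation (\<lambda>\<omega>. (norm (X \<omega> - Xhat \<omega>))\<^sup>2))" .
qed

end

subsection \<open>Block parameters\<close>

text \<open>The defining expression is the power l/2 of an eigenvalue divided by a level; for m
  blocks the level is n^(-2/(m l)) times the geometric mean of the leading eigenvalues.\<close>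

lemma block_expression_exp:
  fixes lam :: "nat \<Rightarrow> real"
  assumes n: "n \<ge> 1" and l: "l \<ge> 1" and m: "m \<ge> 1" and pos: "\<And>i. i \<ge> 1 \<Longrightarrow> lam i > 0"
  shows "real n powr (1 / real m) * lam ((j - 1) * l + 1) powr (real l / 2) *
      (\<Prod>i=1..m. lam ((i - 1) * l + 1)) powr (- (real l / (2 * real m))) =
    exp (real l / 2 * (ln (lam ((j - 1) * l + 1)) - ((\<Sum>i<m. ln (lam (i * l + 1))) - 2 * ln n / l) / m))"
proof -
  have P: "(\<Prod>i=1..m. lam ((i - 1) * l + 1)) = (\<Prod>i<m. lam (i * l + 1))"
    by (rule prod.reindex_bij_witness[of _ Suc "\<lambda>i. i - 1"]) auto
  have pos': "lam (i * l + 1) > 0" for i by (rule pos) simp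
  have nz: "lam (Suc (i * l)) \<noteq> 0" for i using pos[of "Suc (i * l)"] by simp
  have Ppos: "(\<Prod>i<m. lam (i * l + 1)) > 0" by (intro prod_pos) (auto intro: pos)
  have lnP: "ln (\<Prod>i<m. lam (i * l + 1)) = (\<Sum>i<m. ln (lam (i * l + 1)))"
    using pos' by (intro ln_prod) (auto simp: less_imp_neq[symmetric])
  have q: "lam ((j - 1) * l + 1) > 0" by (rule pos) simp
  have "real n powr (1 / real m) * lam ((j - 1) * l + 1) powr (real l / 2) *
      (\<Prod>i<m. lam (i * l + 1)) powr (- (real l / (2 * real m))) =
    exp (ln n / m + real l / 2 * ln (lam ((j - 1) * l + 1)) - real l / (2 * m) * (\<Sum>i<m. ln (lam (i * l + 1))))"
    using n q Ppos unfolding powr_def lnP by (simp add: nz mult_exp_exp algebra_simps)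
  also have "ln n / m + real l / 2 * ln (lam ((j - 1) * l + 1)) - real l / (2 * m) * (\<Sum>i<m. ln (lam (i * l + 1)))
    = real l / 2 * (ln (lam ((j - 1) * l + 1)) - ((\<Sum>i<m. ln (lam (i * l + 1))) - 2 * ln n / l) / m)"
    using l m by (simp add: field_simps)
  finally show ?thesis unfolding P .
qed

lemma half_le_nat_floor:
  fixes x :: real
  assumes "x \<ge> 1"
  shows "x / 2 \<le> real (nat \<lfloor>x\<rfloor>)"
proof -
  have "\<lfloor>x\<rfloor> \<ge> 1" using assms by simp
  then have "real (nat \<lfloor>x\<rfloor>) = of_int \<lfloor>x\<rfloor>" by simp
  then show ?thesis using \<open>\<lfloor>x\<rfloor> \<ge> 1\<close> by linarith
qed

text \<open>Let a j be the logarithms of the leading eigenvalues and M k that of the level for k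
  blocks. The set in \<open>blockNum\<close> consists of the k with
  \<open>M k \<le> a (k - 1)\<close>. As M (m + 1) is a weighted mean of M m and a m, the exclusion
  of m + 1 means a m < M m: the level \<mu> = exp (M m) lies above the next block. The logarithmic
  sum is the definition of M.\<close>

lemma block_parameters:
  fixes lam :: "nat \<Rightarrow> real" and n l :: nat
  assumes n: "n \<ge> 1" and l: "l \<ge> 1" and pos: "\<And>i. i \<ge> 1 \<Longrightarrow> lam i > 0"
    and dec: "\<And>i. i \<ge> 1 \<Longrightarrow> lam (Suc i) \<le> lam i" and lim: "lam \<longlonglongrightarrow> 0"
  defines "m \<equiv> blockNum lam n l"
  obtains \<mu> where "\<mu> > 0" "m \<ge> 1" "\<And>j. j < m \<Longrightarrow> \<mu> \<le> lam (j * l + 1)" "lam (m * l + 1) < \<mu>"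
    "(\<Sum>j<m. ln (lam (j * l + 1) / \<mu>)) = 2 * ln n / l"
    "\<And>j. j < m \<Longrightarrow> blockSize lam n l m (Suc j) \<ge> 1"
    "\<And>j. j < m \<Longrightarrow> real (blockSize lam n l m (Suc j)) powr (- 2 / l) \<le> 4 powr (1 / l) * (\<mu> / lam (j * l + 1))"
    "(\<Prod>j<m. blockSize lam n l m (Suc j)) \<le> n"
proof -
  define a where "a j = ln (lam (j * l + 1))" for j
  define T where "T = 2 * ln n / l"
  define M where "M k = ((\<Sum>i<k. a i) - T) / real k" for k :: nat
  have T0: "T \<ge> 0" using n by (simp add: T_def)
  have anti: "lam j \<le> lam i" if "1 \<le> i" "i \<le> j" for i j
    using that(2) by (induction j rule: dec_induct) (use dec that(1) in \<open>auto intro: order_trans\<close>)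
  have a_anti: "a j \<le> a i" if "i \<le> j" for i j
    unfolding a_def using that by (subst ln_le_cancel_iff) (auto intro!: pos anti)
  have expr: "real n powr (1 / real k) * lam ((j - 1) * l + 1) powr (real l / 2) *
      (\<Prod>i=1..k. lam ((i - 1) * l + 1)) powr (- (real l / (2 * real k))) = exp (real l / 2 * (a (j - 1) - M k))"
    if "k \<ge> 1" for k j
    using block_expression_exp[of n l k lam j] n l that pos unfolding a_def M_def T_def by simp
  define K where "K = {k. k \<ge> 1 \<and> M k \<le> a (k - 1)}"
  have K: "{k. k \<ge> 1 \<and> real n powr (1 / real k) * lam ((k - 1) * l + 1) powr (real l / 2) *
      (\<Prod>j=1..k. lam ((j - 1) * l + 1)) powr (- (real l / (2 * real k))) \<ge> 1} = K"
    unfolding K_def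
  proof (intro Collect_cong conj_cong refl)
    fix k :: nat assume k: "1 \<le> k"
    show "(1 \<le> real n powr (1 / real k) * lam ((k - 1) * l + 1) powr (real l / 2) *
      (\<Prod>j=1..k. lam ((j - 1) * l + 1)) powr (- (real l / (2 * real k)))) = (M k \<le> a (k - 1))"
      unfolding expr[OF k] using l by (simp add: zero_le_mult_iff)
  qed
  have mK: "m = Max K" unfolding m_def blockNum_def K ..
  have K1: "1 \<in> K" using T0 by (simp add: K_def M_def)
  \<comment> \<open>Bounding all summands but the first below by the last one turns membership into
    a lower bound independent of \<open>k\<close>. As \<open>lam\<close> tends to 0, the set is
    finite, which \<open>Max\<close> requires.\<close>
  have lamK: "lam ((k - 1) * l + 1) \<ge> exp (a 0 - T)" if "k \<in> K" for k
  proof -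
    have k: "k \<ge> 1" "M k \<le> a (k - 1)" using that by (auto simp: K_def)
    have "(\<Sum>i<k. a i) - T \<le> k * a (k - 1)" using k by (simp add: M_def field_simps)
    moreover have "(\<Sum>i<k. a i) \<ge> a 0 + (\<Sum>i\<in>{..<k} - {0}. a (k - 1))"
    proof -
      have "(\<Sum>i<k. a i) = a 0 + (\<Sum>i\<in>{..<k} - {0}. a i)" using k by (intro sum.remove) auto
      also have "\<dots> \<ge> a 0 + (\<Sum>i\<in>{..<k} - {0}. a (k - 1))" by (intro add_left_mono sum_mono a_anti) auto
      finally show ?thesis .
    qed
    moreover have "(\<Sum>i\<in>{..<k} - {0}. a (k - 1)) = (real k - 1) * a (k - 1)" using k by (simp add: of_nat_diff)
    ultimately have "a 0 - T \<le> a (k - 1)" by (simp add: algebra_simps)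
    then have "exp (a 0 - T) \<le> exp (a (k - 1))" by simp
    also have "\<dots> = lam ((k - 1) * l + 1)" unfolding a_def by (rule exp_ln) (rule pos, simp)
    finally show ?thesis .
  qed
  have "\<forall>\<^sub>F i in sequentially. lam i < exp (a 0 - T)"
    by (rule order_tendstoD[OF lim]) simp
  then obtain i0 where i0: "\<And>i. i \<ge> i0 \<Longrightarrow> lam i < exp (a 0 - T)" unfolding eventually_sequentially by blast
  have "k \<le> Suc i0" if "k \<in> K" for k
  proof (rule ccontr)
    assume "\<not> k \<le> Suc i0"
    moreover have "k - 1 \<le> (k - 1) * l" using l by simp
    ultimately have "(k - 1) * l + 1 \<ge> i0" by linarith
    then show False using i0 lamK[OF that] by fastforce
  qed
  then have finK: "finite K" using finite_nat_set_iff_bounded_le by blast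
  have "m \<in> K" unfolding mK using finK K1 by (intro Max_in) auto
  then have m: "m \<ge> 1" "M m \<le> a (m - 1)" by (auto simp: K_def)
  have "Suc m \<notin> K"
  proof
    assume "Suc m \<in> K"
    then have "Suc m \<le> m" unfolding mK using finK by (rule Max_ge[rotated])
    then show False by simp
  qed
  then have "a m < M (Suc m)" by (auto simp: K_def)
  then have "real (Suc m) * a m < (\<Sum>i<Suc m. a i) - T" by (simp add: M_def field_simps)
  then have "real m * a m < (\<Sum>i<m. a i) - T" by (simp add: algebra_simps)
  then have am: "a m < M m" using m by (simp add: M_def field_simps)
  define \<mu> where "\<mu> = exp (M m)"
  have \<mu>: "\<mu> > 0" by (simp add: \<mu>_def)
  have la: "lam (j * l + 1) = exp (a j)" for j unfolding a_def by (rule exp_ln[symmetric]) (rule pos, simp)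
  have lr: "ln (lam (j * l + 1) / \<mu>) = a j - M m" for j
    unfolding la \<mu>_def by (simp flip: exp_diff)
  have sz: "blockSize lam n l m (Suc j) = nat \<lfloor>exp (real l / 2 * (a j - M m))\<rfloor>" for j
    unfolding blockSize_def expr[OF m(1)] by simp
  have Mj: "M m \<le> a j" if "j < m" for j
    using that by (intro order_trans[OF m(2)] a_anti) simp
  have e1: "exp (real l / 2 * (a j - M m)) \<ge> 1" if "j < m" for j
    using Mj[OF that] by simp
  have s1: "blockSize lam n l m (Suc j) \<ge> 1" if "j < m" for j
    using e1[OF that] unfolding sz by (simp add: le_nat_floor)
  have s2: "real (blockSize lam n l m (Suc j)) \<le> exp (real l / 2 * (a j - M m))" for j
    unfolding sz by (simp add: of_nat_floor)
  have s3: "exp (real l / 2 * (a j - M m)) / 2 \<le> real (blockSize lam n l m (Suc j))" if "j < m" for j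
    unfolding sz by (rule half_le_nat_floor[OF e1[OF that]])
  have sumM: "(\<Sum>j<m. a j - M m) = T" using m by (simp add: sum_subtractf M_def)
  show ?thesis
  proof (rule that[OF \<mu> m(1)])
    show "\<mu> \<le> lam (j * l + 1)" if "j < m" for j
      unfolding la \<mu>_def using Mj[OF that] by simp
    show "lam (m * l + 1) < \<mu>" unfolding la \<mu>_def using am by simp
    show "(\<Sum>j<m. ln (lam (j * l + 1) / \<mu>)) = 2 * ln n / l"
      unfolding lr sumM by (simp add: T_def)
    show "blockSize lam n l m (Suc j) \<ge> 1" if "j < m" for j by (rule s1[OF that])
    show "real (blockSize lam n l m (Suc j)) powr (- 2 / l) \<le> 4 powr (1 / l) * (\<mu> / lam (j * l + 1))" if "j < m" for j
    proof -
      \<comment> \<open>The integer part of a number that is at least 1 is at least half of it;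
        under the power -2/l the factor 2 becomes 4^(1/l).\<close>
      have "real (blockSize lam n l m (Suc j)) powr (- 2 / l) \<le> (exp (real l / 2 * (a j - M m)) / 2) powr (- 2 / l)"
        using s3[OF that] l by (intro powr_mono2') auto
      also have "\<dots> = exp (real l / 2 * (a j - M m)) powr (- 2 / l) / 2 powr (- 2 / l)"
        by (simp add: powr_divide)
      also have "exp (real l / 2 * (a j - M m)) powr (- 2 / l) = exp (M m - a j)"
        using l by (simp add: powr_def field_simps)
      also have "exp (M m - a j) = \<mu> / lam (j * l + 1)" unfolding la \<mu>_def by (simp add: exp_diff)
      also have "\<mu> / lam (j * l + 1) / 2 powr (- 2 / l) = 4 powr (1 / l) * (\<mu> / lam (j * l + 1))"
      proof -
        have "(4::real) powr (1 / l) = (2 powr 2) powr (1 / l)" by simp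
        also have "\<dots> = 2 powr (2 / l)" by (simp only: powr_powr) simp
        finally show ?thesis by (simp add: powr_minus divide_inverse)
      qed
      finally show ?thesis .
    qed
    have "real (\<Prod>j<m. blockSize lam n l m (Suc j)) \<le> (\<Prod>j<m. exp (real l / 2 * (a j - M m)))"
      unfolding of_nat_prod by (intro prod_mono conjI s2) simp
    also have "\<dots> = exp (real l / 2 * (\<Sum>j<m. a j - M m))" by (simp add: exp_sum sum_distrib_left)
    also have "\<dots> = n" unfolding sumM T_def using l n by simp
    finally show "(\<Prod>j<m. blockSize lam n l m (Suc j)) \<le> n" by (simp only: of_nat_le_iff)
  qed
qed

section \<open>Growth of the number of blocks\<close>

text \<open>Regular variation at t = 2 keeps lam (2 j) / lam j above 2^(-(b + 1)) from some J on.
  Iteration gives the power law along J 2^i, and monotonicity carries it to all j. The exponent b +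
  1 instead of b leaves room for slowly varying factors.\<close>

lemma regularly_varying_polynomial_lower_bound:
  fixes lam :: "nat \<Rightarrow> real"
  assumes pos: "\<And>i. i \<ge> 1 \<Longrightarrow> lam i > 0" and dec: "\<And>i. i \<ge> 1 \<Longrightarrow> lam (Suc i) \<le> lam i"
    and b: "b \<ge> 0" and rv: "reg_varying s \<phi> (- b)" and eq: "lam \<sim>[sequentially] (\<lambda>j. \<phi> (real j))"
  obtains c where "c > 0" "\<And>j. j \<ge> 1 \<Longrightarrow> lam j \<ge> c * real j powr (- (b + 1))"
proof -
  have anti: "lam j \<le> lam i" if "1 \<le> i" "i \<le> j" for i j
    using that(2) by (induction j rule: dec_induct) (use dec that(1) in \<open>auto intro: order_trans\<close>)
  have "((\<lambda>x. \<phi> (2 * x) / \<phi> x) \<longlongrightarrow> 2 powr (- b)) at_top" using rv by (simp add: reg_varying_def)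
  then have r1: "((\<lambda>j. \<phi> (2 * real j) / \<phi> (real j)) \<longlongrightarrow> 2 powr (- b)) sequentially"
    by (rule filterlim_compose[OF _ filterlim_real_sequentially])
  have "filterlim (\<lambda>j::nat. 2 * j) sequentially sequentially" by real_asymp
  then have "(\<lambda>j. lam (2 * j)) \<sim>[sequentially] (\<lambda>j. \<phi> (real (2 * j)))"
    by (rule asymp_equiv_compose'[OF eq])
  then have "(\<lambda>j. lam (2 * j) / lam j) \<sim>[sequentially] (\<lambda>j. \<phi> (real (2 * j)) / \<phi> (real j))"
    by (rule asymp_equiv_divide[OF _ eq])
  then have "((\<lambda>j. lam (2 * j) / lam j) \<longlongrightarrow> 2 powr (- b)) sequentially"
    using r1 by (simp add: tendsto_asymp_equiv_cong)
  moreover have "(2::real) powr (- (b + 1)) < 2 powr (- b)" by simp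
  ultimately have "\<forall>\<^sub>F j in sequentially. 2 powr (- (b + 1)) < lam (2 * j) / lam j"
    by (rule order_tendstoD)
  then obtain J0 where J0: "\<And>j. j \<ge> J0 \<Longrightarrow> 2 powr (- (b + 1)) < lam (2 * j) / lam j"
    unfolding eventually_sequentially by blast
  define J where "J = max 1 J0"
  define q :: real where "q = 2 powr (- (b + 1))"
  have q: "q > 0" by (simp add: q_def)
  have iter: "lam (J * 2 ^ i) \<ge> q ^ i * lam J" for i
  proof (induction i)
    case (Suc i)
    have "J * 1 \<le> J * 2 ^ i" by (intro mult_left_mono) auto
    then have J1: "J * 2 ^ i \<ge> J0" "J * 2 ^ i \<ge> 1" unfolding J_def by linarith+
    have "q ^ Suc i * lam J \<le> q * lam (J * 2 ^ i)" using Suc q by (simp add: mult.assoc)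
    also have "\<dots> \<le> lam (2 * (J * 2 ^ i))"
      using J0[OF J1(1)] pos[OF J1(2)] by (simp add: q_def field_simps)
    finally show ?case by (simp add: mult_ac)
  qed simp
  have "lam J > 0" by (rule pos) (simp add: J_def)
  show ?thesis
  proof (rule that[of "lam J * 2 powr (- (b + 1))"])
    show "lam J * 2 powr (- (b + 1)) > 0" using \<open>lam J > 0\<close> by simp
    fix j :: nat assume j: "j \<ge> 1"
    obtain i where i: "2 ^ i \<le> j" "j < 2 ^ (i + 1)" using ex_power_ivl1[of 2 j] j by auto
    have "2 ^ (i + 1) * 1 \<le> 2 ^ (i + 1) * J" by (intro mult_left_mono) (auto simp: J_def)
    then have "j \<le> J * 2 ^ (i + 1)" using i(2) by (metis le_trans less_imp_le mult.commute mult_1_right)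
    then have 1: "lam j \<ge> lam (J * 2 ^ (i + 1))" using j by (intro anti)
    have 2: "q ^ (i + 1) = (2 ^ (i + 1)) powr (- (b + 1))"
    proof -
      have "q ^ (i + 1) = q powr real (i + 1)" using q by (rule powr_realpow[symmetric])
      also have "\<dots> = (2 powr real (i + 1)) powr (- (b + 1))" unfolding q_def by (simp only: powr_powr mult.commute)
      also have "2 powr real (i + 1) = (2::real) ^ (i + 1)" by (rule powr_realpow) simp
      finally show ?thesis .
    qed
    have "2 ^ (i + 1) \<le> 2 * real j" using i(1) by (simp flip: of_nat_power)
    then have "(2 * real j) powr (- (b + 1)) \<le> q ^ (i + 1)"
      unfolding 2 using b by (intro powr_mono2') auto
    then have "(2 * real j) powr (- (b + 1)) * lam J \<le> q ^ (i + 1) * lam J"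
      using \<open>lam J > 0\<close> by (intro mult_right_mono) auto
    then show "lam j \<ge> lam J * 2 powr (- (b + 1)) * real j powr (- (b + 1))"
      using 1 iter[of "i + 1"] by (simp add: powr_mult mult_ac)
  qed
qed

text \<open>Bounds ln (m + 1) / m by 2 / sqrt m, which decreases in m, so that a lower bound on the
  number of blocks is enough.\<close>

lemma ln_add_one_le_sqrt:
  fixes x :: real
  assumes "x \<ge> 0"
  shows "ln (x + 1) \<le> 2 * sqrt x"
proof -
  have "ln (x + 1) \<le> ln ((1 + sqrt x)\<^sup>2)"
    using assms by (subst ln_le_cancel_iff) (auto simp: power2_sum intro!: add_pos_nonneg)
  also have "\<dots> = 2 * ln (1 + sqrt x)" using assms by (simp add: ln_realpow add_nonneg_pos)
  also have "\<dots> \<le> 2 * sqrt x" using assms by (intro mult_left_mono ln_add_one_self_le_self) auto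
  finally show ?thesis .
qed

lemma filterlim_ln_real_at_top: "filterlim (\<lambda>n. ln (real n)) at_top sequentially"
  by (rule filterlim_compose[OF ln_at_top filterlim_real_sequentially])

lemma blockLen_at_top:
  assumes "\<theta> > 0"
  shows "filterlim (blockLen \<theta>) at_top sequentially"
  unfolding filterlim_at_top
proof
  fix l0 :: nat
  have "filterlim (\<lambda>y. max 1 y powr \<theta>) at_top at_top" using assms by real_asymp
  then have "\<forall>\<^sub>F y in at_top. real l0 \<le> max 1 y powr \<theta>" by (simp add: filterlim_at_top)
  then have "\<forall>\<^sub>F n in sequentially. real l0 \<le> max 1 (ln (real n)) powr \<theta>"
    by (rule eventually_compose_filterlim[OF _ filterlim_ln_real_at_top])
  then show "\<forall>\<^sub>F n in sequentially. l0 \<le> blockLen \<theta> n"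
    by eventually_elim (simp add: blockLen_def le_nat_floor)
qed

text \<open>A bootstrap, with y = ln n and \<Lambda> the logarithm in question. The m logarithms sum
  to 2 y / l and each is at most \<Lambda>, so m \<Lambda> is at least 2 y^(1 - \<theta>). The power
  law bounds \<Lambda> by a constant plus C (ln (m + 1) + ln (y + 1)). Together these exclude m <
  y^r, and then \<Lambda> / m is at most g y, which tends to 0.\<close>

lemma block_log_ratio_tendsto_0:
  fixes lam :: "nat \<Rightarrow> real" and c C \<theta> :: real
  assumes pos: "\<And>i. i \<ge> 1 \<Longrightarrow> lam i > 0"
    and dec: "\<And>i. i \<ge> 1 \<Longrightarrow> lam (Suc i) \<le> lam i" and lim: "lam \<longlonglongrightarrow> 0"
    and c: "c > 0" and C: "C \<ge> 0" and low: "\<And>j. j \<ge> 1 \<Longrightarrow> lam j \<ge> c * real j powr (- C)"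
    and \<theta>: "0 < \<theta>" "\<theta> < 1"
  defines "l \<equiv> blockLen \<theta>" and "m \<equiv> \<lambda>n. blockNum lam n (blockLen \<theta> n)"
  shows "(\<lambda>n. ln (lam 1 / lam (m n * l n + 1)) / m n) \<longlonglongrightarrow> 0"
proof -
  \<comment> \<open>Half of the available exponent: y^r times a logarithm is of smaller order than
    y^(2 r).\<close>
  define r where "r = (1 - \<theta>) / 2"
  have r: "0 < r" "r \<le> 1" "2 * r = 1 - \<theta>" using \<theta> by (auto simp: r_def)
  define C0 where "C0 = \<bar>ln (lam 1 / c)\<bar>"
  have C0: "C0 \<ge> 0" by (simp add: C0_def)
  define g where "g y = C0 / y powr r + 2 * C / sqrt (y powr r) + C * ln (y + 1) / y powr r" for y :: real
  have anti: "lam j \<le> lam i" if "1 \<le> i" "i \<le> j" for i j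
    using that(2) by (induction j rule: dec_induct) (use dec that(1) in \<open>auto intro: order_trans\<close>)
  have "(g \<longlongrightarrow> 0) at_top" unfolding g_def using r by real_asymp
  then have g0: "(\<lambda>n. g (ln (real n))) \<longlonglongrightarrow> 0" by (rule filterlim_compose[OF _ filterlim_ln_real_at_top])
  have "((\<lambda>y. y powr r * (C0 + 2 * C * ln (y + 1)) / y powr (2 * r)) \<longlongrightarrow> 0) at_top" using r by real_asymp
  then have "\<forall>\<^sub>F y in at_top. y powr r * (C0 + 2 * C * ln (y + 1)) / y powr (2 * r) < 2" by (rule order_tendstoD) simp
  then have ev1: "\<forall>\<^sub>F n in sequentially. ln (real n) powr r * (C0 + 2 * C * ln (ln (real n) + 1)) / ln (real n) powr (2 * r) < 2"
    by (rule eventually_compose_filterlim[OF _ filterlim_ln_real_at_top])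
  have ev2: "\<forall>\<^sub>F n in sequentially. ln (real n) \<ge> 1"
    using filterlim_ln_real_at_top by (simp add: filterlim_at_top)
  have "\<forall>\<^sub>F n in sequentially. 0 \<le> ln (lam 1 / lam (m n * l n + 1)) / m n \<and> ln (lam 1 / lam (m n * l n + 1)) / m n \<le> g (ln (real n))"
    using ev1 ev2 eventually_ge_at_top[of 1]
  proof eventually_elim
    case (elim n)
    define y where "y = ln (real n)"
    have y: "y \<ge> 1" using elim by (simp add: y_def)
    have n: "n \<ge> 1" using elim by simp
    have yth: "y powr \<theta> \<ge> 1" using y \<theta> by (intro ge_one_powr_ge_zero) auto
    have lfl: "l n = nat \<lfloor>y powr \<theta>\<rfloor>" using y by (simp add: l_def blockLen_def y_def max_def)
    have l1: "l n \<ge> 1" using yth unfolding lfl by (simp add: le_nat_floor)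
    have lle: "real (l n) \<le> y powr \<theta>" unfolding lfl by (simp add: of_nat_floor)
    have "y powr \<theta> \<le> y powr 1" using y \<theta> by (intro powr_mono) auto
    then have ly: "real (l n) \<le> y" using lle y by simp
    obtain \<mu> where \<mu>: "\<mu> > 0" "m n \<ge> 1" "\<And>j. j < m n \<Longrightarrow> \<mu> \<le> lam (j * l n + 1)" "lam (m n * l n + 1) < \<mu>"
      "(\<Sum>j<m n. ln (lam (j * l n + 1) / \<mu>)) = 2 * ln n / l n"
      using block_parameters[OF n l1 pos dec lim] unfolding m_def l_def by metis
    define \<Lambda> where "\<Lambda> = ln (lam 1 / lam (m n * l n + 1))"
    have p1: "lam 1 > 0" "lam (m n * l n + 1) > 0" by (auto intro: pos)
    have \<Lambda>0: "\<Lambda> \<ge> 0" unfolding \<Lambda>_def using p1 anti[of 1 "m n * l n + 1"] by simp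
    have "2 * y / l n \<le> (\<Sum>j<m n. \<Lambda>)"
      unfolding y_def \<mu>(5)[symmetric]
    proof (rule sum_mono)
      fix j
      have pj: "lam (j * l n + 1) > 0" by (rule pos) simp
      have "lam (j * l n + 1) / \<mu> \<le> lam 1 / lam (m n * l n + 1)"
        using \<mu>(1,4) p1 pj by (intro frac_le anti) auto
      then show "ln (lam (j * l n + 1) / \<mu>) \<le> \<Lambda>"
        unfolding \<Lambda>_def using pj \<mu>(1) p1 by (subst ln_le_cancel_iff) auto
    qed
    then have m\<Lambda>: "2 * y / l n \<le> m n * \<Lambda>" by simp
    have "2 * y powr (2 * r) \<le> 2 * y / l n"
    proof -
      have "y powr (2 * r) = y / y powr \<theta>" using y unfolding r(3) by (simp add: powr_diff)
      also have "\<dots> \<le> y / l n" using lle l1 y by (intro divide_left_mono) auto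
      finally show ?thesis by simp
    qed
    with m\<Lambda> have big: "2 * y powr (2 * r) \<le> m n * \<Lambda>" by linarith
    have \<Lambda>le: "\<Lambda> \<le> C0 + C * ln (real (m n) + 1) + C * ln (y + 1)"
    proof -
      define q where "q = m n * l n + 1"
      have "q \<ge> 1" by (simp add: q_def)
      then have q: "q \<ge> 1" "real q > 0" by auto
      have "lam 1 / lam q \<le> lam 1 / (c * real q powr (- C))"
        using low[OF q(1)] c q p1 by (intro divide_left_mono) (auto simp: q_def)
      also have "\<dots> = lam 1 / c * real q powr C" using c by (simp add: powr_minus field_simps)
      finally have "\<Lambda> \<le> ln (lam 1 / c * real q powr C)"
        unfolding \<Lambda>_def q_def[symmetric] using p1 c q by (subst ln_le_cancel_iff) (auto simp: q_def)
      also have "\<dots> = ln (lam 1 / c) + C * ln q" using p1 c q by (subst ln_mult) (auto simp: ln_powr)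
      also have "\<dots> \<le> C0 + C * (ln (real (m n) + 1) + ln (y + 1))"
      proof (intro add_mono mult_left_mono C)
        have "real q \<le> (real (m n) + 1) * (y + 1)"
        proof -
          have "real (m n) * real (l n) \<le> real (m n) * y" using ly by (intro mult_left_mono) auto
          then show ?thesis using y by (simp add: q_def algebra_simps)
        qed
        then have "ln q \<le> ln ((real (m n) + 1) * (y + 1))" using q y by (subst ln_le_cancel_iff) auto
        also have "\<dots> = ln (real (m n) + 1) + ln (y + 1)" using y by (subst ln_mult) auto
        finally show "ln q \<le> ln (real (m n) + 1) + ln (y + 1)" .
      qed (simp add: C0_def)
      finally show ?thesis by (simp add: algebra_simps)
    qed
    have mr: "real (m n) \<ge> y powr r"
    proof (rule ccontr)
      assume "\<not> real (m n) \<ge> y powr r"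
      then have mlt: "real (m n) < y powr r" by simp
      also have "y powr r \<le> y powr 1" using y r by (intro powr_mono) auto
      finally have "real (m n) \<le> y" using y by simp
      then have "ln (real (m n) + 1) \<le> ln (y + 1)" using y by (subst ln_le_cancel_iff) auto
      then have "C * ln (real (m n) + 1) \<le> C * ln (y + 1)" using C by (intro mult_left_mono)
      then have "\<Lambda> \<le> C0 + 2 * C * ln (y + 1)" using \<Lambda>le by simp
      then have "m n * \<Lambda> \<le> y powr r * (C0 + 2 * C * ln (y + 1))" using mlt \<Lambda>0 by (intro mult_mono) auto
      also have "\<dots> < 2 * y powr (2 * r)"
        using elim(1) y unfolding y_def[symmetric] by (simp add: divide_less_eq)
      finally show False using big by simp
    qed
    have mpos: "real (m n) > 0" using \<mu>(2) by simp
    have yr: "y powr r > 0" using y by simp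
    have "\<Lambda> / m n \<le> (C0 + C * ln (real (m n) + 1) + C * ln (y + 1)) / m n"
      using \<Lambda>le mpos by (intro divide_right_mono) auto
    also have "\<dots> = C0 / m n + C * (ln (real (m n) + 1) / m n) + C * ln (y + 1) / m n"
      by (simp add: add_divide_distrib)
    also have "\<dots> \<le> C0 / y powr r + C * (2 / sqrt (y powr r)) + C * ln (y + 1) / y powr r"
    proof (intro add_mono mult_left_mono C)
      show "C0 / m n \<le> C0 / y powr r" using C0 mr yr mpos by (intro divide_left_mono) auto
      have "C * ln (y + 1) \<ge> 0" using C y by simp
      then show "C * ln (y + 1) / m n \<le> C * ln (y + 1) / y powr r" using mr yr mpos by (intro divide_left_mono) auto
      have "ln (real (m n) + 1) / m n \<le> 2 * sqrt (m n) / m n"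
        using ln_add_one_le_sqrt[of "real (m n)"] by (intro divide_right_mono) auto
      also have "\<dots> = 2 / sqrt (m n)" using mpos by (simp add: real_div_sqrt field_simps)
      also have "\<dots> \<le> 2 / sqrt (y powr r)" using mr yr mpos by (intro divide_left_mono) auto
      finally show "ln (real (m n) + 1) / m n \<le> 2 / sqrt (y powr r)" .
    qed
    also have "\<dots> = g y" by (simp add: g_def)
    finally show ?case using \<Lambda>0 unfolding \<Lambda>_def y_def by simp
  qed
  then show ?thesis
    by (intro tendsto_sandwich[OF _ _ tendsto_const g0]) (auto elim: eventually_mono)
qed

subsection \<open>Asymptotic optimality\<close>

context gaussian_eigen
begin

text \<open>The dual bound at th = \<mu>. In the kept blocks the logarithms are compared with those
  of the leading eigenvalues, whose sum exactly cancels 2 \<mu> ln n; behind them every eigenvalue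
  lies below \<mu> and contributes itself.\<close>

lemma block_lower_bound:
  assumes l: "l \<ge> 1" and dec: "\<And>i. L (Suc i) \<le> L i" and \<mu>: "\<mu> > 0"
    and Lm: "L (m * l) < \<mu>" and sumln: "(\<Sum>j<m. ln (L (j * l) / \<mu>)) = 2 * ln n / l"
    and A: "finite A" "A \<noteq> {}" "card A \<le> n"
  shows "expectation (\<lambda>\<omega>. min_dist_sq A \<omega>) \<ge>
    real m * real l * \<mu> + (suminf L - (\<Sum>i<m * l. L i)) - \<mu> * l * ln (L 0 / L (m * l))"
proof -
  have anti: "L j \<le> L i" if "i \<le> j" for i j using lift_Suc_antimono_le[of L, OF dec that] .
  have lnq: "ln (L i / \<mu>) = ln (L i) - ln \<mu>" for i using L_pos[of i] \<mu> by (simp add: ln_div)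
  \<comment> \<open>Eigenvalues inside the last kept block may fall below \<mu>; there ln x at most
    x - 1 yields the same expression as a lower bound.\<close>
  have low: "min \<mu> x + \<mu> * max 0 (ln (x / \<mu>)) \<ge> \<mu> * (1 + ln (x / \<mu>))" if "x > 0" for x
  proof (cases "x \<ge> \<mu>")
    case True
    then show ?thesis using \<mu> that by (simp add: algebra_simps)
  next
    case False
    have "ln (x / \<mu>) \<le> x / \<mu> - 1" using that \<mu> by (intro ln_le_minus_one) simp
    then have "\<mu> * (1 + ln (x / \<mu>)) \<le> \<mu> * (x / \<mu>)" using \<mu> by (intro mult_left_mono) auto
    also have "\<dots> = x" using \<mu> by simp
    also have "x \<le> min \<mu> x + \<mu> * max 0 (ln (x / \<mu>))" using False \<mu> by simp
    finally show ?thesis .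
  qed
  \<comment> \<open>Each eigenvalue is at least the leading one of the next block. Summation shifts
    the block index by one, and the defect telescopes to l ln (L 0 / L (m l)).\<close>
  have blocks: "(\<Sum>i<m * l. ln (L i)) \<ge> l * ((\<Sum>j<m. ln (L (j * l))) + ln (L (m * l)) - ln (L 0))"
  proof -
    have "(\<Sum>i<m * l. ln (L i)) = (\<Sum>j<m. \<Sum>i\<in>{j * l..<j * l + l}. ln (L i))"
      by (rule sum.nat_group[symmetric])
    also have "\<dots> \<ge> (\<Sum>j<m. \<Sum>i\<in>{j * l..<j * l + l}. ln (L (Suc j * l)))"
    proof (intro sum_mono)
      fix j i assume "i \<in> {j * l..<j * l + l}"
      then have "L (Suc j * l) \<le> L i" by (intro anti) auto
      then show "ln (L (Suc j * l)) \<le> ln (L i)" using L_pos by (subst ln_le_cancel_iff)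
    qed
    also have "(\<Sum>j<m. \<Sum>i\<in>{j * l..<j * l + l}. ln (L (Suc j * l))) = l * (\<Sum>j<m. ln (L (Suc j * l)))"
      by (simp add: sum_distrib_left)
    also have "(\<Sum>j<m. ln (L (Suc j * l))) = (\<Sum>j<m. ln (L (j * l))) + ln (L (m * l)) - ln (L 0)"
    proof -
      have "ln (L 0) + (\<Sum>j<m. ln (L (Suc j * l))) = (\<Sum>j<Suc m. ln (L (j * l)))"
        by (subst sum.lessThan_Suc_shift) simp
      then show ?thesis by simp
    qed
    finally show ?thesis .
  qed
  have bound: "real m * real l * \<mu> + ((\<Sum>i<N. L i) - (\<Sum>i<m * l. L i)) - \<mu> * l * ln (L 0 / L (m * l))
     \<le> expectation (\<lambda>\<omega>. min_dist_sq A \<omega>)" if N: "N \<ge> m * l" for N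
  proof -
    have un: "{..<N} = {..<m * l} \<union> {m * l..<N}" using N by auto
    have split: "(\<Sum>i<N. f i) = (\<Sum>i<m * l. f i) + (\<Sum>i=m * l..<N. f i)" for f :: "nat \<Rightarrow> real"
      unfolding un by (rule sum.union_disjoint) auto
    have t1: "(\<Sum>i<m * l. min \<mu> (L i) + \<mu> * max 0 (ln (L i / \<mu>))) \<ge> (\<Sum>i<m * l. \<mu> * (1 + ln (L i / \<mu>)))"
      by (intro sum_mono low L_pos)
    have t2: "(\<Sum>i=m * l..<N. min \<mu> (L i) + \<mu> * max 0 (ln (L i / \<mu>))) = (\<Sum>i=m * l..<N. L i)"
    proof (rule sum.cong[OF refl])
      fix i assume "i \<in> {m * l..<N}"
      then have "L i < \<mu>" using anti[of "m * l" i] Lm by simp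
      moreover from this have "ln (L i / \<mu>) < 0" using L_pos[of i] \<mu> by simp
      ultimately show "min \<mu> (L i) + \<mu> * max 0 (ln (L i / \<mu>)) = L i" by simp
    qed
    have t3: "(\<Sum>i<m * l. \<mu> * (1 + ln (L i / \<mu>))) = real m * real l * \<mu> + \<mu> * ((\<Sum>i<m * l. ln (L i)) - real m * real l * ln \<mu>)"
      unfolding lnq by (simp add: sum_distrib_left[symmetric] sum.distrib sum_subtractf algebra_simps)
    have "2 * ln n = l * ((\<Sum>j<m. ln (L (j * l))) - m * ln \<mu>)"
      using sumln l unfolding lnq by (simp add: sum_subtractf field_simps)
    then have t4: "2 * \<mu> * ln n = \<mu> * (l * ((\<Sum>j<m. ln (L (j * l))) - m * ln \<mu>))" by simp
    have t5: "\<mu> * (\<Sum>i<m * l. ln (L i)) \<ge> \<mu> * (l * ((\<Sum>j<m. ln (L (j * l))) + ln (L (m * l)) - ln (L 0)))"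
      using blocks \<mu> by (intro mult_left_mono) auto
    have t6: "ln (L 0 / L (m * l)) = ln (L 0) - ln (L (m * l))" using L_pos[of 0] L_pos[of "m * l"] by (simp add: ln_div)
    have "(\<Sum>i<N. min \<mu> (L i) + \<mu> * max 0 (ln (L i / \<mu>))) - 2 * \<mu> * ln n \<le>
      expectation (\<lambda>\<omega>. min_dist_sq A \<omega>)"
      by (rule quantization_lower_bound[OF A \<mu>])
    moreover have "real m * real l * \<mu> + ((\<Sum>i<N. L i) - (\<Sum>i<m * l. L i)) - \<mu> * l * ln (L 0 / L (m * l)) \<le>
      (\<Sum>i<N. min \<mu> (L i) + \<mu> * max 0 (ln (L i / \<mu>))) - 2 * \<mu> * ln n"
      unfolding t4 t6 split[of "\<lambda>i. min \<mu> (L i) + \<mu> * max 0 (ln (L i / \<mu>))"] t2 split[of L]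
      using t1 t5 unfolding t3 by (simp add: algebra_simps)
    ultimately show ?thesis by linarith
  qed
  have "(\<lambda>N. real m * real l * \<mu> + ((\<Sum>i<N. L i) - (\<Sum>i<m * l. L i)) - \<mu> * l * ln (L 0 / L (m * l))) \<longlonglongrightarrow>
     real m * real l * \<mu> + (suminf L - (\<Sum>i<m * l. L i)) - \<mu> * l * ln (L 0 / L (m * l))"
    using L_sums by (intro tendsto_intros summable_LIMSEQ) (auto simp: sums_iff)
  then show ?thesis
    by (rule LIMSEQ_le_const2) (use bound in blast)
qed

lemma quant_number_lower_bound:
  assumes "n \<ge> 1" and "B \<ge> 0"
    and "\<And>A. finite A \<Longrightarrow> A \<noteq> {} \<Longrightarrow> card A \<le> n \<Longrightarrow> B \<le> expectation (\<lambda>\<omega>. min_dist_sq A \<omega>)"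
  shows "sqrt B \<le> quant_number M UNIV dist X n"
  unfolding quant_number_def
proof (rule cInf_greatest)
  show "{quant_err M dist X \<alpha> |\<alpha>. \<alpha> \<subseteq> UNIV \<and> finite \<alpha> \<and> \<alpha> \<noteq> {} \<and> card \<alpha> \<le> n} \<noteq> {}"
    using assms(1) by (auto intro!: exI[of _ "{0}"])
  show "sqrt B \<le> x" if "x \<in> {quant_err M dist X \<alpha> |\<alpha>. \<alpha> \<subseteq> UNIV \<and> finite \<alpha> \<and> \<alpha> \<noteq> {} \<and> card \<alpha> \<le> n}" for x
  proof -
    from that obtain \<alpha> where \<alpha>: "x = quant_err M dist X \<alpha>" "finite \<alpha>" "\<alpha> \<noteq> {}" "card \<alpha> \<le> n" by blast
    show ?thesis unfolding \<alpha>(1) quant_err_def by (rule real_sqrt_le_mono[OF assms(3)[OF \<alpha>(2-4)]])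
  qed
qed

end

theorem theorem5:
  fixes M :: "'w measure"
    and X :: "'w \<Rightarrow> 'h::{real_inner,banach,second_countable_topology}"
    and lam :: "nat \<Rightarrow> real" and u :: "nat \<Rightarrow> 'h"
    and \<phi> :: "real \<Rightarrow> real" and s b \<theta> :: real
    and \<alpha> :: "nat \<Rightarrow> nat \<Rightarrow> (nat \<Rightarrow> real) set"
    and Zhat :: "nat \<Rightarrow> nat \<Rightarrow> 'w \<Rightarrow> nat \<Rightarrow> real"
  assumes "prob_space M"
    and "centered_gaussian M X"
    and "\<forall>j\<ge>1. lam j > 0 \<and> lam (Suc j) \<le> lam j"
    and "\<forall>j\<ge>1. \<forall>k\<ge>1. u j \<bullet> u k = (if j = k then 1 else 0)"
    and "\<forall>j\<ge>1. cov_op M X (u j) = lam j *\<^sub>R u j"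
    and "\<forall>y. (\<forall>j\<ge>1. y \<bullet> u j = 0) \<longrightarrow> cov_op M X y = 0"
    and "s \<ge> 0" and "b > 1"
    and "\<forall>x y. s < x \<and> x \<le> y \<longrightarrow> \<phi> y \<le> \<phi> x"
    and "reg_varying s \<phi> (- b)"
    and "lam \<sim>[sequentially] (\<lambda>j. \<phi> (real j))"
    and "0 < \<theta>" and "\<theta> < 1"
    and "\<forall>n\<ge>1. \<forall>j\<in>{1..blockNum lam n (blockLen \<theta> n)}.
           optimal_quantizer M (Rl (blockLen \<theta> n)) (euclid_dist (blockLen \<theta> n))
             (Zblock X lam u (blockLen \<theta> n) j)
             (blockSize lam n (blockLen \<theta> n) (blockNum lam n (blockLen \<theta> n)) j) (\<alpha> n j) \<and>
           voronoi_quantization (blockLen \<theta> n) M (\<alpha> n j)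
             (Zblock X lam u (blockLen \<theta> n) j) (Zhat n j)"
  shows "(\<lambda>n. sqrt (\<integral>\<omega>. (norm (X \<omega> -
            (\<Sum>j=1..blockNum lam n (blockLen \<theta> n). \<Sum>k=1..blockLen \<theta> n.
               (sqrt (lam ((j - 1) * blockLen \<theta> n + k)) * Zhat n j \<omega> (k - 1)) *\<^sub>R
                 u ((j - 1) * blockLen \<theta> n + k))))\<^sup>2 \<partial>M))
         \<sim>[sequentially] (\<lambda>n. quant_number M UNIV dist X n)"
proof -
  define L where "L i = lam (Suc i)" for i
  define v where "v i = u (Suc i)" for i
  interpret gaussian_eigen M X L v
  proof (intro gaussian_eigen.intro gaussian_eigen_axioms.intro assms(1,2))
    show "L i > 0" for i using assms(3) by (simp add: L_def)
    show "orthonormal_seq v" using assms(4) by (simp add: orthonormal_seq_def v_def)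
    show "cov_op M X (v i) = L i *\<^sub>R v i" for i using assms(5) by (simp add: L_def v_def)
    show "cov_op M X y = 0" if "\<And>i. y \<bullet> v i = 0" for y
    proof -
      have "y \<bullet> u j = 0" if "j \<ge> 1" for j
        using \<open>\<And>i. y \<bullet> v i = 0\<close>[of "j - 1"] that by (simp add: v_def)
      then show ?thesis using assms(6) by blast
    qed
  qed
  have pos: "lam i > 0" if "i \<ge> 1" for i using assms(3) that by blast
  have dec: "lam (Suc i) \<le> lam i" if "i \<ge> 1" for i using assms(3) that by blast
  have decL: "L (Suc i) \<le> L i" for i using dec[of "Suc i"] by (simp add: L_def)
  have "L \<longlonglongrightarrow> 0" using L_sums by (intro summable_LIMSEQ_zero) (simp add: sums_iff)
  then have lim: "lam \<longlonglongrightarrow> 0" unfolding L_def by (rule LIMSEQ_imp_Suc)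
  define l where "l n = blockLen \<theta> n" for n
  define m where "m n = blockNum lam n (l n)" for n
  define U where "U n = sqrt (\<integral>\<omega>. (norm (X \<omega> -
            (\<Sum>j=1..m n. \<Sum>k=1..l n. (sqrt (lam ((j - 1) * l n + k)) * Zhat n j \<omega> (k - 1)) *\<^sub>R
                 u ((j - 1) * l n + k))))\<^sup>2 \<partial>M)" for n
  define e where "e n = quant_number M UNIV dist X n" for n
  define R where "R n = ln (L 0 / L (m n * l n)) / m n" for n
  obtain c where c: "c > 0" "\<And>j. j \<ge> 1 \<Longrightarrow> lam j \<ge> c * real j powr (- (b + 1))"
    using regularly_varying_polynomial_lower_bound[OF pos dec _ assms(10,11)] assms(8) by (metis less_imp_le order_trans zero_le_one)
  have R0: "R \<longlonglongrightarrow> 0"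
    using block_log_ratio_tendsto_0[OF pos dec lim c(1) _ c(2) assms(12,13)] assms(8)
    unfolding R_def L_def m_def l_def by simp
  have lim4: "(\<lambda>n. 4 powr (1 / real (l n))) \<longlonglongrightarrow> (4::real) powr 0"
  proof -
    have "((\<lambda>k. 4 powr (1 / real k)) \<longlongrightarrow> (4::real) powr 0) sequentially"
      by (intro tendsto_intros lim_const_over_n) auto
    then show ?thesis unfolding l_def by (rule filterlim_compose[OF _ blockLen_at_top[OF assms(12)]])
  qed
  have l_ev: "\<forall>\<^sub>F n in sequentially. l n \<ge> k" for k
    using blockLen_at_top[OF assms(12)] unfolding l_def filterlim_at_top by blast
  \<comment> \<open>The sandwich at a fixed n: \<open>e\<close> is the optimal error,
    \<open>U\<close> that of the block quantizer, and \<open>RC\<close> the coding bound for block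
    length \<open>l n\<close> and every number of points.\<close>
  have bounds: "\<exists>V>0. V * (1 - R n) \<le> (e n)\<^sup>2 \<and> e n \<le> U n \<and> (U n)\<^sup>2 \<le> (1 + \<epsilon>) * 4 powr (1 / l n) * V"
    if n: "n \<ge> 1" and ln1: "l n \<ge> 1" and R1: "R n \<le> 1" and \<epsilon>: "\<epsilon> > 0"
      and RC: "\<And>k. k \<ge> 1 \<Longrightarrow> \<exists>A. finite A \<and> A \<noteq> {} \<and> card A \<le> k \<and>
        code_error (l n) A
          \<le> ennreal ((1 + \<epsilon>) * (l n * real k powr (- 2 / l n)))"
    for n \<epsilon>
  proof -
    let ?l = "l n" and ?m = "m n"
    let ?N = "\<lambda>j. blockSize lam n ?l ?m (Suc j)"
    obtain \<mu> where \<mu>0: "\<mu> > 0" "?m \<ge> 1" "\<And>j. j < ?m \<Longrightarrow> \<mu> \<le> lam (j * ?l + 1)" "lam (?m * ?l + 1) < \<mu>"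
      "(\<Sum>j<?m. ln (lam (j * ?l + 1) / \<mu>)) = 2 * ln n / ?l"
      "\<And>j. j < ?m \<Longrightarrow> ?N j \<ge> 1"
      "\<And>j. j < ?m \<Longrightarrow> real (?N j) powr (- 2 / ?l) \<le> 4 powr (1 / ?l) * (\<mu> / lam (j * ?l + 1))"
      "(\<Prod>j<?m. ?N j) \<le> n"
      by (rule block_parameters[OF n ln1 pos dec lim, folded m_def]) (assumption | rule that)+
    have lamL: "lam (i + 1) = L i" for i by (simp add: L_def)
    note \<mu> = \<mu>0[unfolded lamL]
    define tail where "tail = suminf L - (\<Sum>i<?m * ?l. L i)"
    define V where "V = real ?m * real ?l * \<mu> + tail"
    have tail0: "tail \<ge> 0"
    proof -
      have "(\<Sum>i<?m * ?l. L i) \<le> suminf L"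
        using sums_summable[OF L_sums] L_pos by (intro sum_le_suminf) (auto simp: less_imp_le)
      then show ?thesis by (simp add: tail_def)
    qed
    have ml: "real ?m * real ?l * \<mu> > 0" using \<mu>(1,2) ln1 by simp
    have V: "V > 0" "V \<ge> real ?m * real ?l * \<mu>" using ml tail0 by (auto simp: V_def)
    have low: "V * (1 - R n) \<le> (e n)\<^sup>2"
    proof -
      have R0: "R n \<ge> 0"
      proof -
        have "L (?m * ?l) \<le> L 0" using lift_Suc_antimono_le[of L, OF decL] by simp
        then show ?thesis unfolding R_def using L_pos by simp
      qed
      have B0: "V * (1 - R n) \<ge> 0" using V R1 by simp
      have "sqrt (V * (1 - R n)) \<le> e n"
        unfolding e_def
      proof (rule quant_number_lower_bound[OF n B0])
        fix A :: "'h set" assume A: "finite A" "A \<noteq> {}" "card A \<le> n"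
        have "V * (1 - R n) \<le> V - real ?m * real ?l * \<mu> * R n"
          using mult_right_mono[OF V(2) R0] by (simp add: right_diff_distrib)
        also have "real ?m * real ?l * \<mu> * R n = \<mu> * ?l * ln (L 0 / L (?m * ?l))"
          using \<mu>(2) by (simp add: R_def)
        also have "V - \<mu> * ?l * ln (L 0 / L (?m * ?l)) \<le> expectation (\<lambda>\<omega>. min_dist_sq A \<omega>)"
          unfolding V_def tail_def
          by (rule block_lower_bound[OF ln1 decL \<mu>(1,4,5) A])
        finally show "V * (1 - R n) \<le> expectation (\<lambda>\<omega>. min_dist_sq A \<omega>)" .
      qed
      then have "(sqrt (V * (1 - R n)))\<^sup>2 \<le> (e n)\<^sup>2" using B0 by (intro power_mono) auto
      then show ?thesis using B0 by simp
    qed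
    have Zb: "Zblock X lam u ?l (Suc j) = block ?l j" for j
      by (intro ext) (simp add: Zblock_def block_def Z_def L_def v_def)
    have ov: "optimal_quantizer M (Rl ?l) (euclid_dist ?l) (Zblock X lam u ?l (Suc j)) (?N j) (\<alpha> n (Suc j)) \<and>
       voronoi_quantization ?l M (\<alpha> n (Suc j)) (Zblock X lam u ?l (Suc j)) (Zhat n (Suc j))" if "j < ?m" for j
      using assms(14) n that unfolding m_def l_def by auto
    have opt: "optimal_quantizer M (Rl ?l) (euclid_dist ?l) (block ?l j) (?N j) (\<alpha> n (Suc j))"
      and vor: "voronoi_quantization ?l M (\<alpha> n (Suc j)) (block ?l j) (Zhat n (Suc j))" if "j < ?m" for j
      using ov[OF that] unfolding Zb by blast+
    have fin: "finite (\<alpha> n (Suc j))" "\<alpha> n (Suc j) \<noteq> {}" "card (\<alpha> n (Suc j)) \<le> ?N j" if "j < ?m" for j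
      using opt[OF that] by (auto simp: optimal_quantizer_def)
    note vorD = voronoi_quantizationD[OF vor fin(1,2) block_measurable block_Rl]
    define Xhat where "Xhat \<omega> = (\<Sum>i<?m * ?l. (sqrt (L i) * Zhat n (Suc (i div ?l)) \<omega> (i mod ?l)) *\<^sub>R v i)" for \<omega>
    have Xhat: "(\<Sum>j=1..?m. \<Sum>k=1..?l. (sqrt (lam ((j - 1) * ?l + k)) * Zhat n j \<omega> (k - 1)) *\<^sub>R u ((j - 1) * ?l + k)) = Xhat \<omega>" for \<omega>
    proof -
      have "(\<Sum>j=1..?m. \<Sum>k=1..?l. (sqrt (lam ((j - 1) * ?l + k)) * Zhat n j \<omega> (k - 1)) *\<^sub>R u ((j - 1) * ?l + k)) =
        (\<Sum>j<?m. \<Sum>k<?l. (sqrt (L (j * ?l + k)) * Zhat n (Suc j) \<omega> k) *\<^sub>R v (j * ?l + k))"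
        unfolding One_nat_def
        by (simp add: sum.atLeast1_atMost_eq[unfolded One_nat_def] L_def v_def)
      also have "\<dots> = (\<Sum>j<?m. \<Sum>i\<in>{j * ?l..<j * ?l + ?l}. (sqrt (L i) * Zhat n (Suc (i div ?l)) \<omega> (i mod ?l)) *\<^sub>R v i)"
      proof (rule sum.cong[OF refl])
        fix j
        show "(\<Sum>k<?l. (sqrt (L (j * ?l + k)) * Zhat n (Suc j) \<omega> k) *\<^sub>R v (j * ?l + k)) =
          (\<Sum>i\<in>{j * ?l..<j * ?l + ?l}. (sqrt (L i) * Zhat n (Suc (i div ?l)) \<omega> (i mod ?l)) *\<^sub>R v i)"
          by (rule sum.reindex_bij_witness[of _ "\<lambda>i. i - j * ?l" "\<lambda>k. j * ?l + k"]) auto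
      qed
      also have "\<dots> = Xhat \<omega>" unfolding Xhat_def by (rule sum.nat_group)
      finally show ?thesis .
    qed
    have UX: "U n = sqrt (expectation (\<lambda>\<omega>. (norm (X \<omega> - Xhat \<omega>))\<^sup>2))"
      unfolding U_def Xhat ..
    have prodN: "(\<Prod>j<?m. card (\<alpha> n (Suc j))) \<le> n"
      by (rule order_trans[OF prod_mono \<mu>(8)]) (use fin(3) in auto)
    note blk = block_sum_quantization[where \<alpha>="\<lambda>j. \<alpha> n (Suc j)" and Zh="\<lambda>j. Zhat n (Suc j)",
        OF ln1 decL fin(1) vorD(1) vorD(2) prodN, folded Xhat_def]
    have eU: "e n \<le> U n" unfolding UX e_def by (rule blk(2))
    have "(U n)\<^sup>2 = expectation (\<lambda>\<omega>. (norm (X \<omega> - Xhat \<omega>))\<^sup>2)"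
      unfolding UX by (simp add: Bochner_Integration.integral_nonneg)
    also have "\<dots> \<le> tail + (\<Sum>j<?m. L (j * ?l) * expectation (\<lambda>\<omega>. sq_dist ?l (block ?l j \<omega>) (Zhat n (Suc j) \<omega>)))"
      unfolding tail_def by (rule blk(1))
    \<comment> \<open>The bound for the chosen block size is proportional to \<mu> over the leading
      eigenvalue, so the eigenvalue cancels and every block gets the same bound.\<close>
    also have "\<dots> \<le> tail + (\<Sum>j<?m. (1 + \<epsilon>) * 4 powr (1 / ?l) * (?l * \<mu>))"
    proof (intro add_left_mono sum_mono)
      fix j assume "j \<in> {..<?m}"
      then have j: "j < ?m" by simp
      obtain A where A: "finite A" "A \<noteq> {}" "card A \<le> ?N j"
        "code_error ?l A
          \<le> ennreal ((1 + \<epsilon>) * (?l * real (?N j) powr (- 2 / ?l)))"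
        using RC[OF \<mu>(6)[OF j]] by blast
      have "expectation (\<lambda>\<omega>. sq_dist ?l (block ?l j \<omega>) (Zhat n (Suc j) \<omega>)) = (quant_err M (euclid_dist ?l) (block ?l j) (\<alpha> n (Suc j)))\<^sup>2"
        by (rule vorD(3)[OF j j j, symmetric])
      also have "\<dots> \<le> (1 + \<epsilon>) * (?l * real (?N j) powr (- 2 / ?l))"
        using \<epsilon> by (intro optimal_gaussian_quantizer_error[OF block_measurable block_law[OF ln1] A _ opt[OF j]]) auto
      also have "\<dots> \<le> (1 + \<epsilon>) * (?l * (4 powr (1 / ?l) * (\<mu> / L (j * ?l))))"
        using \<mu>(7)[OF j] \<epsilon> by (intro mult_left_mono) auto
      finally have "L (j * ?l) * expectation (\<lambda>\<omega>. sq_dist ?l (block ?l j \<omega>) (Zhat n (Suc j) \<omega>)) \<le>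
         L (j * ?l) * ((1 + \<epsilon>) * (?l * (4 powr (1 / ?l) * (\<mu> / L (j * ?l)))))"
        using L_pos[of "j * ?l"] by (intro mult_left_mono) auto
      also have "\<dots> = (1 + \<epsilon>) * 4 powr (1 / ?l) * (?l * \<mu>)"
        using L_pos[of "j * ?l"] by (simp add: field_simps)
      finally show "L (j * ?l) * expectation (\<lambda>\<omega>. sq_dist ?l (block ?l j \<omega>) (Zhat n (Suc j) \<omega>)) \<le>
        (1 + \<epsilon>) * 4 powr (1 / ?l) * (?l * \<mu>)" .
    qed
    also have "\<dots> = 1 * tail + (1 + \<epsilon>) * 4 powr (1 / ?l) * (real ?m * real ?l * \<mu>)" by (simp add: mult_ac)
    \<comment> \<open>The tail is enlarged by the same factor, which is at least 1, so that V
      factors out.\<close>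
    also have "\<dots> \<le> (1 + \<epsilon>) * 4 powr (1 / ?l) * tail + (1 + \<epsilon>) * 4 powr (1 / ?l) * (real ?m * real ?l * \<mu>)"
    proof -
      have "(4::real) powr (1 / ?l) \<ge> 1" by (intro ge_one_powr_ge_zero) auto
      then have "1 * 1 \<le> (1 + \<epsilon>) * 4 powr (1 / ?l)" using \<epsilon> by (intro mult_mono) auto
      then show ?thesis using tail0 by (intro add_right_mono mult_right_mono) auto
    qed
    also have "\<dots> = (1 + \<epsilon>) * 4 powr (1 / ?l) * V" by (simp add: V_def algebra_simps)
    finally show ?thesis using V low eU by blast
  qed
  have "(\<lambda>n. U n / e n) \<longlonglongrightarrow> 1"
  proof (rule tendstoI)
    fix \<delta> :: real assume \<delta>: "\<delta> > 0"
    obtain l0 where l0: "l0 \<ge> 1" "\<And>l k. l \<ge> l0 \<Longrightarrow> k \<ge> 1 \<Longrightarrow> \<exists>A. finite A \<and> A \<noteq> {} \<and> card A \<le> k \<and>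
      code_error l A
        \<le> ennreal ((1 + \<delta>) * (l * real k powr (- 2 / l)))"
      using gaussian_random_coding[OF \<delta>] by blast
    \<comment> \<open>The limit 1 + \<delta> lies strictly below (1 + \<delta>)^2. This gap absorbs
      4^(1/l) and 1 / (1 - R n), and the square root returns 1 + \<delta>.\<close>
    have "(\<lambda>n. (1 + \<delta>) * 4 powr (1 / real (l n)) / (1 - R n)) \<longlonglongrightarrow> (1 + \<delta>) * 4 powr 0 / (1 - 0)"
      by (intro tendsto_intros lim4 R0) auto
    then have ev1: "\<forall>\<^sub>F n in sequentially. (1 + \<delta>) * 4 powr (1 / real (l n)) / (1 - R n) < (1 + \<delta>)\<^sup>2"
      by (rule order_tendstoD) (use \<delta> in \<open>simp add: power2_eq_square\<close>)
    have ev2: "\<forall>\<^sub>F n in sequentially. R n < 1" by (rule order_tendstoD[OF R0]) simp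
    show "\<forall>\<^sub>F n in sequentially. dist (U n / e n) 1 < \<delta>"
      using ev1 ev2 l_ev[of l0] eventually_ge_at_top[of 1]
    proof eventually_elim
      case (elim n)
      have "l n \<ge> 1" "R n \<le> 1" using elim l0(1) by auto
      then obtain V where V: "V > 0" "V * (1 - R n) \<le> (e n)\<^sup>2" "e n \<le> U n" "(U n)\<^sup>2 \<le> (1 + \<delta>) * 4 powr (1 / l n) * V"
        using bounds[OF elim(4) _ _ \<delta> l0(2)[OF elim(3)]] by blast
      have "(e n)\<^sup>2 > 0" using V(1,2) elim(2) by (smt (verit) mult_pos_pos)
      moreover have "e n \<ge> 0" unfolding e_def
      proof (rule order_trans[OF _ quant_number_lower_bound[of n 0]])
        show "0 \<le> expectation (\<lambda>\<omega>. min_dist_sq A \<omega>)" for A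
          by (rule Bochner_Integration.integral_nonneg) simp
      qed (use elim(4) in auto)
      ultimately have e: "e n > 0" by (simp add: less_le)
      have V': "V \<le> (e n)\<^sup>2 / (1 - R n)" using V(2) elim(2) by (simp add: le_divide_eq)
      have "(U n)\<^sup>2 \<le> (1 + \<delta>) * 4 powr (1 / l n) * ((e n)\<^sup>2 / (1 - R n))"
        by (rule order_trans[OF V(4) mult_left_mono[OF V']]) (use \<delta> in simp)
      also have "\<dots> = (1 + \<delta>) * 4 powr (1 / real (l n)) / (1 - R n) * (e n)\<^sup>2" by simp
      also have "\<dots> < (1 + \<delta>)\<^sup>2 * (e n)\<^sup>2" using elim(1) e by (intro mult_strict_right_mono) auto
      finally have "(U n)\<^sup>2 < ((1 + \<delta>) * e n)\<^sup>2" by (simp add: power_mult_distrib)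
      then have "U n < (1 + \<delta>) * e n" using e \<delta> by (intro power2_less_imp_less[of "U n"]) auto
      then have "U n / e n < 1 + \<delta>" using e by (simp add: divide_less_eq)
      moreover have "U n / e n \<ge> 1" using V(3) e by (simp add: le_divide_eq)
      ultimately show ?case by (simp add: dist_real_def)
    qed
  qed
  then have "U \<sim>[sequentially] e" by (rule asymp_equivI')
  then show ?thesis unfolding U_def[abs_def] e_def[abs_def] m_def l_def .
qed

end
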